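(* Let $p_k$ denote the limit as $n\to\infty$ (with $k$ fixed) of the probability that the min mean-weight cycle has length $k$. For the directed complete graph with i.i.d. exponential mean-$1$ arc weights, where $p_k=\frac{k^k}{k!}\int_0^{1/e}\frac{c^k e^c}{T(c)}\,dc$ for $k\ge2$, one has $$p_k=(1+o(1))\,\frac{e^{-1+1/e}}{\sqrt{2\pi}}\,k^{-3/2}\quad(k\to\infty),\qquad \sum_{k\ge2}p_k=1-e^{-1+1/e}<1.$$ For the undirected complete graph with i.i.d. exponential mean-$1$ edge weights, where $p_k=\frac{k^k}{2\,k!}\int_0^{1/e}\frac{c^{k-1/2}e^{c/2+c^2/2}}{\sqrt{T(c)}}\,dc$ for $k\ge3$, one has $$p_k=(1+o(1))\,\frac{e^{-\frac12+\frac1{2e}+\frac1{2e^2}}}{2\sqrt{2\pi}}\,k^{-3/2}\quad(k\to\infty),\qquad \sum_{k\ge3}p_k=1-e^{-\frac12+\frac1{2e}+\frac1{2e^2}}<1.$$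
   Context: The directed complete graph on $n$ vertices has one arc for each ordered pair of distinct vertices; its cycles are simple directed cycles, of length at least $2$. The undirected complete graph has one edge for each unordered pair of distinct vertices; its cycles are simple cycles, of length at least $3$. Edge (arc) weights are i.i.d. exponential with mean $1$. The mean weight of a cycle is the sum of its edge weights divided by its length (number of edges). The min mean-weight cycle is the cycle of smallest mean weight (almost surely unique). The tree function is $T(z)=\sum_{k=1}^\infty k^{k-1}\frac{z^k}{k!}$, convergent for $|z|\le 1/e$; it satisfies $T(z)=ze^{T(z)}$. *)

theory Defs
  imports "HOL-Probability.Probability" "HOL-Library.Landau_Symbols"
begin

text \<open>A simple cycle is given by its set of arcs (or edges), so that the vertex lists which differ
  by a rotation (or, in the undirected case, a reflection) give the same cycle.  The length of a
  cycle is then the cardinality of this set.\<close>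

definition directed_arcs :: "nat \<Rightarrow> (nat \<times> nat) set" where
  "directed_arcs n = {(u, v). u < n \<and> v < n \<and> u \<noteq> v}"

definition arcs_of :: "nat list \<Rightarrow> (nat \<times> nat) set" where
  "arcs_of vs = {(vs ! i, vs ! (Suc i mod length vs)) | i. i < length vs}"

definition directed_cycles :: "nat \<Rightarrow> (nat \<times> nat) set set" where
  "directed_cycles n =
     {arcs_of vs | vs. distinct vs \<and> set vs \<subseteq> {..<n} \<and> length vs \<ge> 2}"

definition undirected_edges :: "nat \<Rightarrow> nat set set" where
  "undirected_edges n = {{u, v} | u v. u < n \<and> v < n \<and> u \<noteq> v}"

definition edges_of :: "nat list \<Rightarrow> nat set set" where
  "edges_of vs = {{vs ! i, vs ! (Suc i mod length vs)} | i. i < length vs}"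

definition undirected_cycles :: "nat \<Rightarrow> nat set set set" where
  "undirected_cycles n =
     {edges_of vs | vs. distinct vs \<and> set vs \<subseteq> {..<n} \<and> length vs \<ge> 3}"

lemma card_arcs_of:
  assumes "distinct vs"
  shows "card (arcs_of vs) = length vs"
proof -
  have "arcs_of vs = (\<lambda>i. (vs ! i, vs ! (Suc i mod length vs))) ` {..<length vs}"
    by (auto simp: arcs_of_def)
  moreover have "inj_on (\<lambda>i. (vs ! i, vs ! (Suc i mod length vs))) {..<length vs}"
    using assms by (auto simp: inj_on_def nth_eq_iff_index_eq)
  ultimately show ?thesis
    by (simp add: card_image)
qed

lemma card_edges_of:
  assumes "distinct vs" "length vs \<ge> 3"
  shows "card (edges_of vs) = length vs"
proof -
  let ?k = "length vs"
  let ?e = "\<lambda>i. {vs ! i, vs ! (Suc i mod ?k)}"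
  have "inj_on ?e {..<?k}"
  proof (rule inj_onI, goal_cases)
    case (1 i j)
    then have ij: "i < ?k" "j < ?k" by auto
    have m: "Suc i mod ?k < ?k" "Suc j mod ?k < ?k"
      using ij by (auto intro!: mod_less_divisor)
    consider "vs ! i = vs ! j"
      | "vs ! i = vs ! (Suc j mod ?k)" "vs ! j = vs ! (Suc i mod ?k)"
      using 1(3) by (auto simp: doubleton_eq_iff)
    then show ?case
    proof cases
      case 1
      then show ?thesis
        using ij assms(1) by (simp add: nth_eq_iff_index_eq)
    next
      case 2
      then have eq: "i = Suc j mod ?k" "j = Suc i mod ?k"
        using ij m assms(1) nth_eq_iff_index_eq by blast+
      have wrap: "Suc l mod ?k = (if Suc l = ?k then 0 else Suc l)" if "l < ?k" for l
        using that by simp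
      show ?thesis
        using eq[unfolded wrap[OF ij(1)] wrap[OF ij(2)]] assms(2) by presburger
    qed
  qed
  moreover have "edges_of vs = ?e ` {..<?k}"
    by (auto simp: edges_of_def)
  ultimately show ?thesis
    by (simp add: card_image)
qed

definition exp_weights :: "'e set \<Rightarrow> ('e \<Rightarrow> real) measure" where
  "exp_weights E = PiM E (\<lambda>_. density lborel (exponential_density 1))"

definition mean_weight :: "('e \<Rightarrow> real) \<Rightarrow> 'e set \<Rightarrow> real" where
  "mean_weight w C = (\<Sum>e\<in>C. w e) / real (card C)"

text \<open>Ties between distinct cycles have probability zero, so it is immaterial that the minimiser is
  not required to be unique here.\<close>

definition min_mean_length_prob :: "'e set \<Rightarrow> 'e set set \<Rightarrow> nat \<Rightarrow> real" where
  "min_mean_length_prob E \<C> k =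
     \<P>(w in exp_weights E. \<exists>C. is_arg_min (mean_weight w) (\<lambda>C. C \<in> \<C>) C \<and> card C = k)"

definition directed_prob :: "nat \<Rightarrow> nat \<Rightarrow> real" where
  "directed_prob n k = min_mean_length_prob (directed_arcs n) (directed_cycles n) k"

definition undirected_prob :: "nat \<Rightarrow> nat \<Rightarrow> real" where
  "undirected_prob n k = min_mean_length_prob (undirected_edges n) (undirected_cycles n) k"

definition directed_p :: "nat \<Rightarrow> real" where
  "directed_p k = lim (\<lambda>n. directed_prob n k)"

definition undirected_p :: "nat \<Rightarrow> real" where
  "undirected_p k = lim (\<lambda>n. undirected_prob n k)"

definition tree_fun :: "real \<Rightarrow> real" where
  "tree_fun z = (\<Sum>j. real (Suc j) ^ j * z ^ Suc j / fact (Suc j))"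

end

theory Submission
  imports Defs "HOL-Complex_Analysis.Complex_Analysis" "HOL-Real_Asymp.Real_Asymp"
begin

text \<open>The expected number of \<open>k\<close>-cycles of mean weight at most \<open>c/n\<close> tends to
  \<open>\<lambda>\<^sub>k(c) = \<kappa> k\<^bsup>k-1\<^esup> c\<^sup>k / k!\<close>, with \<open>\<kappa> = 1\<close> for directed and \<open>\<kappa> = 1/2\<close> for undirected cycles.
  Two distinct cycles that share an edge have more edges than vertices, so such pairs do not matter.
  Edge-disjoint cycles are independent; hence the probability that the minimiser has
  length \<open>k\<close> and mean weight in a short window from \<open>a/n\<close> to \<open>b/n\<close> is, up to an error quadratic
  in the length of the window, \<open>\<lambda>\<^sub>k(b) - \<lambda>\<^sub>k(a)\<close> times the probability that no cycle lies below \<open>a/n\<close>.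
  For cycles of bounded length this is a discretised differential equation, whose solution gives the
  density \<open>\<lambda>\<^sub>k' exp (-\<Lambda>)\<close> with \<open>\<Lambda>\<close> the sum of the \<open>\<lambda>\<^sub>j\<close>.
  The bound on the length is removed by a union bound for \<open>c \<le> 1/e\<close>, where \<open>\<Lambda>(c)\<close> converges; for
  \<open>c > 1/e\<close> it diverges, so there already is a short cycle below \<open>c/n\<close> with probability tending to 1.
  Finally \<open>\<Lambda>\<close> is expressed through \<open>T\<close>, and \<open>T = z exp T\<close>, \<open>T(1/e) = 1\<close> and
  Stirling's formula give the explicit forms.\<close>

section \<open>Independent exponential weights\<close>

text \<open>The obstacle is the order of limits. Intersecting pairs cost a factor
  \<open>max 1 (K * c) ^ (2 * K)\<close>, harmless only if the length bound \<open>K\<close> is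
  fixed before \<open>n\<close> grows; hence the truncation. The threshold \<open>1/e\<close> is
  where \<open>k^(k-1) c^k / k!\<close>, of order \<open>(e c)^k k^(-3/2)\<close>, turns from
  summable into unbounded. At the threshold itself \<Lambda> is still finite. So with limiting
  probability \<open>exp (- \<Lambda>(1/e))\<close> no cycle of bounded length lies below
  \<open>1/(e n)\<close>, and in that case the length of the minimiser escapes to infinity; this is
  the mass by which the \<open>p_k\<close> fall short of 1. The window argument yields the joint law
  of length and minimum from first moments and pair bounds alone. The decay \<open>k^(-3/2)\<close>
  combines \<open>k^k / k!\<close>, of order \<open>e^k k^(-1/2)\<close>, with an integral of order
  \<open>e^(-k) / k\<close> that concentrates at the right end point, so that only the value of
  \<open>exp (- \<Lambda>)\<close> at \<open>1/e\<close> enters the constant.\<close>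

lemma prob_space_exp_weights: "prob_space (exp_weights E)"
  unfolding exp_weights_def
  by (intro prob_space_PiM prob_space_exponential_density) simp

lemma sets_exp_weights [measurable_cong]: "sets (exp_weights E) = sets (PiM E (\<lambda>_. borel))"
  unfolding exp_weights_def by (intro sets_PiM_cong) simp_all

lemma space_exp_weights: "space (exp_weights E) = PiE E (\<lambda>_. UNIV)"
  unfolding exp_weights_def by (simp add: space_PiM)

lemma measurable_exp_weights_component:
  "e \<in> E \<Longrightarrow> (\<lambda>w. w e) \<in> borel_measurable (exp_weights E)"
  by measurable

lemma distr_exp_weights_component:
  assumes "e \<in> E"
  shows "distr (exp_weights E) borel (\<lambda>w. w e) = density lborel (exponential_density 1)"
proof -
  interpret product_prob_space "\<lambda>_. density lborel (exponential_density 1)" E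
    by (intro product_prob_spaceI prob_space_exponential_density) simp
  have "distr (exp_weights E) borel (\<lambda>w. w e) =
      distr (exp_weights E) (density lborel (exponential_density 1)) (\<lambda>w. w e)"
    by (intro distr_cong) simp_all
  also have "\<dots> = density lborel (exponential_density 1)"
    unfolding exp_weights_def using PiM_component[OF assms] by simp
  finally show ?thesis .
qed

lemma indep_vars_exp_weights:
  assumes "E \<noteq> {}"
  shows "prob_space.indep_vars (exp_weights E) (\<lambda>_. borel) (\<lambda>e w. w e) E"
proof -
  interpret prob_space "exp_weights E" by (rule prob_space_exp_weights)
  have "distr (exp_weights E) (PiM E (\<lambda>_. borel)) (\<lambda>w. \<lambda>e\<in>E. w e) =
      distr (exp_weights E) (exp_weights E) (\<lambda>w. w)"
    by (intro distr_cong) (auto simp: sets_exp_weights space_exp_weights)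
  also have "\<dots> = PiM E (\<lambda>e. distr (exp_weights E) borel (\<lambda>w. w e))"
    unfolding distr_id exp_weights_def[of E]
    by (intro PiM_cong refl) (simp add: distr_exp_weights_component flip: exp_weights_def)
  finally show ?thesis
    using assms by (subst indep_vars_iff_distr_eq_PiM') auto
qed

lemma borel_measurable_mean_weight:
  assumes "C \<subseteq> E"
  shows "(\<lambda>w. mean_weight w C) \<in> borel_measurable (exp_weights E)"
  unfolding mean_weight_def
  using assms by (intro borel_measurable_divide borel_measurable_sum borel_measurable_const)
    (auto intro!: measurable_exp_weights_component)

context
  fixes E :: "'e set"
  assumes fin: "finite E"
begin

interpretation prob_space "exp_weights E" by (rule prob_space_exp_weights)

lemma indep_vars_subset_exp_weights:
  assumes "C \<subseteq> E" "C \<noteq> {}"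
  shows "indep_vars (\<lambda>_. borel) (\<lambda>e w. w e) C"
  using assms by (intro indep_vars_subset[OF indep_vars_exp_weights assms(1)]) auto

lemma distributed_exp_weights:
  assumes "e \<in> E"
  shows "distributed (exp_weights E) lborel (\<lambda>w. w e) (exponential_density 1)"
proof -
  have "distr (exp_weights E) lborel (\<lambda>w. w e) = distr (exp_weights E) borel (\<lambda>w. w e)"
    by (intro distr_cong) simp_all
  moreover have "(\<lambda>w. w e) \<in> borel_measurable (exp_weights E)"
    using assms by (rule measurable_exp_weights_component)
  ultimately show ?thesis
    unfolding distributed_def using distr_exp_weights_component[OF assms] by simp
qed

text \<open>A sum of \<open>k\<close> unit exponentials is Erlang with index \<open>k - 1\<close>,
  the index counting from 0.\<close>

lemma prob_exp_weights_sum_le: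
  assumes "C \<subseteq> E" "C \<noteq> {}" "0 \<le> x"
  shows "\<P>(w in exp_weights E. sum w C \<le> x) = erlang_CDF (card C - 1) 1 x"
proof -
  have "distributed (exp_weights E) lborel (\<lambda>w. \<Sum>e\<in>C. w e) (erlang_density (card C - 1) 1)"
    using assms finite_subset[OF assms(1) fin]
    by (intro exponential_distributed_sum indep_vars_subset_exp_weights distributed_exp_weights) auto
  then show ?thesis
    using assms(3) by (intro erlang_distributed_le) auto
qed

lemma prob_mean_weight_le:
  assumes "C \<subseteq> E" "C \<noteq> {}" "0 \<le> a"
  shows "\<P>(w in exp_weights E. mean_weight w C \<le> a) = erlang_CDF (card C - 1) 1 (real (card C) * a)"
proof -
  have "card C > 0" using assms finite_subset[OF assms(1) fin] by (simp add: card_gt_0_iff)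
  then have "mean_weight w C \<le> a \<longleftrightarrow> sum w C \<le> real (card C) * a" for w
    by (simp add: mean_weight_def field_simps)
  then show ?thesis
    using prob_exp_weights_sum_le[OF assms(1,2), of "real (card C) * a"] assms(3) by simp
qed

text \<open>The weights range over all reals, so their sign is controlled almost surely only. This
  turns a bound on the total weight of a cycle into a bound on each of its edges.\<close>

lemma AE_exp_weights_nonneg: "AE w in exp_weights E. \<forall>e\<in>E. 0 \<le> w e"
proof -
  have "AE w in exp_weights E. 0 \<le> w e" if "e \<in> E" for e
  proof -
    note measurable_exp_weights_component[OF that, measurable]
    have "\<P>(w in exp_weights E. w e \<le> 0) = 0"
      using prob_exp_weights_sum_le[of "{e}" 0] that by (simp add: erlang_CDF_at0)
    then have "emeasure (exp_weights E) {w \<in> space (exp_weights E). w e \<le> 0} = 0"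
      by (simp add: emeasure_eq_measure)
    then show ?thesis
      by (rule AE_I[rotated]) auto
  qed
  then show ?thesis using fin by (simp add: AE_finite_all)
qed

text \<open>By independence a product of factors \<open>1 - exp (- t)\<close>, each at most
  \<open>t\<close>.\<close>

lemma prob_all_weights_le:
  assumes "H \<subseteq> E" "0 \<le> t"
  shows "\<P>(w in exp_weights E. \<forall>e\<in>H. w e \<le> t) \<le> t ^ card H"
proof (cases "H = {}")
  case False
  have "\<P>(w in exp_weights E. \<forall>e\<in>H. w e \<le> t) = prob (\<Inter>e\<in>H. (\<lambda>w. w e) -` {..t} \<inter> space (exp_weights E))"
    using False by (intro arg_cong[where f = prob]) auto
  also have "\<dots> = (\<Prod>e\<in>H. prob ((\<lambda>w. w e) -` {..t} \<inter> space (exp_weights E)))"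
    using False finite_subset[OF assms(1) fin]
    by (intro indep_varsD[OF indep_vars_subset_exp_weights[OF assms(1) False]]) auto
  also have "\<dots> \<le> (\<Prod>e\<in>H. t)"
  proof (intro prod_mono conjI)
    fix e assume "e \<in> H"
    then have "prob ((\<lambda>w. w e) -` {..t} \<inter> space (exp_weights E)) = erlang_CDF 0 1 t"
      using prob_exp_weights_sum_le[of "{e}" t] assms
      by (auto simp: vimage_def Int_def conj_commute)
    also have "\<dots> \<le> t"
      using assms(2) exp_ge_add_one_self[of "-t"] by (simp add: erlang_CDF_0)
    finally show "prob ((\<lambda>w. w e) -` {..t} \<inter> space (exp_weights E)) \<le> t" .
  qed simp
  finally show ?thesis by simp
qed simp

text \<open>The equations with \<open>restrict\<close> say that \<open>P\<close> and
  \<open>Q\<close> look only at the weights on \<open>A\<close> and on \<open>B\<close>, so both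
  factor through independent blocks of coordinates.\<close>

lemma prob_indep_disjoint_edges:
  assumes "A \<subseteq> E" "B \<subseteq> E" "A \<inter> B = {}"
    and P: "Measurable.pred (PiM A (\<lambda>_. borel)) P" "\<And>w. P (restrict w A) = P w"
    and Q: "Measurable.pred (PiM B (\<lambda>_. borel)) Q" "\<And>w. Q (restrict w B) = Q w"
  shows "\<P>(w in exp_weights E. P w \<and> Q w) = \<P>(w in exp_weights E. P w) * \<P>(w in exp_weights E. Q w)"
proof (cases "E = {}")
  \<comment> \<open>Independence of the coordinates was obtained for nonempty \<open>E\<close>; over
    no edges there is a single weight function.\<close>
  case True
  then have "space (exp_weights E) = {\<lambda>_. undefined}" by (simp add: space_exp_weights)
  then have "{w \<in> space (exp_weights E). R w} = (if R (\<lambda>_. undefined) then space (exp_weights E) else {})" for R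
    by auto
  then show ?thesis by (simp add: prob_space)
next
  case False
  have "indep_var (PiM A (\<lambda>_. borel)) (\<lambda>w. restrict (\<lambda>i. w i) A) (PiM B (\<lambda>_. borel)) (\<lambda>w. restrict (\<lambda>i. w i) B)"
    by (rule indep_var_restrict[OF indep_vars_exp_weights[OF False] assms(3,1,2)])
  then have "prob ((\<lambda>w. (restrict w A, restrict w B)) -` ({w \<in> space (PiM A (\<lambda>_. borel)). P w} \<times>
       {w \<in> space (PiM B (\<lambda>_. borel)). Q w}) \<inter> space (exp_weights E))
     = prob ((\<lambda>w. restrict w A) -` {w \<in> space (PiM A (\<lambda>_. borel)). P w} \<inter> space (exp_weights E))
     * prob ((\<lambda>w. restrict w B) -` {w \<in> space (PiM B (\<lambda>_. borel)). Q w} \<inter> space (exp_weights E))"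
    using P(1) Q(1) by (intro indep_varD) (auto simp: pred_def)
  moreover have "(\<lambda>w. restrict w A) -` {w \<in> space (PiM A (\<lambda>_. borel)). P w} \<inter> space (exp_weights E)
      = {w \<in> space (exp_weights E). P w}"
    using P(2) by (auto simp: space_PiM space_exp_weights)
  moreover have "(\<lambda>w. restrict w B) -` {w \<in> space (PiM B (\<lambda>_. borel)). Q w} \<inter> space (exp_weights E)
      = {w \<in> space (exp_weights E). Q w}"
    using Q(2) by (auto simp: space_PiM space_exp_weights)
  moreover have "(\<lambda>w. (restrict w A, restrict w B)) -` ({w \<in> space (PiM A (\<lambda>_. borel)). P w} \<times>
       {w \<in> space (PiM B (\<lambda>_. borel)). Q w}) \<inter> space (exp_weights E)
      = {w \<in> space (exp_weights E). P w \<and> Q w}"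
    using P(2) Q(2) by (auto simp: space_PiM space_exp_weights)
  ultimately show ?thesis by simp
qed

end

section \<open>A window estimate for the law of the minimiser\<close>

text \<open>\<open>S\<close> holds the competitors, \<open>J\<close> the admissible minimisers:
  \<open>J = S\<close> gives the distribution function of the minimum, and the cycles of one length
  give the joint law of length and minimum.\<close>

definition argmin_prob :: "'e set \<Rightarrow> 'e set set \<Rightarrow> 'e set set \<Rightarrow> real \<Rightarrow> real" where
  "argmin_prob E S J a =
     \<P>(w in exp_weights E. \<exists>C\<in>J. (\<forall>C'\<in>S. mean_weight w C \<le> mean_weight w C') \<and> mean_weight w C \<le> a)"

definition mean_prob :: "'e set \<Rightarrow> 'e set \<Rightarrow> real \<Rightarrow> real" where
  "mean_prob E C a = \<P>(w in exp_weights E. mean_weight w C \<le> a)"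

context
  fixes E :: "'e set" and S :: "'e set set"
  assumes fin: "finite E" and S: "S \<subseteq> Pow E - {{}}"
begin

interpretation prob_space "exp_weights E" by (rule prob_space_exp_weights)

lemma finite_cycle_family: "finite S"
  by (rule finite_subset[OF S]) (use fin in simp)

lemma measurable_mean_weight: "C \<in> S \<Longrightarrow> (\<lambda>w. mean_weight w C) \<in> borel_measurable (exp_weights E)"
  using S by (intro borel_measurable_mean_weight) auto

lemma pred_mean_le: "C \<in> S \<Longrightarrow> Measurable.pred (exp_weights E) (\<lambda>w. mean_weight w C \<le> a)"
  unfolding pred_def using measurable_mean_weight[of C] by (intro borel_measurable_le) auto

lemma pred_mean_gr: "C \<in> S \<Longrightarrow> Measurable.pred (exp_weights E) (\<lambda>w. a < mean_weight w C)"
  unfolding pred_def using measurable_mean_weight[of C] by (intro borel_measurable_less) auto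

lemma pred_mean_le2: "C \<in> S \<Longrightarrow> C' \<in> S \<Longrightarrow> Measurable.pred (exp_weights E) (\<lambda>w. mean_weight w C \<le> mean_weight w C')"
  unfolding pred_def using measurable_mean_weight[of C] measurable_mean_weight[of C'] by (intro borel_measurable_le) auto

lemmas pred_rules = pred_intros_logic pred_intros_finite pred_mean_le pred_mean_gr pred_mean_le2 finite_cycle_family

text \<open>A finite family attains its minimum, so the event for \<open>J = S\<close> fails exactly
  when every cycle lies above \<open>a\<close>.\<close>

lemma one_minus_argmin_prob:
  "1 - argmin_prob E S S a = \<P>(w in exp_weights E. \<forall>C\<in>S. a < mean_weight w C)"
proof -
  have ev: "{w \<in> space (exp_weights E). \<exists>C\<in>S. (\<forall>C'\<in>S. mean_weight w C \<le> mean_weight w C') \<and> mean_weight w C \<le> a}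
      = space (exp_weights E) - {w \<in> space (exp_weights E). \<forall>C\<in>S. a < mean_weight w C}" (is "?A = ?B")
  proof (intro equalityI subsetI)
    fix w assume w: "w \<in> ?B"
    then obtain C0 where C0: "C0 \<in> S" "mean_weight w C0 \<le> a" by force
    then have "finite (mean_weight w ` S)" "mean_weight w ` S \<noteq> {}" using finite_cycle_family by auto
    from Min_in[OF this] obtain C where C: "C \<in> S" "Min (mean_weight w ` S) = mean_weight w C" by auto
    have "mean_weight w C \<le> mean_weight w C'" if "C' \<in> S" for C'
      unfolding C(2)[symmetric] using that finite_cycle_family by (intro Min_le) auto
    moreover have "mean_weight w C \<le> a" using calculation[OF C0(1)] C0(2) by simp
    ultimately show "w \<in> ?A" using C(1) w by blast
  next
    fix w assume "w \<in> ?A"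
    then show "w \<in> ?B" by (auto simp: not_less)
  qed
  have m: "{w \<in> space (exp_weights E). \<forall>C\<in>S. a < mean_weight w C} \<in> events"
    unfolding pred_def[symmetric] by (intro pred_rules)
  show ?thesis
    unfolding argmin_prob_def ev using prob_compl[OF m] by simp
qed

text \<open>All minimisers over \<open>S\<close> share one mean weight, so a minimiser above
  \<open>a\<close> excludes another one at or below \<open>a\<close>; the difference of the events
  is exact even with ties.\<close>

lemma argmin_prob_diff:
  assumes J: "J \<subseteq> S" and "a \<le> b"
  shows "argmin_prob E S J b - argmin_prob E S J a =
    \<P>(w in exp_weights E. \<exists>C\<in>J. (\<forall>C'\<in>S. mean_weight w C \<le> mean_weight w C')
        \<and> a < mean_weight w C \<and> mean_weight w C \<le> b)"
proof -
  let ?A = "\<lambda>a. {w \<in> space (exp_weights E). \<exists>C\<in>J. (\<forall>C'\<in>S. mean_weight w C \<le> mean_weight w C') \<and> mean_weight w C \<le> a}"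
  have fJ: "finite J" using J finite_cycle_family by (rule finite_subset)
  have m: "?A x \<in> events" for x
    unfolding pred_def[symmetric] using J fJ by (intro pred_rules) auto
  have sub: "?A a \<subseteq> ?A b" using assms(2) by (auto intro: order_trans)
  have "{w \<in> space (exp_weights E). \<exists>C\<in>J. (\<forall>C'\<in>S. mean_weight w C \<le> mean_weight w C')
        \<and> a < mean_weight w C \<and> mean_weight w C \<le> b} = ?A b - ?A a" (is "?L = ?R")
  proof (intro equalityI subsetI)
    fix w assume w: "w \<in> ?L"
    then obtain C where C: "C \<in> J" "\<forall>C'\<in>S. mean_weight w C \<le> mean_weight w C'" "a < mean_weight w C" "mean_weight w C \<le> b"
      by blast
    have "w \<notin> ?A a"
    proof
      assume "w \<in> ?A a"
      then obtain D where "D \<in> J" "mean_weight w D \<le> a" by blast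
      with C J show False by force
    qed
    with w C show "w \<in> ?R" by blast
  next
    fix w assume w: "w \<in> ?R"
    then obtain C where C: "C \<in> J" "\<forall>C'\<in>S. mean_weight w C \<le> mean_weight w C'" "mean_weight w C \<le> b"
      by blast
    moreover have "\<not> mean_weight w C \<le> a" using w C by blast
    ultimately show "w \<in> ?L" using w by (auto simp: not_le)
  qed
  then show ?thesis
    unfolding argmin_prob_def using finite_measure_Diff[OF m m sub] by simp
qed

lemma mean_prob_diff:
  assumes "C \<in> S" "a \<le> b"
  shows "mean_prob E C b - mean_prob E C a = \<P>(w in exp_weights E. a < mean_weight w C \<and> mean_weight w C \<le> b)"
proof -
  let ?A = "\<lambda>a. {w \<in> space (exp_weights E). mean_weight w C \<le> a}"
  have m: "?A x \<in> events" for x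
    unfolding pred_def[symmetric] using assms by (intro pred_rules) auto
  have "{w \<in> space (exp_weights E). a < mean_weight w C \<and> mean_weight w C \<le> b} = ?A b - ?A a" by auto
  moreover have "?A a \<subseteq> ?A b" using assms(2) by auto
  ultimately show ?thesis
    unfolding mean_prob_def using finite_measure_Diff[OF m m] by simp
qed

lemma mean_prob_mono: "C \<in> S \<Longrightarrow> a \<le> b \<Longrightarrow> mean_prob E C a \<le> mean_prob E C b"
  unfolding mean_prob_def
  by (intro finite_measure_mono) (auto intro: pred_rules simp flip: pred_def)

lemma mean_prob_nonneg: "0 \<le> mean_prob E C a"
  unfolding mean_prob_def by simp

lemma mean_weight_restrict: "C \<subseteq> A \<Longrightarrow> mean_weight (restrict w A) C = mean_weight w C"
  unfolding mean_weight_def by (intro arg_cong2[where f = "(/)"] sum.cong) auto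

text \<open>The event on \<open>C\<close> reads the edges of \<open>C\<close>, the others only edges
  of \<open>E - C\<close>. Members of \<open>T\<close> may well intersect each other.\<close>

lemma prob_indep_cycles:
  assumes "C \<in> S" "T \<subseteq> S" "\<And>C'. C' \<in> T \<Longrightarrow> C \<inter> C' = {}"
  assumes P: "P \<in> sets borel" and Q: "\<And>C. Q C \<in> sets borel"
  shows "\<P>(w in exp_weights E. mean_weight w C \<in> P \<and> (\<forall>C'\<in>T. mean_weight w C' \<in> Q C')) =
    \<P>(w in exp_weights E. mean_weight w C \<in> P) * \<P>(w in exp_weights E. \<forall>C'\<in>T. mean_weight w C' \<in> Q C')"
proof (rule prob_indep_disjoint_edges[OF fin, where A = C and B = "E - C"])
  have meas: "Measurable.pred (PiM A (\<lambda>_. borel)) (\<lambda>w. mean_weight w C' \<in> R)"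
    if "C' \<subseteq> A" "R \<in> sets borel" for A C' and R :: "real set"
    using measurable_sets[OF borel_measurable_mean_weight[OF that(1)] that(2)]
    by (simp add: pred_def sets_exp_weights space_exp_weights space_PiM vimage_def Int_def conj_commute)
  have fT: "finite T" using assms(2) finite_cycle_family by (rule finite_subset)
  show "Measurable.pred (PiM C (\<lambda>_. borel)) (\<lambda>w. mean_weight w C \<in> P)"
    by (intro meas P) auto
  show "Measurable.pred (PiM (E - C) (\<lambda>_. borel)) (\<lambda>w. \<forall>C'\<in>T. mean_weight w C' \<in> Q C')"
    using assms S by (intro pred_intros_finite meas Q fT) auto
  show "(mean_weight (restrict w C) C \<in> P) = (mean_weight w C \<in> P)" for w
    by (simp add: mean_weight_restrict)
  have "mean_weight (restrict w (E - C)) C' = mean_weight w C'" if "C' \<in> T" for C' w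
    using that assms S by (intro mean_weight_restrict) auto
  then show "(\<forall>C'\<in>T. mean_weight (restrict w (E - C)) C' \<in> Q C') = (\<forall>C'\<in>T. mean_weight w C' \<in> Q C')" for w
    by simp
qed (use assms S in auto)

text \<open>Avoiding the cycles disjoint from \<open>C\<close> is weaker than avoiding all; the
  difference is covered by a union bound over the cycles that meet \<open>C\<close>, among them
  \<open>C\<close> itself.\<close>

lemma prob_avoid_disjoint:
  assumes "C \<in> S"
  shows "1 - argmin_prob E S S a \<le> \<P>(w in exp_weights E. \<forall>C'\<in>{C'\<in>S. C \<inter> C' = {}}. a < mean_weight w C')"
    and "\<P>(w in exp_weights E. \<forall>C'\<in>{C'\<in>S. C \<inter> C' = {}}. a < mean_weight w C') \<le>
       1 - argmin_prob E S S a + (\<Sum>C'\<in>{C'\<in>S. C \<inter> C' \<noteq> {}}. mean_prob E C' a)"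
proof -
  let ?N = "{w \<in> space (exp_weights E). \<forall>C'\<in>{C'\<in>S. C \<inter> C' = {}}. a < mean_weight w C'}"
  let ?Z = "{w \<in> space (exp_weights E). \<forall>C'\<in>S. a < mean_weight w C'}"
  let ?B = "\<lambda>C'. {w \<in> space (exp_weights E). mean_weight w C' \<le> a}"
  have m: "?N \<in> events" "?Z \<in> events" "\<And>C'. C' \<in> S \<Longrightarrow> ?B C' \<in> events"
    unfolding pred_def[symmetric] using finite_cycle_family by (intro pred_rules; auto)+
  show "1 - argmin_prob E S S a \<le> prob ?N"
    unfolding one_minus_argmin_prob using m by (intro finite_measure_mono) auto
  have mU: "(\<Union>C'\<in>{C'\<in>S. C \<inter> C' \<noteq> {}}. ?B C') \<in> events"
    using finite_cycle_family by (intro sets.finite_UN m) auto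
  have "prob ?N \<le> prob (?Z \<union> (\<Union>C'\<in>{C'\<in>S. C \<inter> C' \<noteq> {}}. ?B C'))"
    by (intro finite_measure_mono sets.Un m(2) mU) (auto simp: not_le[symmetric])
  also have "\<dots> \<le> prob ?Z + prob (\<Union>C'\<in>{C'\<in>S. C \<inter> C' \<noteq> {}}. ?B C')"
    by (intro measure_Un_le m(2) mU)
  also have "prob (\<Union>C'\<in>{C'\<in>S. C \<inter> C' \<noteq> {}}. ?B C') \<le> (\<Sum>C'\<in>{C'\<in>S. C \<inter> C' \<noteq> {}}. prob (?B C'))"
    using finite_cycle_family m(3) by (intro finite_measure_subadditive_finite) auto
  finally show "prob ?N \<le> 1 - argmin_prob E S S a + (\<Sum>C'\<in>{C'\<in>S. C \<inter> C' \<noteq> {}}. mean_prob E C' a)"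
    unfolding one_minus_argmin_prob mean_prob_def by simp
qed

lemma prob_window_avoid:
  assumes "C \<in> S" "a \<le> b"
  shows "\<P>(w in exp_weights E. (a < mean_weight w C \<and> mean_weight w C \<le> b) \<and> (\<forall>C'\<in>{C'\<in>S. C \<inter> C' = {}}. a < mean_weight w C'))
    = (mean_prob E C b - mean_prob E C a) * \<P>(w in exp_weights E. \<forall>C'\<in>{C'\<in>S. C \<inter> C' = {}}. a < mean_weight w C')"
proof -
  have "\<P>(w in exp_weights E. mean_weight w C \<in> {a<..b} \<and> (\<forall>C'\<in>{C'\<in>S. C \<inter> C' = {}}. mean_weight w C' \<in> {a<..}))
    = \<P>(w in exp_weights E. mean_weight w C \<in> {a<..b}) *
      \<P>(w in exp_weights E. \<forall>C'\<in>{C'\<in>S. C \<inter> C' = {}}. mean_weight w C' \<in> {a<..})"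
    by (rule prob_indep_cycles) (use assms in auto)
  then show ?thesis
    unfolding mean_prob_diff[OF assms] by (simp only: greaterThanAtMost_iff greaterThan_iff)
qed

text \<open>A minimiser \<open>C\<close> in the window forces all cycles disjoint from
  \<open>C\<close> above \<open>a\<close>, an event independent of the weight of \<open>C\<close>.
  Trading the disjoint cycles for all cycles costs the double sum, whose diagonal
  \<open>C' = C\<close> is included.\<close>

lemma argmin_prob_window_upper:
  assumes J: "J \<subseteq> S" and "a \<le> b"
  shows "argmin_prob E S J b - argmin_prob E S J a \<le>
    (\<Sum>C\<in>J. mean_prob E C b - mean_prob E C a) * (1 - argmin_prob E S S a)
    + (\<Sum>C\<in>S. \<Sum>C'\<in>{C'\<in>S. C \<inter> C' \<noteq> {}}. mean_prob E C b * mean_prob E C' b)"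
proof -
  let ?N = "\<lambda>C w. \<forall>C'\<in>{C'\<in>S. C \<inter> C' = {}}. a < mean_weight w C'"
  let ?I = "\<lambda>C w. a < mean_weight w C \<and> mean_weight w C \<le> b"
  have fJ: "finite J" using J finite_cycle_family by (rule finite_subset)
  have m: "{w \<in> space (exp_weights E). ?I C w \<and> ?N C w} \<in> events" if "C \<in> S" for C
    unfolding pred_def[symmetric] using finite_cycle_family that by (intro pred_rules) auto
  have "argmin_prob E S J b - argmin_prob E S J a \<le> prob (\<Union>C\<in>J. {w \<in> space (exp_weights E). ?I C w \<and> ?N C w})"
    unfolding argmin_prob_diff[OF assms]
  proof (rule finite_measure_mono)
    show "(\<Union>C\<in>J. {w \<in> space (exp_weights E). ?I C w \<and> ?N C w}) \<in> events"
      using fJ J by (intro sets.finite_UN m) auto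
  qed (auto intro: less_le_trans)
  also have "\<dots> \<le> (\<Sum>C\<in>J. prob {w \<in> space (exp_weights E). ?I C w \<and> ?N C w})"
    using m fJ J by (intro finite_measure_subadditive_finite) auto
  also have "\<dots> \<le> (\<Sum>C\<in>J. (mean_prob E C b - mean_prob E C a) * (1 - argmin_prob E S S a)
      + (\<Sum>C'\<in>{C'\<in>S. C \<inter> C' \<noteq> {}}. mean_prob E C b * mean_prob E C' b))"
  proof (rule sum_mono)
    fix C assume "C \<in> J"
    then have C: "C \<in> S" using J by auto
    have le: "0 \<le> mean_prob E C b - mean_prob E C a" "mean_prob E C b - mean_prob E C a \<le> mean_prob E C b"
      using mean_prob_mono[OF C assms(2)] mean_prob_nonneg[of C a] by auto
    have "prob {w \<in> space (exp_weights E). ?I C w \<and> ?N C w} = (mean_prob E C b - mean_prob E C a) * prob {w \<in> space (exp_weights E). ?N C w}"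
      by (rule prob_window_avoid[OF C assms(2)])
    also have "\<dots> \<le> (mean_prob E C b - mean_prob E C a) * (1 - argmin_prob E S S a + (\<Sum>C'\<in>{C'\<in>S. C \<inter> C' \<noteq> {}}. mean_prob E C' a))"
      by (intro mult_left_mono prob_avoid_disjoint C le)
    also have "\<dots> = (mean_prob E C b - mean_prob E C a) * (1 - argmin_prob E S S a)
        + (mean_prob E C b - mean_prob E C a) * (\<Sum>C'\<in>{C'\<in>S. C \<inter> C' \<noteq> {}}. mean_prob E C' a)"
      by (simp add: distrib_left)
    also have "(mean_prob E C b - mean_prob E C a) * (\<Sum>C'\<in>{C'\<in>S. C \<inter> C' \<noteq> {}}. mean_prob E C' a)
        \<le> mean_prob E C b * (\<Sum>C'\<in>{C'\<in>S. C \<inter> C' \<noteq> {}}. mean_prob E C' b)"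
      using assms(2) by (intro mult_mono le sum_mono mean_prob_mono sum_nonneg mean_prob_nonneg) auto
    finally show "prob {w \<in> space (exp_weights E). ?I C w \<and> ?N C w} \<le>
        (mean_prob E C b - mean_prob E C a) * (1 - argmin_prob E S S a)
      + (\<Sum>C'\<in>{C'\<in>S. C \<inter> C' \<noteq> {}}. mean_prob E C b * mean_prob E C' b)"
      by (simp add: sum_distrib_left)
  qed
  also have "\<dots> = (\<Sum>C\<in>J. mean_prob E C b - mean_prob E C a) * (1 - argmin_prob E S S a)
     + (\<Sum>C\<in>J. \<Sum>C'\<in>{C'\<in>S. C \<inter> C' \<noteq> {}}. mean_prob E C b * mean_prob E C' b)"
    by (simp add: sum.distrib sum_distrib_right)
  also have "(\<Sum>C\<in>J. \<Sum>C'\<in>{C'\<in>S. C \<inter> C' \<noteq> {}}. mean_prob E C b * mean_prob E C' b) \<le>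
      (\<Sum>C\<in>S. \<Sum>C'\<in>{C'\<in>S. C \<inter> C' \<noteq> {}}. mean_prob E C b * mean_prob E C' b)"
    by (intro sum_mono2 finite_cycle_family J sum_nonneg mult_nonneg_nonneg mean_prob_nonneg)
  finally show ?thesis by simp
qed

text \<open>Let \<open>C\<close> lie in the window and its disjoint cycles above \<open>a\<close>.
  Then \<open>C\<close> can fail to be the only light cycle in two ways: a cycle meeting
  \<open>C\<close> is at most \<open>b\<close>, or a disjoint one lies in the same window. Pairs of
  the second kind are independent and yield the square.\<close>

lemma argmin_prob_window_lower:
  assumes J: "J \<subseteq> S" and "a \<le> b"
  shows "argmin_prob E S J b - argmin_prob E S J a \<ge>
    (\<Sum>C\<in>J. mean_prob E C b - mean_prob E C a) * (1 - argmin_prob E S S a)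
    - (\<Sum>C\<in>S. \<Sum>C'\<in>{C'\<in>S. C' \<noteq> C \<and> C \<inter> C' \<noteq> {}}. \<P>(w in exp_weights E. mean_weight w C \<le> b \<and> mean_weight w C' \<le> b))
    - (\<Sum>C\<in>S. mean_prob E C b - mean_prob E C a)\<^sup>2"
proof -
  let ?N = "\<lambda>C w. \<forall>C'\<in>{C'\<in>S. C \<inter> C' = {}}. a < mean_weight w C'"
  let ?I = "\<lambda>C w. a < mean_weight w C \<and> mean_weight w C \<le> b"
  let ?q = "\<lambda>C. mean_prob E C b - mean_prob E C a"
  \<comment> \<open>\<open>U C\<close>: the cycle \<open>C\<close> is the only one with mean weight at most \<open>b\<close>; these events are disjoint.\<close>
  define U where "U = (\<lambda>C. {w \<in> space (exp_weights E). ?I C w \<and> (\<forall>C'\<in>S. C' \<noteq> C \<longrightarrow> b < mean_weight w C')})"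
  let ?A = "\<lambda>C. {w \<in> space (exp_weights E). ?I C w \<and> ?N C w}"
  define V where "V = (\<lambda>C C'. {w \<in> space (exp_weights E). mean_weight w C \<le> b \<and> mean_weight w C' \<le> b})"
  define W where "W = (\<lambda>C C'. {w \<in> space (exp_weights E). ?I C w \<and> ?I C' w})"
  have fJ: "finite J" using J finite_cycle_family by (rule finite_subset)
  have mA: "?A C \<in> events" if "C \<in> S" for C
    unfolding pred_def[symmetric] using finite_cycle_family that by (intro pred_rules) auto
  have mU: "U C \<in> events" if "C \<in> S" for C
    unfolding U_def pred_def[symmetric] using finite_cycle_family that by (intro pred_rules) auto
  have mV: "V C C' \<in> events" if "C \<in> S" "C' \<in> S" for C C'
    unfolding V_def pred_def[symmetric] using that by (intro pred_rules) auto
  have mW: "W C C' \<in> events" if "C \<in> S" "C' \<in> S" for C C'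
    unfolding W_def pred_def[symmetric] using that by (intro pred_rules) auto
  have q0: "0 \<le> ?q C" if "C \<in> S" for C
    using mean_prob_mono[OF that assms(2)] by simp
  have mR: "{w \<in> space (exp_weights E). \<exists>C\<in>J. (\<forall>C'\<in>S. mean_weight w C \<le> mean_weight w C') \<and> a < mean_weight w C \<and> mean_weight w C \<le> b} \<in> events"
    unfolding pred_def[symmetric] using fJ J by (intro pred_rules) auto
  have U: "?q C * (1 - argmin_prob E S S a)
      - (\<Sum>C'\<in>{C'\<in>S. C' \<noteq> C \<and> C \<inter> C' \<noteq> {}}. prob (V C C')) - ?q C * (\<Sum>C'\<in>S. ?q C') \<le> prob (U C)"
    if "C \<in> J" for C
  proof -
    have C: "C \<in> S" using that J by auto
    have "?q C * (1 - argmin_prob E S S a) \<le> ?q C * prob {w \<in> space (exp_weights E). ?N C w}"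
      by (intro mult_left_mono prob_avoid_disjoint C q0)
    also have "\<dots> = prob (?A C)"
      by (simp only: prob_window_avoid[OF C assms(2)])
    also have "\<dots> \<le> prob (U C \<union> ((\<Union>C'\<in>{C'\<in>S. C' \<noteq> C \<and> C \<inter> C' \<noteq> {}}. V C C') \<union> (\<Union>C'\<in>{C'\<in>S. C \<inter> C' = {}}. W C C')))"
    proof (intro finite_measure_mono subsetI)
      fix w assume w: "w \<in> ?A C"
      show "w \<in> U C \<union> ((\<Union>C'\<in>{C'\<in>S. C' \<noteq> C \<and> C \<inter> C' \<noteq> {}}. V C C') \<union> (\<Union>C'\<in>{C'\<in>S. C \<inter> C' = {}}. W C C'))"
      proof (cases "\<forall>C'\<in>S. C' \<noteq> C \<longrightarrow> b < mean_weight w C'")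
        case True
        then show ?thesis using w by (auto simp: U_def)
      next
        case False
        then obtain C' where "C' \<in> S" "C' \<noteq> C" "mean_weight w C' \<le> b" by (auto simp: not_less)
        then show ?thesis using w by (cases "C \<inter> C' = {}") (auto simp: V_def W_def)
      qed
    qed (use C finite_cycle_family in \<open>auto intro!: sets.Un sets.finite_UN mU mV mW\<close>)
    also have "\<dots> \<le> prob (U C) + prob ((\<Union>C'\<in>{C'\<in>S. C' \<noteq> C \<and> C \<inter> C' \<noteq> {}}. V C C') \<union> (\<Union>C'\<in>{C'\<in>S. C \<inter> C' = {}}. W C C'))"
      using C finite_cycle_family by (intro measure_Un_le sets.Un sets.finite_UN mU mV mW) auto
    also have "prob ((\<Union>C'\<in>{C'\<in>S. C' \<noteq> C \<and> C \<inter> C' \<noteq> {}}. V C C') \<union> (\<Union>C'\<in>{C'\<in>S. C \<inter> C' = {}}. W C C'))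
       \<le> prob (\<Union>C'\<in>{C'\<in>S. C' \<noteq> C \<and> C \<inter> C' \<noteq> {}}. V C C') + prob (\<Union>C'\<in>{C'\<in>S. C \<inter> C' = {}}. W C C')"
      using C finite_cycle_family by (intro measure_Un_le sets.Un sets.finite_UN mU mV mW) auto
    also have "prob (\<Union>C'\<in>{C'\<in>S. C' \<noteq> C \<and> C \<inter> C' \<noteq> {}}. V C C') \<le> (\<Sum>C'\<in>{C'\<in>S. C' \<noteq> C \<and> C \<inter> C' \<noteq> {}}. prob (V C C'))"
      using mV C finite_cycle_family by (intro finite_measure_subadditive_finite) auto
    also have "prob (\<Union>C'\<in>{C'\<in>S. C \<inter> C' = {}}. W C C') \<le> (\<Sum>C'\<in>{C'\<in>S. C \<inter> C' = {}}. prob (W C C'))"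
      using mW C finite_cycle_family by (intro finite_measure_subadditive_finite) auto
    also have "\<dots> = (\<Sum>C'\<in>{C'\<in>S. C \<inter> C' = {}}. ?q C * ?q C')"
    proof (intro sum.cong refl)
      fix C' assume C': "C' \<in> {C'\<in>S. C \<inter> C' = {}}"
      show "prob (W C C') = ?q C * ?q C'"
        using prob_indep_cycles[of C "{C'}" "{a<..b}" "\<lambda>_. {a<..b}"] assms C C'
        by (simp add: mean_prob_diff W_def)
    qed
    also have "\<dots> \<le> (\<Sum>C'\<in>S. ?q C * ?q C')"
      by (intro sum_mono2 finite_cycle_family mult_nonneg_nonneg q0 C) auto
    also have "\<dots> = ?q C * (\<Sum>C'\<in>S. ?q C')" by (simp add: sum_distrib_left)
    finally show ?thesis by simp
  qed
  have gen: "(\<Sum>C\<in>J. p C * x - g C - p C * y) = sum p J * x - sum g J - sum p J * y"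
    for p g :: "'e set \<Rightarrow> real" and x y
    by (induction J rule: infinite_finite_induct) (simp_all add: algebra_simps)
  have "(\<Sum>C\<in>J. ?q C * (1 - argmin_prob E S S a)
      - (\<Sum>C'\<in>{C'\<in>S. C' \<noteq> C \<and> C \<inter> C' \<noteq> {}}. prob (V C C')) - ?q C * (\<Sum>C'\<in>S. ?q C')) \<le> (\<Sum>C\<in>J. prob (U C))"
    by (intro sum_mono U)
  also have "\<dots> = prob (\<Union>C\<in>J. U C)"
  proof (rule finite_measure_finite_Union[symmetric])
    show "disjoint_family_on U J"
      unfolding disjoint_family_on_def U_def
    proof (intro ballI impI equalityI subsetI)
      fix C D w assume CD: "C \<in> J" "D \<in> J" "C \<noteq> D"
        and w: "w \<in> {w \<in> space (exp_weights E). ?I C w \<and> (\<forall>C'\<in>S. C' \<noteq> C \<longrightarrow> b < mean_weight w C')} \<inter>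
          {w \<in> space (exp_weights E). ?I D w \<and> (\<forall>C'\<in>S. C' \<noteq> D \<longrightarrow> b < mean_weight w C')}"
      then have "b < mean_weight w D" "mean_weight w D \<le> b" using J by auto
      then show "w \<in> {}" by simp
    qed simp
  qed (use fJ mU J in auto)
  also have "\<dots> \<le> argmin_prob E S J b - argmin_prob E S J a"
    unfolding argmin_prob_diff[OF assms]
  proof (intro finite_measure_mono mR subsetI)
    fix w assume "w \<in> (\<Union>C\<in>J. U C)"
    then obtain C where C: "C \<in> J" "w \<in> U C" by blast
    have "mean_weight w C \<le> mean_weight w C'" if "C' \<in> S" for C'
      using C(2) that by (cases "C' = C") (auto simp: U_def)
    with C show "w \<in> {w \<in> space (exp_weights E). \<exists>C\<in>J. (\<forall>C'\<in>S. mean_weight w C \<le> mean_weight w C') \<and> a < mean_weight w C \<and> mean_weight w C \<le> b}"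
      unfolding U_def by blast
  qed
  finally have main0: "(\<Sum>C\<in>J. ?q C * (1 - argmin_prob E S S a)
      - (\<Sum>C'\<in>{C'\<in>S. C' \<noteq> C \<and> C \<inter> C' \<noteq> {}}. prob (V C C')) - ?q C * (\<Sum>C'\<in>S. ?q C'))
      \<le> argmin_prob E S J b - argmin_prob E S J a" .
  have main: "(\<Sum>C\<in>J. ?q C) * (1 - argmin_prob E S S a)
      - (\<Sum>C\<in>J. \<Sum>C'\<in>{C'\<in>S. C' \<noteq> C \<and> C \<inter> C' \<noteq> {}}. prob (V C C'))
      - (\<Sum>C\<in>J. ?q C) * (\<Sum>C'\<in>S. ?q C') \<le> argmin_prob E S J b - argmin_prob E S J a"
    by (rule order_trans[OF eq_refl main0], rule gen[symmetric])
  have "(\<Sum>C\<in>J. \<Sum>C'\<in>{C'\<in>S. C' \<noteq> C \<and> C \<inter> C' \<noteq> {}}. prob (V C C'))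
      \<le> (\<Sum>C\<in>S. \<Sum>C'\<in>{C'\<in>S. C' \<noteq> C \<and> C \<inter> C' \<noteq> {}}. prob (V C C'))"
    by (intro sum_mono2 finite_cycle_family J sum_nonneg measure_nonneg)
  moreover have "(\<Sum>C\<in>J. ?q C) * (\<Sum>C'\<in>S. ?q C') \<le> (\<Sum>C\<in>S. ?q C)\<^sup>2"
    unfolding power2_eq_square
    by (intro mult_right_mono sum_mono2 finite_cycle_family J sum_nonneg q0) auto
  ultimately show ?thesis using main by (simp add: V_def)
qed

end

section \<open>Probabilities that one or two cycles are light\<close>

text \<open>The Lagrange remainder of the exponential series makes the distribution function equal
  to \<open>exp (t - x) * x ^ k / fact k\<close> for some \<open>t\<close> of absolute value at most
  \<open>x\<close>.\<close>

lemma erlang_CDF_bounds: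
  assumes "0 \<le> x" "1 \<le> k"
  shows "erlang_CDF (k - 1) 1 x \<le> x ^ k / fact k"
    and "exp (- 2 * x) * (x ^ k / fact k) \<le> erlang_CDF (k - 1) 1 x"
proof -
  obtain t where t: "\<bar>t\<bar> \<le> \<bar>x\<bar>" "exp x = (\<Sum>m<k. x ^ m / fact m) + exp t / fact k * x ^ k"
    using Maclaurin_exp_le by blast
  have "{..k - 1} = {..<k}" using assms(2) by auto
  then have "erlang_CDF (k - 1) 1 x = 1 - (\<Sum>m<k. x ^ m / fact m) * exp (- x)"
    using assms(1) by (simp add: erlang_CDF_def sum_distrib_right)
  also have "(\<Sum>m<k. x ^ m / fact m) = exp x - exp t / fact k * x ^ k" using t(2) by simp
  also have "1 - (exp x - exp t / fact k * x ^ k) * exp (- x) = exp (t - x) * (x ^ k / fact k)"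
    by (simp add: left_diff_distrib exp_minus_inverse exp_diff exp_minus field_simps)
  finally have eq: "erlang_CDF (k - 1) 1 x = exp (t - x) * (x ^ k / fact k)" .
  have "exp (t - x) * (x ^ k / fact k) \<le> 1 * (x ^ k / fact k)"
    using t(1) assms(1) by (intro mult_right_mono) auto
  then show "erlang_CDF (k - 1) 1 x \<le> x ^ k / fact k" unfolding eq by simp
  show "exp (- 2 * x) * (x ^ k / fact k) \<le> erlang_CDF (k - 1) 1 x"
    unfolding eq using t(1) assms(1) by (intro mult_right_mono) auto
qed

context
  fixes E :: "'e set"
  assumes fin: "finite E"
begin

interpretation prob_space "exp_weights E" by (rule prob_space_exp_weights)

lemma mean_prob_eq_erlang:
  assumes "C \<subseteq> E" "C \<noteq> {}" "0 \<le> a"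
  shows "mean_prob E C a = erlang_CDF (card C - 1) 1 (real (card C) * a)"
  unfolding mean_prob_def by (rule prob_mean_weight_le[OF fin assms])

text \<open>For nonnegative weights a mean of at most \<open>b\<close> over at most \<open>K\<close>
  edges bounds every edge by \<open>K * b\<close>. Each edge of the union contributes one factor,
  shared edges only once.\<close>

lemma joint_mean_prob_le:
  assumes C: "C \<subseteq> E" "C \<noteq> {}" "card C \<le> K" and C': "C' \<subseteq> E" "C' \<noteq> {}" "card C' \<le> K" and b: "0 \<le> b"
  shows "\<P>(w in exp_weights E. mean_weight w C \<le> b \<and> mean_weight w C' \<le> b) \<le> (real K * b) ^ card (C \<union> C')"
proof -
  have le: "w e \<le> real K * b"
    if D: "D \<subseteq> E" "D \<noteq> {}" "card D \<le> K" and w: "\<forall>e\<in>E. 0 \<le> w e" "mean_weight w D \<le> b" and e: "e \<in> D" for w D e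
  proof -
    have fD: "finite D" using D(1) fin by (rule finite_subset)
    have "w e \<le> sum w D" using D w e fD by (intro member_le_sum) auto
    also have "\<dots> \<le> real (card D) * b"
      using w(2) D(2) fD by (simp add: mean_weight_def field_simps card_gt_0_iff)
    also have "\<dots> \<le> real K * b" using D(3) b by (intro mult_right_mono) auto
    finally show ?thesis .
  qed
  have "\<P>(w in exp_weights E. mean_weight w C \<le> b \<and> mean_weight w C' \<le> b)
      \<le> \<P>(w in exp_weights E. \<forall>e\<in>C \<union> C'. w e \<le> real K * b)"
  proof (rule finite_measure_mono_AE)
    show "AE w in exp_weights E. w \<in> {w \<in> space (exp_weights E). mean_weight w C \<le> b \<and> mean_weight w C' \<le> b} \<longrightarrow>
        w \<in> {w \<in> space (exp_weights E). \<forall>e\<in>C \<union> C'. w e \<le> real K * b}"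
      using AE_exp_weights_nonneg[OF fin] by eventually_elim (use le C C' in blast)
    have "finite (C \<union> C')" using C C' fin finite_subset by blast
    then show "{w \<in> space (exp_weights E). \<forall>e\<in>C \<union> C'. w e \<le> real K * b} \<in> events"
      using C C' by (intro sets.sets_Collect_finite_All borel_measurable_le measurable_exp_weights_component) auto
  qed
  also have "\<dots> \<le> (real K * b) ^ card (C \<union> C')"
    using C C' b by (intro prob_all_weights_le fin) auto
  finally show ?thesis .
qed

lemma mean_prob_le_power:
  assumes C: "C \<subseteq> E" "C \<noteq> {}" "card C \<le> K" and b: "0 \<le> b"
  shows "mean_prob E C b \<le> (real K * b) ^ card C"
  using joint_mean_prob_le[OF C C b] by (simp add: mean_prob_def)

end

section \<open>Discretised differential equations\<close>

text \<open>An error quadratic in the step length adds up to \<open>M c\<^sup>2 / N\<close> over \<open>N\<close> equal steps.\<close>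

lemma tendsto_zero_creeping:
  fixes D :: "nat \<Rightarrow> real \<Rightarrow> real"
  assumes "0 \<le> c" "0 \<le> M" and D0: "(\<lambda>n. D n 0) \<longlonglongrightarrow> 0"
    and step: "\<And>a b. 0 \<le> a \<Longrightarrow> a \<le> b \<Longrightarrow> b \<le> c \<Longrightarrow>
      \<exists>e. (\<forall>\<^sub>F n in sequentially. \<bar>D n b\<bar> \<le> \<bar>D n a\<bar> + e n) \<and> (\<exists>l. e \<longlonglongrightarrow> l \<and> l \<le> M * (b - a)\<^sup>2)"
  shows "(\<lambda>n. D n c) \<longlonglongrightarrow> 0"
proof -
  \<comment> \<open>\<open>Q a \<eta>\<close> says that the upper limit of
    \<open>\<bar>D n a\<bar>\<close> is at most \<open>\<eta>\<close>; each step then adds its own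
    quadratic error.\<close>
  define Q where "Q a \<eta> \<longleftrightarrow> (\<forall>\<delta>>0. \<forall>\<^sub>F n in sequentially. \<bar>D n a\<bar> \<le> \<eta> + \<delta>)" for a \<eta>
  have Q_step: "Q b (\<eta> + M * (b - a)\<^sup>2)" if Qa: "Q a \<eta>" and ab: "0 \<le> a" "a \<le> b" "b \<le> c" for a b \<eta>
    unfolding Q_def
  proof (intro allI impI)
    fix \<delta> :: real assume "\<delta> > 0"
    obtain e l where e: "\<forall>\<^sub>F n in sequentially. \<bar>D n b\<bar> \<le> \<bar>D n a\<bar> + e n" "e \<longlonglongrightarrow> l" "l \<le> M * (b - a)\<^sup>2"
      using step[OF ab] by blast
    have "\<forall>\<^sub>F n in sequentially. \<bar>D n a\<bar> \<le> \<eta> + \<delta> / 2"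
      using Qa \<open>\<delta> > 0\<close> unfolding Q_def by (metis half_gt_zero)
    moreover have "\<forall>\<^sub>F n in sequentially. e n < l + \<delta> / 2"
      by (rule order_tendstoD(2)[OF e(2)]) (use \<open>\<delta> > 0\<close> in simp)
    ultimately show "\<forall>\<^sub>F n in sequentially. \<bar>D n b\<bar> \<le> \<eta> + M * (b - a)\<^sup>2 + \<delta>"
      using e(1) by eventually_elim (use e(3) in linarith)
  qed
  have Q0: "Q 0 0"
    unfolding Q_def
  proof (intro allI impI)
    fix \<delta> :: real assume "\<delta> > 0"
    from tendstoD[OF D0 this] show "\<forall>\<^sub>F n in sequentially. \<bar>D n 0\<bar> \<le> 0 + \<delta>"
      by eventually_elim simp
  qed
  have Qc: "Q c (M * c\<^sup>2 / real N)" if "N > 0" for N :: nat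
  proof -
    have "Q (c * real i / real N) (real i * (M * (c / real N)\<^sup>2))" if "i \<le> N" for i
      using that
    proof (induction i)
      case 0
      then show ?case using Q0 by simp
    next
      case (Suc i)
      have "c * real (Suc i) \<le> c * real N"
        using Suc.prems \<open>0 \<le> c\<close> by (intro mult_left_mono) auto
      then have "c * real (Suc i) / real N \<le> c"
        using \<open>N > 0\<close> by (simp only: divide_le_eq) simp
      then have "Q (c * real (Suc i) / real N)
        (real i * (M * (c / real N)\<^sup>2) + M * (c * real (Suc i) / real N - c * real i / real N)\<^sup>2)"
        using Suc \<open>0 \<le> c\<close> by (intro Q_step) (auto intro!: divide_right_mono mult_left_mono)
      moreover have "c * real (Suc i) / real N - c * real i / real N = c / real N"
        by (simp add: add_divide_distrib algebra_simps)
      ultimately show ?case by (simp add: algebra_simps)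
    qed
    from this[of N] have "Q (c * real N / real N) (real N * (M * (c / real N)\<^sup>2))" by simp
    moreover have "real N * (M * (c / real N)\<^sup>2) = M * c\<^sup>2 / real N"
      using \<open>N > 0\<close> by (simp add: power2_eq_square)
    ultimately show ?thesis using \<open>N > 0\<close> by simp
  qed
  show ?thesis
    unfolding tendsto_iff
  proof (intro allI impI)
    fix \<epsilon> :: real assume "\<epsilon> > 0"
    obtain N :: nat where N: "M * c\<^sup>2 / (\<epsilon> / 2) < real N" using reals_Archimedean2 by blast
    have "0 \<le> M * c\<^sup>2 / (\<epsilon> / 2)" using \<open>0 \<le> M\<close> \<open>\<epsilon> > 0\<close> by simp
    with N have N0: "N > 0" by (metis of_nat_0_less_iff order_le_less_trans)
    have "M * c\<^sup>2 / real N < \<epsilon> / 2" using N N0 \<open>\<epsilon> > 0\<close> by (simp add: field_simps)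
    moreover have "\<forall>\<^sub>F n in sequentially. \<bar>D n c\<bar> \<le> M * c\<^sup>2 / real N + \<epsilon> / 2"
      using Qc[OF N0] \<open>\<epsilon> > 0\<close> unfolding Q_def by (metis half_gt_zero)
    ultimately show "\<forall>\<^sub>F n in sequentially. dist (D n c) 0 < \<epsilon>"
      unfolding dist_real_def diff_0_right
      by (elim eventually_mono) linarith
  qed
qed

lemma exp_minus_second_order:
  fixes x :: real
  assumes "0 \<le> x"
  shows "\<bar>x - 1 + exp (- x)\<bar> \<le> x\<^sup>2"
proof -
  have "1 - x \<le> exp (- x)" using exp_ge_add_one_self[of "-x"] by simp
  moreover have "exp (- x) \<le> 1 - x + x\<^sup>2"
  proof (cases "x \<le> 1")
    case True
    have "exp (- x) = 1 / exp x" by (simp add: exp_minus inverse_eq_divide)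
    also have "\<dots> \<le> 1 / (1 + x)" using assms exp_ge_add_one_self[of x] by (intro divide_left_mono) auto
    also have "\<dots> \<le> 1 - x + x\<^sup>2"
    proof -
      have "1 \<le> (1 - x + x\<^sup>2) * (1 + x)" using assms by (simp add: algebra_simps power2_eq_square)
      then show ?thesis using assms by (simp add: field_simps)
    qed
    finally show ?thesis .
  next
    case False
    have "exp (- x) \<le> 1" using assms by simp
    moreover have "x * 1 \<le> x * x" using False by (intro mult_left_mono) auto
    ultimately show ?thesis unfolding power2_eq_square by linarith
  qed
  ultimately show ?thesis by simp
qed

text \<open>The estimate is an Euler scheme for \<open>y' = l' * (1 - y)\<close> with
  \<open>y 0 = 0\<close>, solved by \<open>1 - exp (- l t)\<close>. Pointwise convergence of
  \<open>L\<close> suffices, since every grid has finitely many nodes.\<close>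

lemma window_limit_exp:
  fixes Y L :: "nat \<Rightarrow> real \<Rightarrow> real" and l :: "real \<Rightarrow> real" and \<epsilon> :: "nat \<Rightarrow> real"
  assumes c: "0 \<le> c" and Y: "\<And>n t. 0 \<le> Y n t" "\<And>n t. Y n t \<le> 1" "\<And>n. Y n 0 = 0"
    and L: "\<And>t. 0 \<le> t \<Longrightarrow> t \<le> c \<Longrightarrow> (\<lambda>n. L n t) \<longlonglongrightarrow> l t"
    and Lmono: "\<And>n a b. 0 \<le> a \<Longrightarrow> a \<le> b \<Longrightarrow> L n a \<le> L n b"
    and l0: "l 0 = 0" and lip: "\<And>a b. 0 \<le> a \<Longrightarrow> a \<le> b \<Longrightarrow> b \<le> c \<Longrightarrow> l b - l a \<le> m * (b - a)"
    and \<epsilon>: "\<epsilon> \<longlonglongrightarrow> 0"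
    and win: "\<forall>\<^sub>F n in sequentially. \<forall>a b. 0 \<le> a \<longrightarrow> a \<le> b \<longrightarrow> b \<le> c \<longrightarrow>
      \<bar>Y n b - Y n a - (L n b - L n a) * (1 - Y n a)\<bar> \<le> (L n b - L n a)\<^sup>2 + \<epsilon> n"
  shows "(\<lambda>n. Y n c) \<longlonglongrightarrow> 1 - exp (- l c)"
proof -
  have lmono: "l a \<le> l b" if "0 \<le> a" "a \<le> b" "b \<le> c" for a b
    using that by (intro LIMSEQ_le[OF L L]) (auto intro: Lmono)
  define D where "D n t = Y n t - (1 - exp (- l t))" for n t
  have "(\<lambda>n. D n c) \<longlonglongrightarrow> 0"
  proof (rule tendsto_zero_creeping[where M = "3 * m\<^sup>2"])
    show "(\<lambda>n. D n 0) \<longlonglongrightarrow> 0" by (simp add: D_def Y l0)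
    fix a b assume ab: "0 \<le> a" "a \<le> b" "b \<le> c"
    define e where "e n = 2 * (L n b - L n a)\<^sup>2 + \<epsilon> n + \<bar>(L n b - L n a) - (l b - l a)\<bar> + (l b - l a)\<^sup>2" for n
    have d0: "0 \<le> l b - l a" using lmono[OF ab] by simp
    have "\<forall>\<^sub>F n in sequentially. \<bar>D n b\<bar> \<le> \<bar>D n a\<bar> + e n"
      using win
    proof eventually_elim
      case (elim n)
      define d where "d = L n b - L n a"
      define r where "r = Y n b - Y n a - d * (1 - Y n a)"
      have r: "\<bar>r\<bar> \<le> d\<^sup>2 + \<epsilon> n" using elim ab unfolding r_def d_def by blast
      have d: "0 \<le> d" unfolding d_def using Lmono[of a b n] ab by simp
      define z where "z = l b - l a"
      define u where "u = exp (- l a)"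
      have la: "0 \<le> l a" using lmono[of 0 a] ab l0 by simp
      then have u: "0 \<le> u" "u \<le> 1" by (simp_all add: u_def)
      have ub: "exp (- l b) = u * exp (- z)"
        unfolding u_def z_def by (simp flip: exp_add)
      \<comment> \<open>The old error times \<open>1 - d\<close>, the defect of one Euler step on
        the exact solution, and the window error \<open>r\<close>.\<close>
      have "D n b = D n a * (1 - d) + u * ((d - z) + (z - 1 + exp (- z))) + r"
        unfolding D_def r_def ub by (simp add: u_def algebra_simps)
      then have "\<bar>D n b\<bar> \<le> \<bar>D n a * (1 - d)\<bar> + \<bar>u * ((d - z) + (z - 1 + exp (- z)))\<bar> + \<bar>r\<bar>"
        by linarith
      \<comment> \<open>The factor \<open>\<bar>1 - d\<bar>\<close> is at most
        \<open>1 + d^2\<close>, so the old error is not amplified to first order; as it is at most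
        1, the excess is additive.\<close>
      moreover have "\<bar>D n a * (1 - d)\<bar> \<le> \<bar>D n a\<bar> + d\<^sup>2"
      proof -
        have D1: "\<bar>D n a\<bar> \<le> 1" unfolding D_def using Y(1)[of n a] Y(2)[of n a] u unfolding u_def by linarith
        have "\<bar>1 - d\<bar> \<le> 1 + d\<^sup>2"
        proof (cases "d \<le> 1")
          case False
          then have "d * 1 \<le> d * d" by (intro mult_left_mono) auto
          then show ?thesis using False unfolding power2_eq_square by linarith
        next
          case True
          then show ?thesis using d zero_le_power2[of d] by linarith
        qed
        then have "\<bar>D n a\<bar> * \<bar>1 - d\<bar> \<le> \<bar>D n a\<bar> * (1 + d\<^sup>2)" by (intro mult_left_mono) auto
        also have "\<dots> \<le> \<bar>D n a\<bar> + 1 * d\<^sup>2"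
          unfolding distrib_left using D1 by (intro add_mono mult_right_mono) auto
        finally show ?thesis by (simp add: abs_mult)
      qed
      moreover have "\<bar>u * ((d - z) + (z - 1 + exp (- z)))\<bar> \<le> \<bar>d - z\<bar> + z\<^sup>2"
      proof -
        have "\<bar>u * ((d - z) + (z - 1 + exp (- z)))\<bar> \<le> 1 * \<bar>(d - z) + (z - 1 + exp (- z))\<bar>"
          unfolding abs_mult using u by (intro mult_right_mono) auto
        also have "\<dots> \<le> \<bar>d - z\<bar> + z\<^sup>2"
          using exp_minus_second_order[of z] d0 unfolding z_def[symmetric]
          by (smt (verit))
        finally show ?thesis .
      qed
      ultimately show ?case using r unfolding e_def d_def[symmetric] z_def[symmetric] by linarith
    qed
    moreover have "e \<longlonglongrightarrow> 2 * (l b - l a)\<^sup>2 + 0 + \<bar>(l b - l a) - (l b - l a)\<bar> + (l b - l a)\<^sup>2"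
      unfolding e_def using ab by (intro tendsto_intros L \<epsilon>) auto
    moreover have "2 * (l b - l a)\<^sup>2 + 0 + \<bar>(l b - l a) - (l b - l a)\<bar> + (l b - l a)\<^sup>2 \<le> 3 * m\<^sup>2 * (b - a)\<^sup>2"
      using power_mono[OF lip[OF ab] d0, of 2] by (simp add: power_mult_distrib)
    ultimately show "\<exists>e. (\<forall>\<^sub>F n in sequentially. \<bar>D n b\<bar> \<le> \<bar>D n a\<bar> + e n) \<and> (\<exists>l. e \<longlonglongrightarrow> l \<and> l \<le> 3 * m\<^sup>2 * (b - a)\<^sup>2)"
      by blast
  qed (use c in auto)
  from tendsto_add[OF this tendsto_const[of "1 - exp (- l c)"]] show ?thesis
    by (simp add: D_def)
qed

text \<open>With the limit of \<open>Y\<close> known there is no feedback from \<open>X\<close>: its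
  increments add up to a left-endpoint Riemann sum of \<open>exp (- l)\<close> against
  \<open>h\<close>, and \<open>\<eta>\<close> has the same increments up to a quadratic
  error.\<close>

lemma window_limit_integral:
  fixes X Y H L :: "nat \<Rightarrow> real \<Rightarrow> real" and h l \<eta> :: "real \<Rightarrow> real" and \<epsilon> :: "nat \<Rightarrow> real"
  assumes c: "0 \<le> c" and X0: "\<And>n. X n 0 = 0"
    and Y: "\<And>t. 0 \<le> t \<Longrightarrow> t \<le> c \<Longrightarrow> (\<lambda>n. Y n t) \<longlonglongrightarrow> 1 - exp (- l t)"
    and L: "\<And>t. 0 \<le> t \<Longrightarrow> t \<le> c \<Longrightarrow> (\<lambda>n. L n t) \<longlonglongrightarrow> l t"
    and H: "\<And>t. 0 \<le> t \<Longrightarrow> t \<le> c \<Longrightarrow> (\<lambda>n. H n t) \<longlonglongrightarrow> h t"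
    and lip: "\<And>a b. 0 \<le> a \<Longrightarrow> a \<le> b \<Longrightarrow> b \<le> c \<Longrightarrow> \<bar>l b - l a\<bar> \<le> m * (b - a)"
    and \<eta>0: "\<eta> 0 = 0" and m': "0 \<le> m'"
    and \<eta>: "\<And>a b. 0 \<le> a \<Longrightarrow> a \<le> b \<Longrightarrow> b \<le> c \<Longrightarrow> \<bar>\<eta> b - \<eta> a - (h b - h a) * exp (- l a)\<bar> \<le> m' * (b - a)\<^sup>2"
    and \<epsilon>: "\<epsilon> \<longlonglongrightarrow> 0"
    and win: "\<forall>\<^sub>F n in sequentially. \<forall>a b. 0 \<le> a \<longrightarrow> a \<le> b \<longrightarrow> b \<le> c \<longrightarrow>
      \<bar>X n b - X n a - (H n b - H n a) * (1 - Y n a)\<bar> \<le> (L n b - L n a)\<^sup>2 + \<epsilon> n"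
  shows "(\<lambda>n. X n c) \<longlonglongrightarrow> \<eta> c"
proof -
  define D where "D n t = X n t - \<eta> t" for n t
  have "(\<lambda>n. D n c) \<longlonglongrightarrow> 0"
  proof (rule tendsto_zero_creeping[where M = "m\<^sup>2 + m'"])
    show "(\<lambda>n. D n 0) \<longlonglongrightarrow> 0" by (simp add: D_def X0 \<eta>0)
    fix a b assume ab: "0 \<le> a" "a \<le> b" "b \<le> c"
    define e where "e n = \<bar>(H n b - H n a) * (1 - Y n a) - (h b - h a) * exp (- l a)\<bar>
      + ((L n b - L n a)\<^sup>2 + \<epsilon> n) + m' * (b - a)\<^sup>2" for n
    have "\<forall>\<^sub>F n in sequentially. \<bar>D n b\<bar> \<le> \<bar>D n a\<bar> + e n"
      using win
    proof eventually_elim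
      case (elim n)
      then have "\<bar>X n b - X n a - (H n b - H n a) * (1 - Y n a)\<bar> \<le> (L n b - L n a)\<^sup>2 + \<epsilon> n"
        using ab by blast
      then show ?case using \<eta>[OF ab] unfolding D_def e_def by linarith
    qed
    moreover have "e \<longlonglongrightarrow> \<bar>(h b - h a) * (1 - (1 - exp (- l a))) - (h b - h a) * exp (- l a)\<bar>
      + ((l b - l a)\<^sup>2 + 0) + m' * (b - a)\<^sup>2"
      unfolding e_def using ab by (intro tendsto_intros L H Y \<epsilon>) auto
    moreover have "\<bar>(h b - h a) * (1 - (1 - exp (- l a))) - (h b - h a) * exp (- l a)\<bar>
      + ((l b - l a)\<^sup>2 + 0) + m' * (b - a)\<^sup>2 \<le> (m\<^sup>2 + m') * (b - a)\<^sup>2"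
    proof -
      have "(l b - l a)\<^sup>2 \<le> m\<^sup>2 * (b - a)\<^sup>2"
        using power_mono[OF lip[OF ab], of 2] by (simp only: power2_abs power_mult_distrib)
      then show ?thesis by (simp add: distrib_right)
    qed
    ultimately show "\<exists>e. (\<forall>\<^sub>F n in sequentially. \<bar>D n b\<bar> \<le> \<bar>D n a\<bar> + e n) \<and> (\<exists>l. e \<longlonglongrightarrow> l \<and> l \<le> (m\<^sup>2 + m') * (b - a)\<^sup>2)"
      by blast
  qed (use c m' in auto)
  from tendsto_add[OF this tendsto_const[of "\<eta> c"]] show ?thesis
    by (simp add: D_def)
qed

section \<open>Families of cycles\<close>

text \<open>At index 0 the division by zero makes this term 0, as it should be.\<close>

definition tree_term :: "nat \<Rightarrow> real \<Rightarrow> real" where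
  "tree_term j t = real j ^ j * t ^ j / (real j * fact j)"

definition tree_term_deriv :: "nat \<Rightarrow> real \<Rightarrow> real" where
  "tree_term_deriv j t = real j ^ j * t ^ (j - 1) / fact j"

lemma tree_term_nonneg: "0 \<le> t \<Longrightarrow> 0 \<le> tree_term j t"
  by (simp add: tree_term_def)

lemma tree_term_deriv_nonneg: "0 \<le> t \<Longrightarrow> 0 \<le> tree_term_deriv j t"
  by (simp add: tree_term_deriv_def)

lemma tree_term_mono: "0 \<le> s \<Longrightarrow> s \<le> t \<Longrightarrow> tree_term j s \<le> tree_term j t"
  unfolding tree_term_def by (intro divide_right_mono mult_left_mono power_mono) auto

lemma tree_term_deriv_mono: "0 \<le> s \<Longrightarrow> s \<le> t \<Longrightarrow> tree_term_deriv j s \<le> tree_term_deriv j t"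
  unfolding tree_term_deriv_def by (intro divide_right_mono mult_left_mono power_mono) auto

lemma tree_term_0 [simp]: "tree_term j 0 = 0"
  by (cases "j = 0") (auto simp: tree_term_def)

lemma has_real_derivative_tree_term:
  assumes "1 \<le> j"
  shows "(tree_term j has_real_derivative tree_term_deriv j t) (at t within A)"
  unfolding tree_term_def[abs_def] tree_term_deriv_def
  using assms by (auto intro!: derivative_eq_intros)

lemma continuous_on_tree_term: "continuous_on A (tree_term j)"
  unfolding tree_term_def[abs_def] divide_inverse by (intro continuous_intros)

lemma continuous_on_tree_term_deriv: "continuous_on A (tree_term_deriv j)"
  unfolding tree_term_deriv_def[abs_def] divide_inverse by (intro continuous_intros)

lemma exp_minus_lipschitz:
  fixes x y :: real
  assumes "0 \<le> x" "x \<le> y"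
  shows "\<bar>exp (- y) - exp (- x)\<bar> \<le> y - x"
proof -
  have "exp (- x) - exp (- y) = exp (- x) * (1 - exp (- (y - x)))"
    by (simp add: right_diff_distrib flip: exp_add)
  also have "\<dots> \<le> 1 * (y - x)"
  proof (rule mult_mono)
    show "1 - exp (- (y - x)) \<le> y - x" using exp_ge_add_one_self[of "- (y - x)"] by linarith
  qed (use assms in auto)
  finally show ?thesis using assms by simp
qed

text \<open>Mean value inequality for \<open>\<eta> s - h s * exp (- l a)\<close>: the derivative
  \<open>h' s * (exp (- l s) - exp (- l a))\<close> is itself of order \<open>b - a\<close>.\<close>

lemma integral_weight_increment:
  fixes h h' l :: "real \<Rightarrow> real"
  assumes h: "\<And>s. s \<in> {0..c} \<Longrightarrow> (h has_real_derivative h' s) (at s within {0..c})"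
    and h': "\<And>s. s \<in> {0..c} \<Longrightarrow> \<bar>h' s\<bar> \<le> P" "continuous_on {0..c} h'"
    and l: "\<And>s. s \<in> {0..c} \<Longrightarrow> 0 \<le> l s" "continuous_on {0..c} l"
      "\<And>a b. 0 \<le> a \<Longrightarrow> a \<le> b \<Longrightarrow> b \<le> c \<Longrightarrow> l a \<le> l b \<and> l b - l a \<le> m * (b - a)"
    and m: "0 \<le> m"
    and ab: "0 \<le> a" "a \<le> b" "b \<le> c"
  defines "\<eta> \<equiv> \<lambda>t. integral {0..t} (\<lambda>s. h' s * exp (- l s))"
  shows "\<bar>\<eta> b - \<eta> a - (h b - h a) * exp (- l a)\<bar> \<le> P * m * (b - a)\<^sup>2"
proof -
  have cont: "continuous_on {0..c} (\<lambda>s. h' s * exp (- l s))"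
    by (intro continuous_intros h' l)
  have \<eta>: "(\<eta> has_real_derivative h' s * exp (- l s)) (at s within {a..b})" if "s \<in> {a..b}" for s
    unfolding \<eta>_def
    by (rule has_field_derivative_subset[OF integral_has_real_derivative[OF cont]]) (use that ab in auto)
  have P: "0 \<le> P" using h'(1)[of a] ab by auto
  define \<phi> where "\<phi> s = \<eta> s - h s * exp (- l a)" for s
  have "norm (\<phi> b - \<phi> a) \<le> P * (m * (b - a)) * norm (b - a)"
  proof (rule field_differentiable_bound[where S = "{a..b}"])
    show "(\<phi> has_real_derivative h' s * exp (- l s) - h' s * exp (- l a)) (at s within {a..b})"
      if "s \<in> {a..b}" for s
      unfolding \<phi>_def using that ab
      by (intro derivative_intros \<eta> has_field_derivative_subset[OF h]) (auto intro!: derivative_eq_intros has_field_derivative_subset[OF h])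
    show "norm (h' s * exp (- l s) - h' s * exp (- l a)) \<le> P * (m * (b - a))" if s: "s \<in> {a..b}" for s
    proof -
      have "\<bar>exp (- l s) - exp (- l a)\<bar> \<le> l s - l a"
        using s ab by (intro exp_minus_lipschitz l) (auto dest: l(3))
      also have "\<dots> \<le> m * (s - a)" using s ab l(3)[of a s] by auto
      also have "\<dots> \<le> m * (b - a)" using s m by (intro mult_left_mono) auto
      finally have "\<bar>h' s\<bar> * \<bar>exp (- l s) - exp (- l a)\<bar> \<le> P * (m * (b - a))"
        using h'(1)[of s] s ab P by (intro mult_mono) auto
      then show ?thesis by (simp add: abs_mult flip: right_diff_distrib)
    qed
  qed (use ab in auto)
  moreover have "\<phi> b - \<phi> a = \<eta> b - \<eta> a - (h b - h a) * exp (- l a)"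
    by (simp add: \<phi>_def algebra_simps)
  ultimately show ?thesis using ab by (simp add: power2_eq_square mult_ac)
qed

text \<open>\<open>\<kappa>\<close> is 1 for directed and 1/2 for undirected cycles; the last assumption says that
  intersecting pairs of cycles span fewer vertices than edges.\<close>

locale cycle_model =
  fixes E :: "nat \<Rightarrow> 'e set" and Cy :: "nat \<Rightarrow> 'e set set" and \<kappa> :: real and j0 :: nat
  assumes finite_E: "\<And>n. finite (E n)"
    and Cy_subset: "\<And>n. Cy n \<subseteq> Pow (E n)"
    and \<kappa>_pos: "0 < \<kappa>"
    and j0: "1 \<le> j0"
    and card_ge: "\<And>n C. C \<in> Cy n \<Longrightarrow> j0 \<le> card C"
    and count_le: "\<And>n j. j0 \<le> j \<Longrightarrow> real (card {C \<in> Cy n. card C = j}) \<le> \<kappa> / real j * real n ^ j"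
    and count_lim: "\<And>j. j0 \<le> j \<Longrightarrow> (\<lambda>n. real (card {C \<in> Cy n. card C = j}) / real n ^ j) \<longlonglongrightarrow> \<kappa> / real j"
    and overlap_lim: "\<And>j k. j0 \<le> j \<Longrightarrow> j0 \<le> k \<Longrightarrow>
      (\<lambda>n. \<Sum>(C, C')\<in>{(C, C'). C \<in> Cy n \<and> C' \<in> Cy n \<and> card C = j \<and> card C' = k \<and> C \<noteq> C' \<and> C \<inter> C' \<noteq> {}}.
        (1 / real n) ^ card (C \<union> C')) \<longlonglongrightarrow> 0"
begin

definition cyc :: "nat \<Rightarrow> nat \<Rightarrow> 'e set set" where "cyc j n = {C \<in> Cy n. card C = j}"

definition short :: "nat \<Rightarrow> nat \<Rightarrow> 'e set set" where "short K n = {C \<in> Cy n. card C \<le> K}"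

definition lam :: "nat \<Rightarrow> real \<Rightarrow> real" where "lam j t = \<kappa> * tree_term j t"

definition Lam :: "nat \<Rightarrow> real \<Rightarrow> real" where "Lam K t = (\<Sum>j=j0..K. lam j t)"

definition lam' :: "nat \<Rightarrow> real \<Rightarrow> real" where "lam' j t = \<kappa> * tree_term_deriv j t"

definition Lam' :: "nat \<Rightarrow> real \<Rightarrow> real" where "Lam' K t = (\<Sum>j=j0..K. lam' j t)"

text \<open>Time is measured in units of \<open>1 / n\<close>, the scale on which the expected
  numbers converge.\<close>

definition expected :: "nat \<Rightarrow> 'e set set \<Rightarrow> real \<Rightarrow> real" where
  "expected n J t = (\<Sum>C\<in>J. mean_prob (E n) C (t / real n))"

lemma Cy_Pow: "Cy n \<subseteq> Pow (E n) - {{}}"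
  using Cy_subset card_ge[of "{}"] j0 by fastforce

lemma finite_Cy: "finite (Cy n)"
  by (rule finite_subset[OF Cy_subset]) (simp add: finite_E)

lemma short_Pow: "short K n \<subseteq> Pow (E n) - {{}}"
  using Cy_Pow by (auto simp: short_def)

lemma cyc_subset_short: "j \<le> K \<Longrightarrow> cyc j n \<subseteq> short K n"
  by (auto simp: cyc_def short_def)

lemma sum_by_length:
  assumes "S \<subseteq> Cy n" "\<And>C. C \<in> S \<Longrightarrow> card C \<in> I" "finite I"
  shows "sum f S = (\<Sum>j\<in>I. sum f {C\<in>S. card C = j})"
  using assms finite_subset[OF assms(1) finite_Cy]
  by (intro sum.group[symmetric]) auto

lemma expected_cyc:
  assumes "0 \<le> t"
  shows "expected n (cyc j n) t = real (card (cyc j n)) * erlang_CDF (j - 1) 1 (real j * (t / real n))"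
proof -
  have "mean_prob (E n) C (t / real n) = erlang_CDF (j - 1) 1 (real j * (t / real n))" if "C \<in> cyc j n" for C
  proof -
    have "C \<subseteq> E n" "C \<noteq> {}" "card C = j" using that Cy_Pow by (auto simp: cyc_def)
    then show ?thesis using mean_prob_eq_erlang[OF finite_E, of C n "t / real n"] assms by simp
  qed
  then show ?thesis by (simp add: expected_def)
qed

text \<open>Valid for every \<open>n > 0\<close> and not only in the limit, so that a union bound
  can run over lengths that grow with \<open>n\<close>.\<close>

lemma expected_cyc_le:
  assumes t: "0 \<le> t" and j: "j0 \<le> j" and n: "0 < n"
  shows "expected n (cyc j n) t \<le> lam j t"
proof -
  have "expected n (cyc j n) t \<le> (\<kappa> / real j * real n ^ j) * ((real j * (t / real n)) ^ j / fact j)"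
    unfolding expected_cyc[OF t]
    using t j j0 \<kappa>_pos count_le[OF j, of n] by (intro mult_mono erlang_CDF_bounds) (auto simp: cyc_def)
  also have "\<dots> = lam j t"
    using n j j0 by (simp add: lam_def tree_term_def power_divide power_mult_distrib)
  finally show ?thesis .
qed

text \<open>The count is asymptotic to \<open>\<kappa> / j * n ^ j\<close>, and the correction
  factor of \<open>erlang_CDF_bounds\<close> tends to 1, its argument being of order
  \<open>1 / n\<close>.\<close>

lemma expected_cyc_lim:
  assumes t: "0 \<le> t" and j: "j0 \<le> j"
  shows "(\<lambda>n. expected n (cyc j n) t) \<longlonglongrightarrow> lam j t"
proof (rule tendsto_sandwich)
  show "\<forall>\<^sub>F n in sequentially. expected n (cyc j n) t \<le> lam j t"
    using eventually_gt_at_top[of 0] by eventually_elim (rule expected_cyc_le[OF t j])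
  let ?g = "\<lambda>n. exp (- 2 * (real j * (t / real n))) * (real (card (cyc j n)) / real n ^ j * ((real j * t) ^ j / fact j))"
  show "\<forall>\<^sub>F n in sequentially. ?g n \<le> expected n (cyc j n) t"
    using eventually_gt_at_top[of 0]
  proof eventually_elim
    case (elim n)
    have "?g n = real (card (cyc j n)) * (exp (- 2 * (real j * (t / real n))) * ((real j * (t / real n)) ^ j / fact j))"
      using elim by (simp add: power_divide power_mult_distrib)
    also have "\<dots> \<le> expected n (cyc j n) t"
      unfolding expected_cyc[OF t] using t j j0 by (intro mult_left_mono erlang_CDF_bounds) auto
    finally show ?case .
  qed
  have "?g \<longlonglongrightarrow> exp (- 2 * (real j * 0)) * (\<kappa> / real j * ((real j * t) ^ j / fact j))"
    unfolding cyc_def by (intro tendsto_intros count_lim j lim_const_over_n)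
  also have "exp (- 2 * (real j * 0)) * (\<kappa> / real j * ((real j * t) ^ j / fact j)) = lam j t"
    by (simp add: lam_def tree_term_def power_mult_distrib)
  finally show "?g \<longlonglongrightarrow> lam j t" .
qed simp

lemma expected_short: "expected n (short K n) t = (\<Sum>j=j0..K. expected n (cyc j n) t)"
proof -
  have "expected n (short K n) t = (\<Sum>j=j0..K. \<Sum>C\<in>{C \<in> short K n. card C = j}. mean_prob (E n) C (t / real n))"
    unfolding expected_def by (rule sum_by_length[where n = n]) (auto simp: short_def card_ge)
  moreover have "{C \<in> short K n. card C = j} = cyc j n" if "j \<in> {j0..K}" for j
    using that by (auto simp: short_def cyc_def)
  ultimately show ?thesis by (simp add: expected_def)
qed

lemma expected_short_lim: "0 \<le> t \<Longrightarrow> (\<lambda>n. expected n (short K n) t) \<longlonglongrightarrow> Lam K t"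
  unfolding expected_short Lam_def by (intro tendsto_sum expected_cyc_lim) auto

lemma expected_mono:
  assumes "J \<subseteq> Cy n" "a \<le> b"
  shows "expected n J a \<le> expected n J b"
  unfolding expected_def
  by (intro sum_mono mean_prob_mono[OF finite_E Cy_Pow]) (use assms in \<open>auto intro: divide_right_mono\<close>)

lemma Lam_nonneg: "0 \<le> t \<Longrightarrow> 0 \<le> Lam K t"
  using \<kappa>_pos by (auto simp: Lam_def lam_def intro!: sum_nonneg mult_nonneg_nonneg tree_term_nonneg)

lemma Lam_mono: "0 \<le> s \<Longrightarrow> s \<le> t \<Longrightarrow> Lam K s \<le> Lam K t"
  using \<kappa>_pos by (auto simp: Lam_def lam_def intro!: sum_mono tree_term_mono)

lemma lam'_nonneg: "0 \<le> t \<Longrightarrow> 0 \<le> lam' j t"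
  using \<kappa>_pos by (simp add: lam'_def tree_term_deriv_nonneg)

lemma lam'_mono: "0 \<le> s \<Longrightarrow> s \<le> t \<Longrightarrow> lam' j s \<le> lam' j t"
  using \<kappa>_pos by (simp add: lam'_def tree_term_deriv_mono)

lemma Lam'_nonneg: "0 \<le> t \<Longrightarrow> 0 \<le> Lam' j t"
  by (auto simp: Lam'_def intro!: sum_nonneg lam'_nonneg)

lemma Lam'_mono: "0 \<le> s \<Longrightarrow> s \<le> t \<Longrightarrow> Lam' j s \<le> Lam' j t"
  by (auto simp: Lam'_def intro!: sum_mono lam'_mono)

lemma has_real_derivative_lam: "1 \<le> j \<Longrightarrow> (lam j has_real_derivative lam' j t) (at t within A)"
  unfolding lam_def[abs_def] lam'_def by (intro DERIV_cmult has_real_derivative_tree_term)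

lemma has_real_derivative_Lam: "(Lam K has_real_derivative Lam' K t) (at t within A)"
  unfolding Lam_def[abs_def] Lam'_def using j0 by (intro DERIV_sum has_real_derivative_lam) auto

lemma continuous_on_Lam: "continuous_on A (Lam K)"
  unfolding Lam_def[abs_def] lam_def by (intro continuous_intros continuous_on_tree_term)

lemma continuous_on_lam': "continuous_on A (lam' j)"
  unfolding lam'_def[abs_def] by (intro continuous_intros continuous_on_tree_term_deriv)

lemma Lam_lipschitz:
  assumes "0 \<le> a" "a \<le> b" "b \<le> c"
  shows "Lam K b - Lam K a \<le> Lam' K c * (b - a)"
proof -
  have "norm (Lam K b - Lam K a) \<le> Lam' K c * norm (b - a)"
    by (rule field_differentiable_bound[where S = "{a..b}", OF _ has_real_derivative_Lam])
      (use assms in \<open>auto simp: Lam'_nonneg intro!: Lam'_mono\<close>)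
  then show ?thesis using assms by simp
qed

end

section \<open>Stirling's formula\<close>

lemma wallis_product_eq:
  "(\<Prod>k=1..n. (4 * real k ^ 2) / (4 * real k ^ 2 - 1)) = (2 ^ n * fact n) ^ 4 / ((fact (2 * n)) ^ 2 * (2 * real n + 1))"
proof (induction n)
  case (Suc n)
  have *: "4 * (1 + real n)\<^sup>2 - 1 = (2 * real n + 1) * (2 * real n + 3)" by (simp add: power2_eq_square algebra_simps)
  have f: "fact (2 * Suc n) = (2 * real n + 2) * (2 * real n + 1) * fact (2 * n)"
    by (simp add: algebra_simps)
  have "(\<Prod>k=1..Suc n. (4 * real k ^ 2) / (4 * real k ^ 2 - 1))
      = (2 ^ n * fact n) ^ 4 / ((fact (2 * n)) ^ 2 * (2 * real n + 1)) * (4 * (1 + real n)\<^sup>2 / ((2 * real n + 1) * (2 * real n + 3)))"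
    using Suc by (simp add: * add.commute)
  also have "\<dots> = (2 ^ Suc n * fact (Suc n)) ^ 4 / ((fact (2 * Suc n)) ^ 2 * (2 * real (Suc n) + 1))"
    unfolding f by (simp add: divide_simps) (simp add: algebra_simps power2_eq_square power4_eq_xxxx)
  finally show ?case .
qed simp

definition stirling_ratio :: "nat \<Rightarrow> real" where
  "stirling_ratio n = fact n / (real n ^ n * exp (- real n) * sqrt (real n))"

lemma stirling_ratio_pos: "0 < n \<Longrightarrow> 0 < stirling_ratio n"
  by (simp add: stirling_ratio_def)

text \<open>The increments of the logarithm are of order \<open>1 / n^2\<close>, hence summable. The
  shift avoids the index 0, where the ratio divides by zero.\<close>

lemma convergent_ln_stirling_ratio: "convergent (\<lambda>n. ln (stirling_ratio (Suc n)))"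
proof -
  define d where "d n = ln (stirling_ratio (Suc (Suc n))) - ln (stirling_ratio (Suc n))" for n
  have ln_eq: "ln (stirling_ratio n) = ln (fact n) - real n * ln (real n) + real n - ln (real n) / 2" if "0 < n" for n
    using that by (simp add: stirling_ratio_def ln_div ln_mult ln_realpow ln_sqrt)
  have d: "d n = 1 - (real n + 3 / 2) * ln (1 + 1 / (real n + 1))" for n
  proof -
    define A B F where "A = ln (real n + 1)" and "B = ln (real n + 2)" and "F = ln (fact (Suc n) :: real)"
    have "fact (Suc (Suc n)) = (real n + 2) * fact (Suc n)" by (simp add: algebra_simps)
    then have "ln (fact (Suc (Suc n)) :: real) = B + F"
      unfolding B_def F_def by (simp only: ln_mult_pos fact_gt_zero)
    then have e1: "ln (stirling_ratio (Suc (Suc n))) = (B + F) - (real n + 2) * B + (real n + 2) - B / 2"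
      by (subst ln_eq) (simp_all add: B_def add.commute del: fact_Suc)
    have e2: "ln (stirling_ratio (Suc n)) = F - (real n + 1) * A + (real n + 1) - A / 2"
      by (subst ln_eq) (simp_all add: A_def F_def add.commute del: fact_Suc)
    have e3: "ln (1 + 1 / (real n + 1)) = B - A"
    proof -
      have "1 + 1 / (real n + 1) = (real n + 2) / (real n + 1)" by (simp add: field_simps)
      then show ?thesis by (simp add: ln_div A_def B_def)
    qed
    show ?thesis
      unfolding d_def e1 e2 e3 by (simp add: algebra_simps add_divide_distrib diff_divide_distrib)
  qed
  have "(\<lambda>n. 1 - (real n + 3 / 2) * ln (1 + 1 / (real n + 1))) \<in> O(\<lambda>n. inverse (real n ^ 2))"
    by real_asymp
  then have "summable d"
    unfolding d[abs_def]
    by (rule summable_comparison_test_bigo[rotated]) (simp add: inverse_power_summable)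
  then have "convergent (\<lambda>n. \<Sum>i<n. d i)" by (simp add: summable_iff_convergent)
  moreover have "(\<Sum>i<n. d i) = ln (stirling_ratio (Suc n)) - ln (stirling_ratio (Suc 0))" for n
    unfolding d_def by (rule sum_lessThan_telescope)
  ultimately show ?thesis
    using convergent_add_const_right_iff[of _ "- ln (stirling_ratio (Suc 0))"] by simp
qed

text \<open>Convergence leaves the constant open. In
  \<open>stirling_ratio n ^ 4 / stirling_ratio (2 * n) ^ 2\<close> the powers and exponentials
  cancel and leave, up to a rational factor, the Wallis product; this gives the square of the
  constant.\<close>

lemma stirling_ratio_lim: "stirling_ratio \<longlonglongrightarrow> sqrt (2 * pi)"
proof -
  obtain l where l: "(\<lambda>n. ln (stirling_ratio (Suc n))) \<longlonglongrightarrow> l"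
    using convergent_ln_stirling_ratio by (auto simp: convergent_def)
  then have "(\<lambda>n. exp (ln (stirling_ratio (Suc n)))) \<longlonglongrightarrow> exp l" by (intro tendsto_exp)
  then have "(\<lambda>n. stirling_ratio (Suc n)) \<longlonglongrightarrow> exp l" by (simp add: stirling_ratio_pos)
  then have C: "stirling_ratio \<longlonglongrightarrow> exp l" by (rule LIMSEQ_imp_Suc)
  have C2: "(\<lambda>n. stirling_ratio (2 * n)) \<longlonglongrightarrow> exp l"
    using LIMSEQ_subseq_LIMSEQ[OF C, of "\<lambda>n. 2 * n"] by (simp add: strict_mono_def o_def)
  have frac: "(\<lambda>n. real n / (2 * (2 * real n + 1))) \<longlonglongrightarrow> 1 / 4" by real_asymp
  have "(\<lambda>n. stirling_ratio n ^ 4 / stirling_ratio (2 * n) ^ 2 * (real n / (2 * (2 * real n + 1))))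
      \<longlonglongrightarrow> exp l ^ 4 / exp l ^ 2 * (1 / 4)"
    by (intro tendsto_intros C C2 frac) simp
  moreover have "\<forall>\<^sub>F n in sequentially. stirling_ratio n ^ 4 / stirling_ratio (2 * n) ^ 2 * (real n / (2 * (2 * real n + 1)))
      = (\<Prod>k=1..n. (4 * real k ^ 2) / (4 * real k ^ 2 - 1))"
    using eventually_gt_at_top[of 0]
  proof eventually_elim
    case (elim n)
    have f: "fact n = stirling_ratio n * (real n ^ n * exp (- real n) * sqrt (real n))"
      "fact (2 * n) = stirling_ratio (2 * n) * (real (2 * n) ^ (2 * n) * exp (- real (2 * n)) * sqrt (real (2 * n)))"
      using elim by (simp_all add: stirling_ratio_def)
    have s: "sqrt (real n) ^ 4 = real n ^ 2" "sqrt (real (2 * n)) ^ 2 = 2 * real n"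
      using power_mult[of "sqrt (real n)" 2 2] by simp_all
    have e: "exp (- real n) ^ 4 = exp (- real (2 * n)) ^ 2"
      by (simp flip: exp_of_nat_mult)
    have p: "(real (2 * n) ^ (2 * n)) ^ 2 = (2 ^ n) ^ 4 * (real n ^ n) ^ 4"
      by (simp add: power_mult_distrib flip: power_mult) (simp add: mult_ac)
    have "(2 ^ n * fact n) ^ 4 = (2 ^ n) ^ 4 * (stirling_ratio n ^ 4 * ((real n ^ n) ^ 4 * exp (- real n) ^ 4 * (real n)\<^sup>2))"
      unfolding f(1) by (simp only: power_mult_distrib s)
    moreover have "(fact (2 * n)) ^ 2 = stirling_ratio (2 * n) ^ 2 * ((2 ^ n) ^ 4 * (real n ^ n) ^ 4 * exp (- real n) ^ 4 * (2 * real n))"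
      unfolding f(2) by (simp only: power_mult_distrib s e p mult.assoc)
    ultimately show ?case
      unfolding wallis_product_eq using elim stirling_ratio_pos[of "2 * n"]
      by (simp add: divide_simps power2_eq_square)
  qed
  ultimately have "(\<lambda>n. \<Prod>k=1..n. (4 * real k ^ 2) / (4 * real k ^ 2 - 1)) \<longlonglongrightarrow> exp l ^ 4 / exp l ^ 2 * (1 / 4)"
    by (rule Lim_transform_eventually)
  from LIMSEQ_unique[OF this wallis] have "exp l ^ 4 / exp l ^ 2 * (1 / 4) = pi / 2" .
  moreover have "exp l ^ 4 / exp l ^ 2 = exp l ^ 2" by (simp add: power4_eq_xxxx power2_eq_square)
  ultimately have "exp l ^ 2 = 2 * pi" by simp
  then have "exp l = sqrt (2 * pi)" by (metis exp_ge_zero real_sqrt_unique)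
  with C show ?thesis by simp
qed

text \<open>Displays the threshold: geometric growth with ratio \<open>exp 1 * c\<close>, damped by
  the power -3/2 of \<open>j\<close>.\<close>

lemma tree_term_stirling:
  assumes "0 < j"
  shows "tree_term j c = (exp 1 * c) ^ j / (real j * sqrt (real j)) / stirling_ratio j"
proof -
  have "exp (- real j) * exp 1 ^ j = 1" by (simp flip: exp_of_nat_mult exp_add)
  then have "(exp 1 * c) ^ j * exp (- real j) = c ^ j" by (simp add: power_mult_distrib mult_ac)
  then show ?thesis
    using assms unfolding tree_term_def stirling_ratio_def
    by (simp add: divide_simps mult_ac)
qed

lemma summable_tree_term_inv_e: "summable (\<lambda>j. tree_term j (1 / exp 1))"
proof (rule summable_comparison_test_bigo)
  show "summable (\<lambda>j. norm (real j powr (- 3 / 2)))" by (simp add: summable_real_powr_iff)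
  have "(\<lambda>j. tree_term j (1 / exp 1) / real j powr (- 3 / 2)) \<longlonglongrightarrow> 1 / sqrt (2 * pi)"
  proof (rule Lim_transform_eventually)
    show "(\<lambda>j. 1 / stirling_ratio j) \<longlonglongrightarrow> 1 / sqrt (2 * pi)"
      by (intro tendsto_intros stirling_ratio_lim) simp
    show "\<forall>\<^sub>F j in sequentially. 1 / stirling_ratio j = tree_term j (1 / exp 1) / real j powr (- 3 / 2)"
      using eventually_gt_at_top[of 0]
    proof eventually_elim
      case (elim j)
      have "real j powr (3 / 2) = real j powr 1 * real j powr (1 / 2)" by (simp only: powr_add[symmetric]) simp
      then have "real j powr (3 / 2) = real j * sqrt (real j)" using elim by (simp add: powr_half_sqrt)
      then show ?case using elim stirling_ratio_pos[OF elim]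
        by (simp add: tree_term_stirling powr_minus divide_simps)
    qed
  qed
  then show "(\<lambda>j. tree_term j (1 / exp 1)) \<in> O(\<lambda>j. real j powr (- 3 / 2))"
    by (rule bigoI_tendsto) (auto simp: eventually_gt_at_top elim!: eventually_mono[OF eventually_gt_at_top[of 0]])
qed

lemma tree_term_at_top:
  assumes "1 / exp 1 < c"
  shows "filterlim (\<lambda>j. tree_term j c) at_top sequentially"
proof -
  define x where "x = exp 1 * c"
  have x: "1 < x" using assms by (simp add: x_def field_simps)
  then have "filterlim (\<lambda>j. x ^ j / (real j * sqrt (real j))) at_top sequentially" by real_asymp
  moreover have "(\<lambda>j. 1 / stirling_ratio j) \<longlonglongrightarrow> 1 / sqrt (2 * pi)"
    by (intro tendsto_intros stirling_ratio_lim) simp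
  ultimately have "filterlim (\<lambda>j. 1 / stirling_ratio j * (x ^ j / (real j * sqrt (real j)))) at_top sequentially"
    by (intro filterlim_tendsto_pos_mult_at_top) auto
  moreover have "\<forall>\<^sub>F j in sequentially. 1 / stirling_ratio j * (x ^ j / (real j * sqrt (real j))) = tree_term j c"
    using eventually_gt_at_top[of 0] by eventually_elim (simp add: tree_term_stirling x_def)
  ultimately show ?thesis by (simp add: filterlim_cong)
qed

section \<open>Cycles of bounded length\<close>

context cycle_model
begin

text \<open>Up to constants depending on the length bound and the time, this dominates the expected
  number of light intersecting pairs.\<close>

definition overlap :: "nat \<Rightarrow> nat \<Rightarrow> nat \<Rightarrow> real" where
  "overlap j k n = (\<Sum>(C, C')\<in>{(C, C'). C \<in> Cy n \<and> C' \<in> Cy n \<and> card C = j \<and> card C' = k \<and> C \<noteq> C' \<and> C \<inter> C' \<noteq> {}}.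
        (1 / real n) ^ card (C \<union> C'))"

text \<open>The second sum is the diagonal \<open>C = C'\<close> of the upper estimate: at most
  \<open>\<kappa> / j * n ^ j\<close> cycles, each with a squared probability of order
  \<open>n ^ (- 2 * j)\<close>.\<close>

definition pair_error :: "nat \<Rightarrow> nat \<Rightarrow> real" where
  "pair_error K n = (\<Sum>j=j0..K. \<Sum>k=j0..K. overlap j k n) + (\<Sum>j=j0..K. \<kappa> / real j * (1 / real n) ^ j)"

lemma pair_error_lim: "pair_error K \<longlonglongrightarrow> 0"
proof -
  have "(\<lambda>n. (\<Sum>j=j0..K. \<Sum>k=j0..K. overlap j k n) + (\<Sum>j=j0..K. \<kappa> / real j * (1 / real n) ^ j))
      \<longlonglongrightarrow> (\<Sum>j=j0..K. \<Sum>k=j0..K. 0) + (\<Sum>j=j0..K. \<kappa> / real j * 0 ^ j)"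
    unfolding overlap_def
    by (intro tendsto_add tendsto_sum tendsto_mult tendsto_const tendsto_power overlap_lim lim_const_over_n) auto
  also have "(\<Sum>j=j0..K. \<Sum>k=j0..K. 0) + (\<Sum>j=j0..K. \<kappa> / real j * 0 ^ j) = (0::real)"
    using j0 by (auto intro!: sum.neutral)
  finally show ?thesis by (simp add: pair_error_def[abs_def])
qed

lemma short_pair_sum_le:
  assumes f: "\<And>C C'. C \<in> short K n \<Longrightarrow> C' \<in> short K n \<Longrightarrow> C \<noteq> C' \<Longrightarrow> C \<inter> C' \<noteq> {} \<Longrightarrow>
      f C C' \<le> B * (1 / real n) ^ card (C \<union> C')"
  shows "(\<Sum>C\<in>short K n. \<Sum>C'\<in>{C'\<in>short K n. C' \<noteq> C \<and> C \<inter> C' \<noteq> {}}. f C C')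
      \<le> B * (\<Sum>j=j0..K. \<Sum>k=j0..K. overlap j k n)"
proof -
  let ?P = "{(C, C'). C \<in> short K n \<and> C' \<in> short K n \<and> C \<noteq> C' \<and> C \<inter> C' \<noteq> {}}"
  let ?g = "\<lambda>(C, C'). (1 / real n) ^ card (C \<union> C')"
  have fin: "finite (short K n)" unfolding short_def by (simp add: finite_Cy)
  have finP: "finite ?P" by (rule finite_subset[of _ "short K n \<times> short K n"]) (auto simp: fin)
  have "(\<Sum>C\<in>short K n. \<Sum>C'\<in>{C'\<in>short K n. C' \<noteq> C \<and> C \<inter> C' \<noteq> {}}. f C C')
      = (\<Sum>(C, C')\<in>(SIGMA C:short K n. {C'\<in>short K n. C' \<noteq> C \<and> C \<inter> C' \<noteq> {}}). f C C')"
    using fin by (intro sum.Sigma) auto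
  also have "(SIGMA C:short K n. {C'\<in>short K n. C' \<noteq> C \<and> C \<inter> C' \<noteq> {}}) = ?P" by auto
  also have "(\<Sum>(C, C')\<in>?P. f C C') \<le> (\<Sum>p\<in>?P. B * ?g p)"
    by (intro sum_mono) (auto intro: f)
  also have "\<dots> = B * sum ?g ?P" by (simp add: sum_distrib_left)
  also have "sum ?g ?P = (\<Sum>q\<in>{j0..K} \<times> {j0..K}. sum ?g {p \<in> ?P. (card (fst p), card (snd p)) = q})"
    using finP by (intro sum.group[symmetric]) (auto simp: short_def card_ge)
  also have "\<dots> = (\<Sum>(j, k)\<in>{j0..K} \<times> {j0..K}. overlap j k n)"
    unfolding overlap_def
    by (intro sum.cong refl) (auto simp: short_def intro!: sum.cong)
  also have "\<dots> = (\<Sum>j=j0..K. \<Sum>k=j0..K. overlap j k n)"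
    by (simp add: sum.cartesian_product)
  finally show ?thesis .
qed

text \<open>One constant serves all times up to \<open>c\<close> and all exponents up to
  \<open>2 * K\<close>, as the base is raised to at least 1. Lowering the exponent to
  \<open>m\<close> treats the exponent \<open>card C + card C'\<close> of a product like the size of
  the union.\<close>

lemma power_bound:
  assumes "0 \<le> t" "t \<le> c" "m \<le> N" "N \<le> 2 * K" "0 < n"
  shows "(real K * (t / real n)) ^ N \<le> max 1 (real K * c) ^ (2 * K) * (1 / real n) ^ m"
proof -
  have "(real K * (t / real n)) ^ N = (real K * t) ^ N * (1 / real n) ^ N"
    by (simp add: power_mult_distrib power_divide)
  also have "\<dots> \<le> max 1 (real K * c) ^ (2 * K) * (1 / real n) ^ m"
  proof (intro mult_mono)
    have "(real K * t) ^ N \<le> max 1 (real K * c) ^ N"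
      using assms by (intro power_mono) (auto simp: le_max_iff_disj intro!: disjI2 mult_left_mono)
    also have "\<dots> \<le> max 1 (real K * c) ^ (2 * K)" using assms by (intro power_increasing) auto
    finally show "(real K * t) ^ N \<le> max 1 (real K * c) ^ (2 * K)" .
    show "(1 / real n) ^ N \<le> (1 / real n) ^ m" using assms by (intro power_decreasing) auto
  qed auto
  finally show ?thesis .
qed

text \<open>Merges both window estimates; the part that vanishes with \<open>n\<close> no longer
  depends on \<open>a\<close> and \<open>b\<close>, as the limit lemmas require.\<close>

lemma window_bound:
  assumes n: "0 < n" and J: "J \<subseteq> short K n" and ab: "0 \<le> a" "a \<le> b" "b \<le> c"
  shows "\<bar>argmin_prob (E n) (short K n) J (b / real n) - argmin_prob (E n) (short K n) J (a / real n)
      - (expected n J b - expected n J a) * (1 - argmin_prob (E n) (short K n) (short K n) (a / real n))\<bar>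
    \<le> (expected n (short K n) b - expected n (short K n) a)\<^sup>2 + max 1 (real K * c) ^ (2 * K) * pair_error K n"
proof -
  let ?S = "short K n" and ?B = "max 1 (real K * c) ^ (2 * K)" and ?b = "b / real n" and ?a = "a / real n"
  interpret prob_space "exp_weights (E n)" by (rule prob_space_exp_weights)
  have ab': "?a \<le> ?b" "0 \<le> ?b" using ab by (auto intro: divide_right_mono)
  have S: "C \<subseteq> E n \<and> C \<noteq> {} \<and> card C \<le> K \<and> finite C" if "C \<in> ?S" for C
    using that short_Pow[of K n] finite_E[of n] finite_subset by (auto simp: short_def)
  have fin: "finite ?S" unfolding short_def by (simp add: finite_Cy)
  have card_Un: "card (C \<union> C') \<le> 2 * K" if "C \<in> ?S" "C' \<in> ?S" for C C'
    using card_Un_le[of C C'] S[OF that(1)] S[OF that(2)] by linarith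
  have overlap0: "0 \<le> overlap j k n" for j k
    unfolding overlap_def by (intro sum_nonneg) auto
  have B: "1 \<le> ?B" by simp
  define O' where "O' = (\<Sum>j=j0..K. \<Sum>k=j0..K. overlap j k n)"
  define R where "R = (\<Sum>j=j0..K. \<kappa> / real j * (1 / real n) ^ j)"
  have O0: "0 \<le> O'" and R0: "0 \<le> R"
    unfolding O'_def R_def using \<kappa>_pos by (auto intro!: sum_nonneg overlap0)
  have joint: "(\<Sum>C\<in>?S. \<Sum>C'\<in>{C'\<in>?S. C' \<noteq> C \<and> C \<inter> C' \<noteq> {}}.
      \<P>(w in exp_weights (E n). mean_weight w C \<le> ?b \<and> mean_weight w C' \<le> ?b)) \<le> ?B * O'"
    unfolding O'_def
  proof (rule short_pair_sum_le)
    fix C C' assume C: "C \<in> ?S" "C' \<in> ?S"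
    have "\<P>(w in exp_weights (E n). mean_weight w C \<le> ?b \<and> mean_weight w C' \<le> ?b) \<le> (real K * ?b) ^ card (C \<union> C')"
      using S[OF C(1)] S[OF C(2)] ab' by (intro joint_mean_prob_le finite_E) auto
    also have "\<dots> \<le> ?B * (1 / real n) ^ card (C \<union> C')"
      using ab n card_Un[OF C] by (intro power_bound) auto
    finally show "\<P>(w in exp_weights (E n). mean_weight w C \<le> ?b \<and> mean_weight w C' \<le> ?b)
      \<le> ?B * (1 / real n) ^ card (C \<union> C')" .
  qed
  have q: "mean_prob (E n) C ?b \<le> (real K * ?b) ^ card C" if "C \<in> ?S" for C
    using S[OF that] ab' by (intro mean_prob_le_power finite_E) auto
  have qq: "mean_prob (E n) C ?b * mean_prob (E n) C' ?b \<le> (real K * ?b) ^ (card C + card C')"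
    if "C \<in> ?S" "C' \<in> ?S" for C C'
    unfolding power_add using ab' by (intro mult_mono q that) (auto simp: mean_prob_def intro!: zero_le_power mult_nonneg_nonneg simp del: times_divide_eq_right)
  \<comment> \<open>The upper estimate contains the diagonal, which is split off because
    \<open>overlap\<close> ranges over distinct cycles.\<close>
  have "(\<Sum>C\<in>?S. \<Sum>C'\<in>{C'\<in>?S. C \<inter> C' \<noteq> {}}. mean_prob (E n) C ?b * mean_prob (E n) C' ?b)
      = (\<Sum>C\<in>?S. \<Sum>C'\<in>{C'\<in>?S. C' \<noteq> C \<and> C \<inter> C' \<noteq> {}}. mean_prob (E n) C ?b * mean_prob (E n) C' ?b)
      + (\<Sum>C\<in>?S. mean_prob (E n) C ?b * mean_prob (E n) C ?b)"
    unfolding sum.distrib[symmetric]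
  proof (intro sum.cong refl)
    fix C assume C: "C \<in> ?S"
    then have "{C'\<in>?S. C \<inter> C' \<noteq> {}} = insert C {C'\<in>?S. C' \<noteq> C \<and> C \<inter> C' \<noteq> {}}"
      using S[OF C] by auto
    then show "(\<Sum>C'\<in>{C'\<in>?S. C \<inter> C' \<noteq> {}}. mean_prob (E n) C ?b * mean_prob (E n) C' ?b)
      = (\<Sum>C'\<in>{C'\<in>?S. C' \<noteq> C \<and> C \<inter> C' \<noteq> {}}. mean_prob (E n) C ?b * mean_prob (E n) C' ?b)
      + mean_prob (E n) C ?b * mean_prob (E n) C ?b"
      using fin by simp
  qed
  also have "\<dots> \<le> ?B * O' + ?B * R"
  proof (rule add_mono)
    show "(\<Sum>C\<in>?S. \<Sum>C'\<in>{C'\<in>?S. C' \<noteq> C \<and> C \<inter> C' \<noteq> {}}. mean_prob (E n) C ?b * mean_prob (E n) C' ?b) \<le> ?B * O'"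
      unfolding O'_def
    proof (rule short_pair_sum_le)
      fix C C' assume C: "C \<in> ?S" "C' \<in> ?S"
      have "mean_prob (E n) C ?b * mean_prob (E n) C' ?b \<le> (real K * ?b) ^ (card C + card C')" by (rule qq[OF C])
      also have "\<dots> \<le> ?B * (1 / real n) ^ card (C \<union> C')"
        using ab n S[OF C(1)] S[OF C(2)] by (intro power_bound) (auto simp: card_Un_le)
      finally show "mean_prob (E n) C ?b * mean_prob (E n) C' ?b \<le> ?B * (1 / real n) ^ card (C \<union> C')" .
    qed
    have "(\<Sum>C\<in>?S. mean_prob (E n) C ?b * mean_prob (E n) C ?b) \<le> (\<Sum>C\<in>?S. ?B * (1 / real n) ^ (2 * card C))"
    proof (rule sum_mono)
      fix C assume C: "C \<in> ?S"
      have "mean_prob (E n) C ?b * mean_prob (E n) C ?b \<le> (real K * ?b) ^ (card C + card C)" by (rule qq[OF C C])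
      also have "\<dots> \<le> ?B * (1 / real n) ^ (2 * card C)"
        using ab n S[OF C] by (intro power_bound) auto
      finally show "mean_prob (E n) C ?b * mean_prob (E n) C ?b \<le> ?B * (1 / real n) ^ (2 * card C)" .
    qed
    also have "\<dots> = ?B * (\<Sum>C\<in>?S. (1 / real n) ^ (2 * card C))" by (simp add: sum_distrib_left)
    also have "(\<Sum>C\<in>?S. (1 / real n) ^ (2 * card C)) = (\<Sum>j=j0..K. \<Sum>C\<in>{C\<in>?S. card C = j}. (1 / real n) ^ (2 * card C))"
      by (rule sum_by_length[where n = n]) (auto simp: short_def card_ge)
    also have "\<dots> \<le> R"
      unfolding R_def
    proof (rule sum_mono)
      fix j assume j: "j \<in> {j0..K}"
      have eq: "{C\<in>?S. card C = j} = {C \<in> Cy n. card C = j}" using j by (auto simp: short_def)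
      have "(\<Sum>C\<in>{C\<in>?S. card C = j}. (1 / real n) ^ (2 * card C)) = real (card {C \<in> Cy n. card C = j}) * (1 / real n) ^ (2 * j)"
        unfolding eq by simp
      also have "\<dots> \<le> (\<kappa> / real j * real n ^ j) * (1 / real n) ^ (2 * j)"
        using j by (intro mult_right_mono count_le) auto
      also have "\<dots> = \<kappa> / real j * (1 / real n) ^ j"
        using n by (simp add: power_divide mult_2 power_add)
      finally show "(\<Sum>C\<in>{C\<in>?S. card C = j}. (1 / real n) ^ (2 * card C)) \<le> \<kappa> / real j * (1 / real n) ^ j" .
    qed
    finally show "(\<Sum>C\<in>?S. mean_prob (E n) C ?b * mean_prob (E n) C ?b) \<le> ?B * R" using B by simp
  qed
  finally have up: "(\<Sum>C\<in>?S. \<Sum>C'\<in>{C'\<in>?S. C \<inter> C' \<noteq> {}}. mean_prob (E n) C ?b * mean_prob (E n) C' ?b) \<le> ?B * (O' + R)"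
    by (simp add: distrib_left)
  have low: "?B * O' \<le> ?B * (O' + R)" using B R0 by (intro mult_left_mono) auto
  have d: "(\<Sum>C\<in>J'. mean_prob (E n) C ?b - mean_prob (E n) C ?a) = expected n J' b - expected n J' a" for J'
    by (simp add: expected_def sum_subtractf)
  have err: "pair_error K n = O' + R" by (simp add: pair_error_def O'_def R_def)
  show ?thesis
    using argmin_prob_window_upper[OF finite_E short_Pow J ab'(1)]
      argmin_prob_window_lower[OF finite_E short_Pow J ab'(1)] up low joint
      zero_le_power2[of "expected n (short K n) b - expected n (short K n) a"]
    unfolding d err by linarith
qed

lemma short_subset_Cy: "short K n \<subseteq> Cy n"
  by (auto simp: short_def)

text \<open>Erlang laws put no mass at or below 0; this is the initial value of both
  recursions.\<close>

lemma argmin_prob_0: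
  assumes "J \<subseteq> short K n"
  shows "argmin_prob (E n) (short K n) J 0 = 0"
proof -
  interpret prob_space "exp_weights (E n)" by (rule prob_space_exp_weights)
  have fJ: "finite J" using assms by (rule finite_subset) (simp add: short_def finite_Cy)
  have m: "{w \<in> space (exp_weights (E n)). mean_weight w C \<le> 0} \<in> events" if "C \<in> J" for C
    using pred_mean_le[OF finite_E short_Pow, of C K n 0] that assms unfolding pred_def by blast
  have "argmin_prob (E n) (short K n) J 0 \<le> prob (\<Union>C\<in>J. {w \<in> space (exp_weights (E n)). mean_weight w C \<le> 0})"
    unfolding argmin_prob_def by (intro finite_measure_mono sets.finite_UN fJ m) auto
  also have "\<dots> \<le> (\<Sum>C\<in>J. mean_prob (E n) C 0)"
    unfolding mean_prob_def using m fJ by (intro finite_measure_subadditive_finite) auto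
  also have "\<dots> = 0"
  proof (intro sum.neutral ballI)
    fix C assume "C \<in> J"
    then have "C \<subseteq> E n" "C \<noteq> {}" using assms short_Pow[of K n] by auto
    then show "mean_prob (E n) C 0 = 0" using mean_prob_eq_erlang[OF finite_E, of C n 0] by (simp add: erlang_CDF_at0)
  qed
  finally show ?thesis by (simp add: argmin_prob_def antisym)
qed

lemma argmin_prob_le_1: "argmin_prob F S J a \<le> 1"
  using prob_space.prob_le_1[OF prob_space_exp_weights] by (simp add: argmin_prob_def)

lemma argmin_prob_nonneg: "0 \<le> argmin_prob F S J a"
  by (simp add: argmin_prob_def)

lemma scaled_pair_error_lim: "(\<lambda>n. B * pair_error K n) \<longlonglongrightarrow> 0"
  using tendsto_mult_right_zero[OF pair_error_lim] by simp

lemma argmin_prob_short_lim: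
  assumes c: "0 \<le> c"
  shows "(\<lambda>n. argmin_prob (E n) (short K n) (short K n) (c / real n)) \<longlonglongrightarrow> 1 - exp (- Lam K c)"
proof (rule window_limit_exp[where m = "Lam' K c" and L = "\<lambda>n. expected n (short K n)" and l = "Lam K" and c = c
      and Y = "\<lambda>n t. argmin_prob (E n) (short K n) (short K n) (t / real n)"
      and \<epsilon> = "\<lambda>n. max 1 (real K * c) ^ (2 * K) * pair_error K n"])
  show "\<forall>\<^sub>F n in sequentially. \<forall>a b. 0 \<le> a \<longrightarrow> a \<le> b \<longrightarrow> b \<le> c \<longrightarrow>
     \<bar>argmin_prob (E n) (short K n) (short K n) (b / real n) - argmin_prob (E n) (short K n) (short K n) (a / real n)
       - (expected n (short K n) b - expected n (short K n) a) * (1 - argmin_prob (E n) (short K n) (short K n) (a / real n))\<bar>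
     \<le> (expected n (short K n) b - expected n (short K n) a)\<^sup>2 + max 1 (real K * c) ^ (2 * K) * pair_error K n"
    using eventually_gt_at_top[of 0] by eventually_elim (use window_bound in blast)
  show "argmin_prob (E n) (short K n) (short K n) (0 / real n) = 0" for n
    using argmin_prob_0[of "short K n" K n] by simp
  show "Lam K 0 = 0" by (simp add: Lam_def lam_def)
qed (use c in \<open>auto intro: argmin_prob_nonneg argmin_prob_le_1 expected_short_lim Lam_lipschitz scaled_pair_error_lim
    pair_error_lim intro!: expected_mono short_subset_Cy\<close>)

lemma argmin_prob_cyc_lim:
  assumes c: "0 \<le> c" and k: "j0 \<le> k" "k \<le> K"
  shows "(\<lambda>n. argmin_prob (E n) (short K n) (cyc k n) (c / real n)) \<longlonglongrightarrow>
    integral {0..c} (\<lambda>s. lam' k s * exp (- Lam K s))"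
proof (rule window_limit_integral[where c = c and X = "\<lambda>n t. argmin_prob (E n) (short K n) (cyc k n) (t / real n)"
      and Y = "\<lambda>n t. argmin_prob (E n) (short K n) (short K n) (t / real n)"
      and \<epsilon> = "\<lambda>n. max 1 (real K * c) ^ (2 * K) * pair_error K n" and m = "Lam' K c" and m' = "lam' k c * Lam' K c" and
      L = "\<lambda>n. expected n (short K n)" and H = "\<lambda>n. expected n (cyc k n)" and l = "Lam K" and h = "lam k"
      and \<eta> = "\<lambda>t. integral {0..t} (\<lambda>s. lam' k s * exp (- Lam K s))"])
  show "\<forall>\<^sub>F n in sequentially. \<forall>a b. 0 \<le> a \<longrightarrow> a \<le> b \<longrightarrow> b \<le> c \<longrightarrow>
     \<bar>argmin_prob (E n) (short K n) (cyc k n) (b / real n) - argmin_prob (E n) (short K n) (cyc k n) (a / real n)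
       - (expected n (cyc k n) b - expected n (cyc k n) a) * (1 - argmin_prob (E n) (short K n) (short K n) (a / real n))\<bar>
     \<le> (expected n (short K n) b - expected n (short K n) a)\<^sup>2 + max 1 (real K * c) ^ (2 * K) * pair_error K n"
    using eventually_gt_at_top[of 0]
    by eventually_elim (use window_bound cyc_subset_short[OF k(2)] in blast)
  show "argmin_prob (E n) (short K n) (cyc k n) (0 / real n) = 0" for n
    using argmin_prob_0[OF cyc_subset_short[OF k(2)]] by simp
  show "\<bar>Lam K b - Lam K a\<bar> \<le> Lam' K c * (b - a)" if "0 \<le> a" "a \<le> b" "b \<le> c" for a b
    using Lam_mono[OF that(1,2)] Lam_lipschitz[OF that] by simp
  show "\<bar>integral {0..b} (\<lambda>s. lam' k s * exp (- Lam K s)) - integral {0..a} (\<lambda>s. lam' k s * exp (- Lam K s))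
      - (lam k b - lam k a) * exp (- Lam K a)\<bar> \<le> lam' k c * Lam' K c * (b - a)\<^sup>2"
    if "0 \<le> a" "a \<le> b" "b \<le> c" for a b
    using that k j0 c
    by (intro integral_weight_increment[where c = c] has_real_derivative_lam continuous_on_lam' continuous_on_Lam
        Lam_nonneg conjI Lam_mono Lam_lipschitz Lam'_nonneg)
      (auto simp: lam'_nonneg intro!: lam'_mono)
  show "0 \<le> lam' k c * Lam' K c" using c by (intro mult_nonneg_nonneg lam'_nonneg Lam'_nonneg)
qed (use c k in \<open>auto intro: argmin_prob_short_lim expected_short_lim expected_cyc_lim scaled_pair_error_lim pair_error_lim\<close>)

end

section \<open>Removing the length restriction\<close>

context cycle_model
begin

definition LamInf :: "real \<Rightarrow> real" where "LamInf t = (\<Sum>j. lam (j + j0) t)"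

text \<open>Taken at the critical point, where it dominates the remainder of the series at every
  earlier time.\<close>

definition tail :: "nat \<Rightarrow> real" where "tail K = (\<Sum>j. lam (j + Suc K) (1 / exp 1))"

definition limit_prob :: "nat \<Rightarrow> real" where
  "limit_prob k = integral {0..1 / exp 1} (\<lambda>s. lam' k s * exp (- LamInf s))"

lemma lam_nonneg: "0 \<le> t \<Longrightarrow> 0 \<le> lam j t"
  using \<kappa>_pos by (simp add: lam_def tree_term_nonneg)

lemma lam_mono: "0 \<le> s \<Longrightarrow> s \<le> t \<Longrightarrow> lam j s \<le> lam j t"
  using \<kappa>_pos by (simp add: lam_def tree_term_mono)

lemma summable_lam: "t \<in> {0..1 / exp 1} \<Longrightarrow> summable (\<lambda>j. lam (j + m) t)"
  by (rule summable_comparison_test'[where g = "\<lambda>j. lam (j + m) (1 / exp 1)" and N = 0])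
    (use summable_tree_term_inv_e in \<open>auto simp: lam_def lam_nonneg[unfolded lam_def] lam_mono[unfolded lam_def]
      abs_of_nonneg intro!: summable_mult summable_ignore_initial_segment\<close>)

lemma tail_lim: "tail \<longlonglongrightarrow> 0"
proof -
  have s: "summable (\<lambda>j. lam j (1 / exp 1))" using summable_lam[of "1 / exp 1" 0] by simp
  have eq: "tail = (\<lambda>K. suminf (\<lambda>j. lam j (1 / exp 1)) - (\<Sum>j<Suc K. lam j (1 / exp 1)))"
  proof
    fix K
    show "tail K = suminf (\<lambda>j. lam j (1 / exp 1)) - (\<Sum>j<Suc K. lam j (1 / exp 1))"
      unfolding tail_def using suminf_split_initial_segment[OF s, of "Suc K"] by linarith
  qed
  have "(\<lambda>K. suminf (\<lambda>j. lam j (1 / exp 1)) - (\<Sum>j<Suc K. lam j (1 / exp 1)))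
      \<longlonglongrightarrow> suminf (\<lambda>j. lam j (1 / exp 1)) - suminf (\<lambda>j. lam j (1 / exp 1))"
    by (intro tendsto_intros LIMSEQ_Suc[OF summable_LIMSEQ[OF s]])
  then show ?thesis unfolding eq by simp
qed

lemma LamInf_bounds:
  assumes t: "t \<in> {0..1 / exp 1}" and K: "j0 \<le> K"
  shows "Lam K t \<le> LamInf t" "LamInf t \<le> Lam K t + tail K"
proof -
  have "LamInf t = (\<Sum>j. lam (j + (Suc K - j0) + j0) t) + (\<Sum>j<Suc K - j0. lam (j + j0) t)"
    unfolding LamInf_def by (rule suminf_split_initial_segment[OF summable_lam[OF t]])
  also have "(\<Sum>j<Suc K - j0. lam (j + j0) t) = Lam K t"
    unfolding Lam_def using K
    by (intro sum.reindex_bij_witness[where i = "\<lambda>j. j - j0" and j = "\<lambda>j. j + j0"]) auto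
  also have "(\<lambda>j. lam (j + (Suc K - j0) + j0) t) = (\<lambda>j. lam (j + Suc K) t)"
    using K by (simp add: add.assoc)
  finally have eq: "LamInf t = (\<Sum>j. lam (j + Suc K) t) + Lam K t" .
  show "Lam K t \<le> LamInf t"
    unfolding eq le_add_same_cancel2
    by (intro suminf_nonneg summable_lam lam_nonneg t) (use t in simp)
  show "LamInf t \<le> Lam K t + tail K"
    unfolding eq tail_def add.commute[of "Lam K t"] add_le_cancel_right
    by (intro suminf_le allI summable_lam lam_mono t) (use t in auto)
qed

lemma continuous_on_LamInf: "continuous_on {0..1 / exp 1} LamInf"
proof (rule uniform_limit_theorem)
  show "uniform_limit {0..1 / exp 1} (\<lambda>n t. \<Sum>j<n. lam (j + j0) t) LamInf sequentially"
    unfolding LamInf_def[abs_def]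
    by (rule Weierstrass_m_test[where M = "\<lambda>j. lam (j + j0) (1 / exp 1)"])
      (auto simp: lam_nonneg abs_of_nonneg intro!: lam_mono summable_lam)
  show "\<forall>\<^sub>F n in sequentially. continuous_on {0..1 / exp 1} (\<lambda>t. \<Sum>j<n. lam (j + j0) t)"
    unfolding lam_def by (intro always_eventually allI continuous_intros continuous_on_tree_term)
qed simp

lemma integrable_limit_density: "(\<lambda>s. lam' k s * exp (- LamInf s)) integrable_on {0..1 / exp 1}"
  by (intro integrable_continuous_real continuous_intros continuous_on_lam' continuous_on_LamInf)

lemma integrable_Lam_density: "(\<lambda>s. lam' k s * exp (- Lam K s)) integrable_on {a..b}"
  by (intro integrable_continuous_real continuous_intros continuous_on_lam' continuous_on_Lam)

text \<open>The multiplicative error \<open>exp (tail K)\<close> takes the place of dominated convergence.\<close>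

lemma limit_prob_bounds:
  assumes K: "j0 \<le> K"
  shows "limit_prob k \<le> integral {0..1 / exp 1} (\<lambda>s. lam' k s * exp (- Lam K s))"
    and "integral {0..1 / exp 1} (\<lambda>s. lam' k s * exp (- Lam K s)) \<le> exp (tail K) * limit_prob k"
proof -
  show "limit_prob k \<le> integral {0..1 / exp 1} (\<lambda>s. lam' k s * exp (- Lam K s))"
    unfolding limit_prob_def
    by (intro integral_le integrable_limit_density integrable_Lam_density mult_left_mono lam'_nonneg)
      (use LamInf_bounds[OF _ K] in auto)
  have "integral {0..1 / exp 1} (\<lambda>s. lam' k s * exp (- Lam K s))
      \<le> integral {0..1 / exp 1} (\<lambda>s. exp (tail K) * (lam' k s * exp (- LamInf s)))"
  proof (intro integral_le integrable_Lam_density)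
    show "(\<lambda>s. exp (tail K) * (lam' k s * exp (- LamInf s))) integrable_on {0..1 / exp 1}"
      by (intro integrable_continuous_real continuous_intros continuous_on_lam' continuous_on_LamInf)
    fix s :: real assume s: "s \<in> {0..1 / exp 1}"
    have "exp (- Lam K s) \<le> exp (tail K - LamInf s)"
      using LamInf_bounds(2)[OF s K] by simp
    then have "lam' k s * exp (- Lam K s) \<le> lam' k s * exp (tail K - LamInf s)"
      using s by (intro mult_left_mono lam'_nonneg) auto
    then show "lam' k s * exp (- Lam K s) \<le> exp (tail K) * (lam' k s * exp (- LamInf s))"
      by (simp add: exp_diff exp_minus field_simps)
  qed
  then show "integral {0..1 / exp 1} (\<lambda>s. lam' k s * exp (- Lam K s)) \<le> exp (tail K) * limit_prob k"
    by (simp add: limit_prob_def)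
qed

text \<open>Only lengths up to \<open>card (E n)\<close> occur, and each is controlled by
  \<open>expected_cyc_le\<close>; the resulting bound is uniform in \<open>n\<close>.\<close>

lemma long_expected_le:
  assumes n: "0 < n" and K: "j0 \<le> K"
  shows "(\<Sum>C\<in>{C \<in> Cy n. K < card C}. mean_prob (E n) C (1 / exp 1 / real n)) \<le> tail K"
proof -
  let ?t = "1 / exp 1 :: real" and ?N = "card (E n)"
  have "(\<Sum>C\<in>{C \<in> Cy n. K < card C}. mean_prob (E n) C (?t / real n))
     = (\<Sum>j\<in>{Suc K..?N}. \<Sum>C\<in>{C \<in> {C \<in> Cy n. K < card C}. card C = j}. mean_prob (E n) C (?t / real n))"
  proof (rule sum_by_length)
    show "card C \<in> {Suc K..?N}" if "C \<in> {C \<in> Cy n. K < card C}" for C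
      using that Cy_subset[of n] card_mono[OF finite_E[of n], of C] by auto
  qed auto
  also have "\<dots> = (\<Sum>j\<in>{Suc K..?N}. expected n (cyc j n) ?t)"
  proof (intro sum.cong refl)
    fix j assume "j \<in> {Suc K..?N}"
    then have "{C \<in> {C \<in> Cy n. K < card C}. card C = j} = cyc j n" by (auto simp: cyc_def)
    then show "(\<Sum>C\<in>{C \<in> {C \<in> Cy n. K < card C}. card C = j}. mean_prob (E n) C (?t / real n)) = expected n (cyc j n) ?t"
      by (simp add: expected_def)
  qed
  also have "\<dots> \<le> (\<Sum>j\<in>{Suc K..?N}. lam j ?t)"
    using n K by (intro sum_mono expected_cyc_le) auto
  also have "\<dots> = (\<Sum>j\<in>{..<Suc ?N - Suc K}. lam (j + Suc K) ?t)"
    by (intro sum.reindex_bij_witness[where i = "\<lambda>j. j + Suc K" and j = "\<lambda>j. j - Suc K"]) auto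
  also have "\<dots> \<le> tail K"
    unfolding tail_def by (intro sum_le_suminf summable_lam lam_nonneg) auto
  finally show ?thesis .
qed

lemma min_mean_length_prob_eq:
  "min_mean_length_prob (E n) (Cy n) k =
     \<P>(w in exp_weights (E n). \<exists>C\<in>cyc k n. \<forall>C'\<in>Cy n. mean_weight w C \<le> mean_weight w C')"
  unfolding min_mean_length_prob_def is_arg_min_linorder cyc_def
  by (intro arg_cong[where f = "measure _"]) auto

text \<open>A short minimiser below the threshold is a global one unless a long cycle lies below the
  threshold too, which is excluded up to \<open>tail K\<close>.\<close>

lemma min_mean_length_prob_lower:
  assumes n: "0 < n" and K: "j0 \<le> K" "k \<le> K"
  shows "argmin_prob (E n) (short K n) (cyc k n) (1 / exp 1 / real n) - tail K \<le> min_mean_length_prob (E n) (Cy n) k"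
proof -
  let ?t = "1 / exp 1 / real n :: real"
  interpret prob_space "exp_weights (E n)" by (rule prob_space_exp_weights)
  note rules = pred_intros_logic pred_intros_finite finite_Cy
    pred_mean_le[OF finite_E Cy_Pow] pred_mean_le2[OF finite_E Cy_Pow]
  let ?G = "{w \<in> space (exp_weights (E n)). \<exists>C\<in>cyc k n. \<forall>C'\<in>Cy n. mean_weight w C \<le> mean_weight w C'}"
  let ?B = "\<lambda>C. {w \<in> space (exp_weights (E n)). mean_weight w C \<le> ?t}"
  let ?L = "{C \<in> Cy n. K < card C}"
  have mG: "?G \<in> events"
    unfolding pred_def[symmetric] by (intro rules) (auto simp: cyc_def finite_Cy)
  have mB: "?B C \<in> events" if "C \<in> ?L" for C
    unfolding pred_def[symmetric] using that by (intro rules) auto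
  have mU: "(\<Union>C\<in>?L. ?B C) \<in> events"
    by (intro sets.finite_UN mB) (auto simp: finite_Cy)
  have "argmin_prob (E n) (short K n) (cyc k n) ?t \<le> prob (?G \<union> (\<Union>C\<in>?L. ?B C))"
    unfolding argmin_prob_def
  proof (intro finite_measure_mono sets.Un mG mU subsetI)
    fix w assume "w \<in> {w \<in> space (exp_weights (E n)). \<exists>C\<in>cyc k n. (\<forall>C'\<in>short K n. mean_weight w C \<le> mean_weight w C') \<and> mean_weight w C \<le> ?t}"
    then obtain C where w: "w \<in> space (exp_weights (E n))" and C: "C \<in> cyc k n"
      "\<forall>C'\<in>short K n. mean_weight w C \<le> mean_weight w C'" "mean_weight w C \<le> ?t" by blast
    show "w \<in> ?G \<union> (\<Union>C\<in>?L. ?B C)"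
    proof (cases "\<exists>C'\<in>?L. mean_weight w C' \<le> ?t")
      case False
      have "mean_weight w C \<le> mean_weight w C'" if "C' \<in> Cy n" for C'
        using that C False by (cases "card C' \<le> K") (auto simp: short_def not_le intro: less_imp_le order.strict_trans1)
      then show ?thesis using w C by blast
    qed (use w in blast)
  qed
  also have "\<dots> \<le> prob ?G + prob (\<Union>C\<in>?L. ?B C)"
    by (intro measure_Un_le mG mU)
  also have "prob (\<Union>C\<in>?L. ?B C) \<le> (\<Sum>C\<in>?L. prob (?B C))"
    by (intro finite_measure_subadditive_finite) (use mB in \<open>auto simp: finite_Cy\<close>)
  also have "\<dots> \<le> tail K"
    using long_expected_le[OF n K(1)] by (simp add: mean_prob_def)
  finally show ?thesis unfolding min_mean_length_prob_eq by simp
qed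

text \<open>A global minimiser of length \<open>k\<close> is minimal among the short cycles; if it
  lies above \<open>a\<close>, so do all of them. The free threshold \<open>a\<close> is later
  chosen beyond the critical point, where this second event is rare.\<close>

lemma min_mean_length_prob_upper:
  assumes K: "k \<le> K"
  shows "min_mean_length_prob (E n) (Cy n) k \<le>
    argmin_prob (E n) (short K n) (cyc k n) a + (1 - argmin_prob (E n) (short K n) (short K n) a)"
proof -
  interpret prob_space "exp_weights (E n)" by (rule prob_space_exp_weights)
  note rules = pred_intros_logic pred_intros_finite finite_cycle_family[OF finite_E short_Pow]
    pred_mean_le[OF finite_E short_Pow] pred_mean_le2[OF finite_E short_Pow] pred_mean_gr[OF finite_E short_Pow]
  let ?X = "{w \<in> space (exp_weights (E n)). \<exists>C\<in>cyc k n. (\<forall>C'\<in>short K n. mean_weight w C \<le> mean_weight w C') \<and> mean_weight w C \<le> a}"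
  let ?N = "{w \<in> space (exp_weights (E n)). \<forall>C\<in>short K n. a < mean_weight w C}"
  have fc: "finite (cyc k n)" by (simp add: cyc_def finite_Cy)
  have mX: "?X \<in> events"
    unfolding pred_def[symmetric] using cyc_subset_short[OF K] by (intro rules fc) auto
  have mN: "?N \<in> events"
    unfolding pred_def[symmetric] by (intro rules) auto
  have "min_mean_length_prob (E n) (Cy n) k \<le> prob (?X \<union> ?N)"
    unfolding min_mean_length_prob_eq
  proof (intro finite_measure_mono sets.Un mX mN subsetI)
    fix w assume "w \<in> {w \<in> space (exp_weights (E n)). \<exists>C\<in>cyc k n. \<forall>C'\<in>Cy n. mean_weight w C \<le> mean_weight w C'}"
    then obtain C where w: "w \<in> space (exp_weights (E n))" and C: "C \<in> cyc k n"
      "\<forall>C'\<in>Cy n. mean_weight w C \<le> mean_weight w C'" by blast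
    have C': "\<forall>C'\<in>short K n. mean_weight w C \<le> mean_weight w C'"
      using C(2) by (auto simp: short_def)
    show "w \<in> ?X \<union> ?N"
    proof (cases "mean_weight w C \<le> a")
      case True
      then show ?thesis using w C(1) C' by blast
    next
      case False
      then have "a < mean_weight w D" if "D \<in> short K n" for D
        using C' that by force
      then show ?thesis using w by blast
    qed
  qed
  also have "\<dots> \<le> prob ?X + prob ?N" by (intro measure_Un_le mX mN)
  finally show ?thesis
    unfolding one_minus_argmin_prob[OF finite_E short_Pow] by (simp add: argmin_prob_def)
qed

text \<open>The two bounds use different thresholds: exactly \<open>1 / e\<close> from below, where
  long cycles are still controlled, and slightly more from above, where a short cycle is likely. The
  bounded density makes the gap between them negligible.\<close>

lemma min_mean_length_prob_lim:
  assumes k: "j0 \<le> k"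
  shows "(\<lambda>n. min_mean_length_prob (E n) (Cy n) k) \<longlonglongrightarrow> limit_prob k"
  unfolding tendsto_iff dist_real_def
proof (intro allI impI)
  fix \<epsilon> :: real assume \<epsilon>: "\<epsilon> > 0"
  define e :: real where "e = 1 / exp 1"
  \<comment> \<open>The threshold chosen below is at most 1, so \<open>P\<close> bounds the density
    between \<open>1 / e\<close> and that threshold. The later divisor \<open>P + 1\<close> is
    positive even if \<open>P\<close> is not.\<close>
  define P where "P = lam' k 1"
  have e: "0 < e" "e < 1" unfolding e_def by (simp_all add: divide_less_eq)
  have P: "0 \<le> P" unfolding P_def by (simp add: lam'_nonneg)
  \<comment> \<open>For a threshold \<open>c > 1/e\<close> there is a short cycle below \<open>c/n\<close> with high probability.\<close>
  define c where "c = e + min (1 - e) (\<epsilon> / (8 * (P + 1)))"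
  have c: "e < c" "c \<le> 1" "c - e \<le> \<epsilon> / (8 * (P + 1))"
    unfolding c_def using e P \<epsilon> by auto
  have Pc: "P * (c - e) \<le> \<epsilon> / 8"
  proof -
    have "P * (c - e) \<le> (P + 1) * (\<epsilon> / (8 * (P + 1)))" using c P by (intro mult_mono) auto
    also have "\<dots> = \<epsilon> / 8" using P by (simp add: field_simps)
    finally show ?thesis .
  qed
  have "filterlim (\<lambda>K. Lam K c) at_top sequentially"
  proof (rule filterlim_at_top_mono)
    show "filterlim (\<lambda>K. lam K c) at_top sequentially"
      unfolding lam_def using c(1) e_def \<kappa>_pos
      by (intro filterlim_tendsto_pos_mult_at_top[OF tendsto_const] tree_term_at_top) auto
    show "\<forall>\<^sub>F K in sequentially. lam K c \<le> Lam K c"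
      using eventually_ge_at_top[of j0]
    proof eventually_elim
      case (elim K)
      then show ?case unfolding Lam_def using c e by (intro member_le_sum) (auto intro: lam_nonneg)
    qed
  qed
  then have "(\<lambda>K. exp (- Lam K c)) \<longlonglongrightarrow> 0"
    by (intro filterlim_compose[OF exp_at_bot] filterlim_compose[OF filterlim_uminus_at_bot_at_top])
  then have "\<forall>\<^sub>F K in sequentially. exp (- Lam K c) < \<epsilon> / 4"
    by (rule order_tendstoD(2)) (use \<epsilon> in simp)
  moreover have "\<forall>\<^sub>F K in sequentially. tail K < \<epsilon> / 4"
    by (rule order_tendstoD(2)[OF tail_lim]) (use \<epsilon> in simp)
  moreover have "\<forall>\<^sub>F K in sequentially. exp (tail K) * limit_prob k < limit_prob k + \<epsilon> / 4"
  proof (rule order_tendstoD(2))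
    show "(\<lambda>K. exp (tail K) * limit_prob k) \<longlonglongrightarrow> exp 0 * limit_prob k"
      by (intro tendsto_intros tail_lim)
  qed (use \<epsilon> in simp)
  moreover have "\<forall>\<^sub>F K in sequentially. k \<le> K" by (rule eventually_ge_at_top)
  \<comment> \<open>\<open>K\<close> is fixed after the threshold \<open>c\<close> and before
    \<open>n\<close> tends to infinity.\<close>
  ultimately have "\<forall>\<^sub>F K in sequentially. exp (- Lam K c) < \<epsilon> / 4 \<and> tail K < \<epsilon> / 4 \<and>
      exp (tail K) * limit_prob k < limit_prob k + \<epsilon> / 4 \<and> k \<le> K"
    by eventually_elim blast
  then obtain K where K: "exp (- Lam K c) < \<epsilon> / 4" "tail K < \<epsilon> / 4"
      "exp (tail K) * limit_prob k < limit_prob k + \<epsilon> / 4" "k \<le> K"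
    by (auto simp: eventually_sequentially)
  have jK: "j0 \<le> K" using k K(4) by simp
  let ?f = "\<lambda>s. lam' k s * exp (- Lam K s)"
  have "integral {e..c} ?f \<le> integral {e..c} (\<lambda>_. P)"
  proof (intro integral_le integrable_Lam_density integrable_const_ivl)
    fix s assume s: "s \<in> {e..c}"
    have "lam' k s * exp (- Lam K s) \<le> P * 1"
      unfolding P_def using s e c
      by (intro mult_mono lam'_mono lam'_nonneg) (auto intro: Lam_nonneg)
    then show "lam' k s * exp (- Lam K s) \<le> P" by simp
  qed
  also have "\<dots> = P * (c - e)" using c by simp
  finally have Ic: "integral {0..c} ?f \<le> integral {0..e} ?f + \<epsilon> / 8"
    using Henstock_Kurzweil_Integration.integral_combine[of 0 e c ?f] e c Pc integrable_Lam_density by simp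
  have up: "(\<lambda>n. argmin_prob (E n) (short K n) (cyc k n) (c / real n) + (1 - argmin_prob (E n) (short K n) (short K n) (c / real n)))
    \<longlonglongrightarrow> integral {0..c} ?f + (1 - (1 - exp (- Lam K c)))"
    using c e by (intro tendsto_intros argmin_prob_cyc_lim argmin_prob_short_lim k K(4)) auto
  have "\<forall>\<^sub>F n in sequentially. argmin_prob (E n) (short K n) (cyc k n) (c / real n)
      + (1 - argmin_prob (E n) (short K n) (short K n) (c / real n)) < limit_prob k + \<epsilon>"
    by (rule order_tendstoD(2)[OF up])
      (use Ic K limit_prob_bounds(2)[OF jK, of k] \<epsilon> in \<open>unfold e_def[symmetric], linarith\<close>)
  moreover have low: "(\<lambda>n. argmin_prob (E n) (short K n) (cyc k n) (e / real n) - tail K)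
    \<longlonglongrightarrow> integral {0..e} ?f - tail K"
    using e by (intro tendsto_intros argmin_prob_cyc_lim k K(4)) auto
  have "\<forall>\<^sub>F n in sequentially. limit_prob k - \<epsilon> < argmin_prob (E n) (short K n) (cyc k n) (e / real n) - tail K"
    by (rule order_tendstoD(1)[OF low])
      (use K limit_prob_bounds(1)[OF jK, of k] \<epsilon> in \<open>unfold e_def[symmetric], linarith\<close>)
  ultimately show "\<forall>\<^sub>F n in sequentially. \<bar>min_mean_length_prob (E n) (Cy n) k - limit_prob k\<bar> < \<epsilon>"
    using eventually_gt_at_top[of 0]
  proof eventually_elim
    case (elim n)
    then show ?case
      using min_mean_length_prob_upper[OF K(4), of n "c / real n"]
        min_mean_length_prob_lower[OF elim(3) jK K(4), folded e_def] by linarith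
  qed
qed

lemma limit_prob_nonneg: "0 \<le> limit_prob k"
  unfolding limit_prob_def
  by (rule integral_nonneg[OF integrable_limit_density]) (simp add: lam'_nonneg)

text \<open>For each \<open>K\<close> the truncated laws sum exactly to
  \<open>1 - exp (- Lam K (1 / e))\<close>, as \<open>Lam' * exp (- Lam)\<close> has an explicit
  antiderivative. By \<open>limit_prob_bounds\<close> this squeezes the partial sums up to a factor
  \<open>exp (tail K)\<close>.\<close>

lemma limit_prob_has_sum: "(limit_prob has_sum (1 - exp (- LamInf (1 / exp 1)))) {j0..}"
proof -
  let ?e = "1 / exp 1 :: real"
  have total: "(\<Sum>k=j0..K. integral {0..?e} (\<lambda>s. lam' k s * exp (- Lam K s))) = 1 - exp (- Lam K ?e)" for K
  proof -
    have "((\<lambda>s. Lam' K s * exp (- Lam K s)) has_integral (- exp (- Lam K ?e) - (- exp (- Lam K 0)))) {0..?e}"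
    proof (rule fundamental_theorem_of_calculus)
      show "((\<lambda>s. - exp (- Lam K s)) has_vector_derivative Lam' K s * exp (- Lam K s)) (at s within {0..?e})" for s
        unfolding has_real_derivative_iff_has_vector_derivative[symmetric]
        by (auto intro!: derivative_eq_intros has_real_derivative_Lam)
    qed simp
    moreover have "Lam K 0 = 0" by (simp add: Lam_def lam_def)
    ultimately have "integral {0..?e} (\<lambda>s. Lam' K s * exp (- Lam K s)) = 1 - exp (- Lam K ?e)"
      by (simp add: integral_unique)
    moreover have "(\<Sum>k=j0..K. integral {0..?e} (\<lambda>s. lam' k s * exp (- Lam K s)))
        = integral {0..?e} (\<lambda>s. Lam' K s * exp (- Lam K s))"
      unfolding Lam'_def sum_distrib_right
      by (intro integral_sum[symmetric] integrable_Lam_density) auto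
    ultimately show ?thesis by simp
  qed
  have bounds: "Lam K ?e \<le> LamInf ?e" "LamInf ?e - tail K \<le> Lam K ?e" if "j0 \<le> K" for K
    using LamInf_bounds[OF _ that, of ?e] by (auto simp: diff_le_eq)
  have Lam_lim: "(\<lambda>K. Lam K ?e) \<longlonglongrightarrow> LamInf ?e"
  proof (rule real_tendsto_sandwich)
    show "\<forall>\<^sub>F K in sequentially. LamInf ?e - tail K \<le> Lam K ?e"
      using eventually_ge_at_top[of j0] by eventually_elim (rule bounds)
    show "\<forall>\<^sub>F K in sequentially. Lam K ?e \<le> LamInf ?e"
      using eventually_ge_at_top[of j0] by eventually_elim (rule bounds)
    show "(\<lambda>K. LamInf ?e - tail K) \<longlonglongrightarrow> LamInf ?e"
      using tendsto_diff[OF tendsto_const[of "LamInf ?e"] tail_lim] by simp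
  qed simp
  have "(\<lambda>K. \<Sum>k=j0..K. limit_prob k) \<longlonglongrightarrow> 1 - exp (- LamInf ?e)"
  proof (rule tendsto_sandwich)
    show "\<forall>\<^sub>F K in sequentially. (\<Sum>k=j0..K. limit_prob k) \<le> 1 - exp (- Lam K ?e)"
      using eventually_ge_at_top[of j0]
      by eventually_elim (auto simp flip: total intro!: sum_mono limit_prob_bounds)
    show "\<forall>\<^sub>F K in sequentially. exp (- tail K) * (1 - exp (- Lam K ?e)) \<le> (\<Sum>k=j0..K. limit_prob k)"
      using eventually_ge_at_top[of j0]
    proof eventually_elim
      case (elim K)
      have "exp (- tail K) * (1 - exp (- Lam K ?e)) \<le> exp (- tail K) * (\<Sum>k=j0..K. exp (tail K) * limit_prob k)"
        unfolding total[symmetric] by (intro mult_left_mono sum_mono limit_prob_bounds elim) auto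
      also have "\<dots> = (\<Sum>k=j0..K. limit_prob k)"
        unfolding sum_distrib_left
        by (intro sum.cong refl) (simp add: mult.assoc[symmetric] flip: exp_add)
      finally show ?case .
    qed
    show "(\<lambda>K. exp (- tail K) * (1 - exp (- Lam K ?e))) \<longlonglongrightarrow> 1 - exp (- LamInf ?e)"
      using tendsto_mult[OF tendsto_exp[OF tendsto_minus[OF tail_lim]]
          tendsto_diff[OF tendsto_const[of 1] tendsto_exp[OF tendsto_minus[OF Lam_lim]]]] by simp
  qed (intro tendsto_intros Lam_lim)
  then have "(\<lambda>k. if j0 \<le> k then limit_prob k else 0) sums (1 - exp (- LamInf ?e))"
  proof (subst sums_def_le, elim Lim_transform_eventually)
    show "\<forall>\<^sub>F K in sequentially. (\<Sum>k=j0..K. limit_prob k) = (\<Sum>k\<le>K. if j0 \<le> k then limit_prob k else 0)"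
      by (intro always_eventually allI sum.mono_neutral_cong_left) auto
  qed
  then have "((\<lambda>k. if j0 \<le> k then limit_prob k else 0) has_sum (1 - exp (- LamInf ?e))) UNIV"
    by (rule sums_nonneg_imp_has_sum) (simp add: limit_prob_nonneg)
  also have "?this \<longleftrightarrow> (limit_prob has_sum (1 - exp (- LamInf ?e))) {j0..}"
    by (rule has_sum_cong_neutral) auto
  finally show ?thesis .
qed

end

section \<open>The tree function\<close>

text \<open>The sum is \<open>p!\<close> times the coefficient of \<open>X\<^sup>p\<close> in \<open>(1 - exp X)\<^sup>m\<close>, a series of order \<open>m\<close>.\<close>

lemma alternating_binomial_power_sum:
  assumes "p < m"
  shows "(\<Sum>j\<le>m. (- 1) ^ j * of_nat (m choose j) * of_nat j ^ p) = (0 :: 'a :: field_char_0)"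
proof -
  have "(1 - fps_exp 1) ^ m = (\<Sum>j\<le>m. of_nat (m choose j) * (- fps_exp 1) ^ j * 1 ^ (m - j) :: 'a fps)"
    using binomial_ring[of "- fps_exp 1" "1 :: 'a fps" m] by simp
  also have "\<dots> = (\<Sum>j\<le>m. fps_const ((- 1) ^ j * of_nat (m choose j)) * fps_exp (of_nat j))"
  proof (intro sum.cong refl)
    fix j
    have "(- fps_exp 1) ^ j = (- 1) ^ j * fps_exp (of_nat j :: 'a)"
      by (subst power_minus) (simp add: fps_exp_power_mult)
    then show "of_nat (m choose j) * (- fps_exp 1) ^ j * 1 ^ (m - j) =
        fps_const ((- 1) ^ j * of_nat (m choose j)) * fps_exp (of_nat j :: 'a)"
      by (simp add: mult_ac fps_of_nat flip: fps_const_mult fps_const_power fps_const_neg)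
  qed
  finally have "(1 - fps_exp 1) ^ m $ p = (\<Sum>j\<le>m. (- 1) ^ j * of_nat (m choose j) * (of_nat j ^ p / fact p) :: 'a)"
    by (simp add: fps_sum_nth)
  moreover have "(1 - fps_exp 1 :: 'a fps) ^ m $ p = 0"
    using startsby_zero_power_prefix[of "1 - fps_exp 1 :: 'a fps" m] assms by simp
  ultimately have "(\<Sum>j\<le>m. (- 1) ^ j * of_nat (m choose j) * of_nat j ^ p) / fact p = (0 :: 'a)"
    by (simp add: sum_divide_distrib)
  then show ?thesis by simp
qed

text \<open>Division by zero makes the constant coefficient vanish, as composition requires.\<close>

definition tree_fps :: "'a :: field_char_0 fps" where
  "tree_fps = Abs_fps (\<lambda>n. of_nat n ^ n / (of_nat n * fact n))"

text \<open>For \<open>m \<ge> 2\<close> the coefficient is, up to a factor, the alternating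
  binomial sum of \<open>j ^ (m - 1)\<close>: an \<open>m\<close>-th difference of a polynomial of
  lower degree.\<close>

lemma tree_fps_compose: "tree_fps oo (fps_X * fps_exp (- 1)) = (fps_X :: 'a :: field_char_0 fps)"
proof (rule fps_ext)
  fix m
  have G: "(fps_X * fps_exp (- 1) :: 'a fps) ^ j $ m = (if m < j then 0 else (- of_nat j) ^ (m - j) / fact (m - j))" for j
    by (simp add: power_mult_distrib fps_exp_power_mult fps_X_power_mult_nth)
  have "(tree_fps oo (fps_X * fps_exp (- 1))) $ m
      = (\<Sum>j\<le>m. of_nat j ^ j / (of_nat j * fact j) * ((- of_nat j) ^ (m - j) / fact (m - j)) :: 'a)"
    by (simp add: fps_compose_nth G tree_fps_def atLeast0AtMost)
  also have "\<dots> = fps_X $ m"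
  proof (cases "m \<le> 1")
    case True
    then consider "m = 0" | "m = 1" by linarith
    then show ?thesis by cases simp_all
  next
    case False
    have "of_nat j ^ j / (of_nat j * fact j) * ((- of_nat j) ^ (m - j) / fact (m - j))
        = (- 1) ^ m / fact m * ((- 1) ^ j * of_nat (m choose j) * of_nat j ^ (m - 1) :: 'a)" if "j \<le> m" for j
    proof (cases "j = 0")
      case True
      then show ?thesis using False by simp
    next
      case j: False
      have "of_nat (m choose j) = (fact m / (fact j * fact (m - j)) :: 'a)"
        by (rule binomial_fact[OF that])
      moreover have "(- of_nat j :: 'a) ^ (m - j) = (- 1) ^ m * (- 1) ^ j * of_nat j ^ (m - j)"
      proof -
        have "(- 1 :: 'a) ^ m = (- 1) ^ (m - j) * (- 1) ^ j" using that by (simp flip: power_add)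
        then have "(- 1 :: 'a) ^ m * (- 1) ^ j = (- 1) ^ (m - j)" by (simp add: mult.assoc flip: power_mult_distrib)
        then show ?thesis by (simp add: power_minus[of "of_nat j"])
      qed
      moreover have "of_nat j ^ j * of_nat j ^ (m - j) = (of_nat j * of_nat j ^ (m - 1) :: 'a)"
        using that False by (simp flip: power_add power_Suc)
      ultimately show ?thesis using j by (simp add: field_simps)
    qed
    then have "(\<Sum>j\<le>m. of_nat j ^ j / (of_nat j * fact j) * ((- of_nat j) ^ (m - j) / fact (m - j)))
      = (- 1) ^ m / fact m * (\<Sum>j\<le>m. (- 1) ^ j * of_nat (m choose j) * of_nat j ^ (m - 1) :: 'a)"
      by (simp add: sum_distrib_left)
    also have "(\<Sum>j\<le>m. (- 1) ^ j * of_nat (m choose j) * of_nat j ^ (m - 1) :: 'a) = 0"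
      using False by (intro alternating_binomial_power_sum) auto
    finally show ?thesis using False by simp
  qed
  finally show "(tree_fps oo (fps_X * fps_exp (- 1))) $ m = (fps_X $ m :: 'a)" .
qed

text \<open>A one-sided compositional inverse is two-sided: associativity identifies
  \<open>tree_fps\<close> with \<open>fps_inv\<close>.\<close>

lemma compose_tree_fps: "(fps_X * fps_exp (- 1)) oo tree_fps = (fps_X :: 'a :: field_char_0 fps)"
proof -
  let ?G = "fps_X * fps_exp (- 1) :: 'a fps"
  have G: "?G $ 0 = 0" "?G $ 1 \<noteq> 0" by simp_all
  have "tree_fps = tree_fps oo (?G oo fps_inv ?G)"
    using fps_inv_right[OF G] by simp
  also have "\<dots> = (tree_fps oo ?G) oo fps_inv ?G"
    by (rule fps_compose_assoc) (simp_all add: fps_inv_def)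
  also have "\<dots> = fps_inv ?G"
    unfolding tree_fps_compose by (simp add: fps_inv_def fps_X_fps_compose_startby0)
  finally show ?thesis using fps_inv_right[OF G] by simp
qed

lemma tree_fun_sums:
  assumes "\<bar>z\<bar> \<le> 1 / exp 1"
  shows "(\<lambda>j. tree_term j z) sums tree_fun z"
proof -
  have "summable (\<lambda>j. tree_term j z)"
  proof (rule summable_comparison_test'[OF summable_tree_term_inv_e, of 0])
    fix n
    have "norm (tree_term n z) = tree_term n \<bar>z\<bar>"
      by (simp add: tree_term_def abs_mult power_abs)
    then show "norm (tree_term n z) \<le> tree_term n (1 / exp 1)"
      using assms by (simp add: tree_term_mono)
  qed
  then have "(\<lambda>j. tree_term (Suc j) z) sums (\<Sum>j. tree_term (Suc j) z)"
    by (intro summable_sums) (subst summable_Suc_iff)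
  moreover have "(\<Sum>j. tree_term (Suc j) z) = tree_fun z"
    unfolding tree_fun_def tree_term_def by (intro suminf_cong) simp
  ultimately have "(\<lambda>j. tree_term (Suc j) z) sums tree_fun z" by simp
  then show ?thesis using sums_Suc_iff[of "\<lambda>j. tree_term j z" "tree_fun z"] by (simp add: tree_term_def)
qed

lemma tree_fun_nonneg: "z \<in> {0..1 / exp 1} \<Longrightarrow> 0 \<le> tree_fun z"
  using sums_le[OF _ sums_zero tree_fun_sums[of z]] by (simp add: tree_term_nonneg)

lemma continuous_on_tree_fun: "continuous_on {0..1 / exp 1} tree_fun"
proof (rule uniform_limit_theorem)
  have "uniform_limit {0..1 / exp 1} (\<lambda>n t. \<Sum>j<n. tree_term j t) (\<lambda>t. \<Sum>j. tree_term j t) sequentially"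
    by (rule Weierstrass_m_test[OF _ summable_tree_term_inv_e])
      (auto simp: tree_term_nonneg abs_of_nonneg intro!: tree_term_mono)
  moreover have "(\<Sum>j. tree_term j t) = tree_fun t" if "t \<in> {0..1 / exp 1}" for t
    using tree_fun_sums[of t] that by (simp add: sums_iff)
  ultimately show "uniform_limit {0..1 / exp 1} (\<lambda>n t. \<Sum>j<n. tree_term j t) tree_fun sequentially"
    using uniform_limit_cong'[of "{0..1 / exp 1}" "\<lambda>n t. \<Sum>j<n. tree_term j t"
        "\<lambda>n t. \<Sum>j<n. tree_term j t" "\<lambda>t. \<Sum>j. tree_term j t" tree_fun] by blast
  show "\<forall>\<^sub>F n in sequentially. continuous_on {0..1 / exp 1} (\<lambda>t. \<Sum>j<n. tree_term j t)"
    by (intro always_eventually allI continuous_intros continuous_on_tree_term)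
qed simp

lemma tree_fps_conv_radius: "ereal (1 / exp 1) \<le> fps_conv_radius (tree_fps :: complex fps)"
proof -
  have "summable (\<lambda>n. tree_fps $ n * (complex_of_real (1 / exp 1)) ^ n)"
  proof -
    have "tree_fps $ n * (complex_of_real (1 / exp 1)) ^ n = of_real (tree_term n (1 / exp 1))" for n
      by (simp add: tree_fps_def tree_term_def)
    then show ?thesis by (simp add: summable_of_real summable_tree_term_inv_e)
  qed
  from conv_radius_geI[OF this] show ?thesis
    unfolding fps_conv_radius_def by (simp only: norm_of_real) simp
qed

lemma eval_tree_fps:
  assumes "\<bar>z\<bar> < 1 / exp 1"
  shows "eval_fps tree_fps (complex_of_real z) = of_real (tree_fun z)"
proof -
  have "(\<lambda>j. complex_of_real (tree_term j z)) sums of_real (tree_fun z)"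
    using assms by (intro sums_of_real tree_fun_sums) simp
  moreover have "complex_of_real (tree_term j z) = tree_fps $ j * of_real z ^ j" for j
    by (simp add: tree_fps_def tree_term_def)
  ultimately show ?thesis by (simp add: eval_fps_def sums_iff)
qed

text \<open>The formal identity gives the equation near 0; the identity theorem for holomorphic
  functions carries it to the whole open disc, whence the complex argument.\<close>

lemma tree_fun_inverse_complex:
  fixes z :: complex
  assumes "norm z < 1 / exp 1"
  shows "eval_fps tree_fps z * exp (- eval_fps tree_fps z) = z"
proof -
  let ?T = "eval_fps (tree_fps :: complex fps)"
  have T: "?T has_fps_expansion tree_fps"
    by (intro eval_fps_has_fps_expansion less_le_trans[OF _ tree_fps_conv_radius]) simp
  have "(\<lambda>w. w * exp (- 1 * w)) has_fps_expansion (fps_X * fps_exp (- 1) :: complex fps)"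
    by (intro fps_expansion_intros)
  then have "((\<lambda>w. w * exp (- 1 * w)) \<circ> ?T) has_fps_expansion ((fps_X * fps_exp (- 1)) oo tree_fps)"
    using T by (rule has_fps_expansion_compose) (simp add: tree_fps_def)
  then have "(\<lambda>w. ?T w * exp (- ?T w)) has_fps_expansion fps_X"
    unfolding compose_tree_fps by (simp add: o_def)
  then have ev: "\<forall>\<^sub>F w in nhds 0. ?T w * exp (- ?T w) = w"
    unfolding has_fps_expansion_def by (auto elim: eventually_mono)
  then obtain d where d: "d > 0" "\<And>w. dist w 0 < d \<Longrightarrow> ?T w * exp (- ?T w) = w"
    unfolding eventually_nhds_metric by blast
  have hol: "?T holomorphic_on ball 0 (1 / exp 1)"
  proof (rule holomorphic_on_subset[OF holomorphic_on_eval_fps])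
    show "ball 0 (1 / exp 1) \<subseteq> eball 0 (fps_conv_radius (tree_fps :: complex fps))"
      using tree_fps_conv_radius by (auto simp: eball_def) (meson ereal_less_eq(3) less_le_trans less_ereal.simps(1))
  qed auto
  define r where "r = min d (1 / exp 1)"
  have "?T z * exp (- ?T z) - z = 0"
  proof (rule analytic_continuation[where f = "\<lambda>w. ?T w * exp (- ?T w) - w" and S = "ball 0 (1 / exp 1)" and U = "ball 0 r" and \<xi> = 0])
    show "(\<lambda>w. ?T w * exp (- ?T w) - w) holomorphic_on ball 0 (1 / exp 1)"
      by (intro holomorphic_intros hol)
    show "0 islimpt ball (0::complex) r"
      using d(1) by (intro interior_limit_point) (simp add: r_def)
  qed (use d assms in \<open>auto simp: r_def dist_commute\<close>)
  then show ?thesis by simp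
qed

text \<open>The end point \<open>1 / e\<close> lies on the boundary of the disc and is reached by
  continuity from inside.\<close>

lemma tree_fun_inverse:
  assumes "z \<in> {0..1 / exp 1}"
  shows "tree_fun z * exp (- tree_fun z) = z"
proof -
  have inner: "tree_fun z * exp (- tree_fun z) = z" if z: "0 \<le> z" "z < 1 / exp 1" for z
  proof -
    have "complex_of_real (tree_fun z * exp (- tree_fun z)) = of_real z"
      using tree_fun_inverse_complex[of "of_real z"] z by (simp add: eval_tree_fps exp_of_real flip: of_real_minus)
    then show ?thesis by (simp only: of_real_eq_iff)
  qed
  have "tree_fun z * exp (- tree_fun z) - z = 0"
  proof (rule continuous_constant_on_closure[where S = "{0<..<1 / exp 1}" and f = "\<lambda>z. tree_fun z * exp (- tree_fun z) - z"])
    show "continuous_on (closure {0<..<1 / exp 1}) (\<lambda>z. tree_fun z * exp (- tree_fun z) - z)"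
      by (simp add: closure_greaterThanLessThan) (intro continuous_intros continuous_on_tree_fun)
    show "z \<in> closure {0<..<1 / exp 1}" using assms by (simp add: closure_greaterThanLessThan)
  qed (use inner in auto)
  then show ?thesis by simp
qed

text \<open>The equation \<open>t * exp (- t) = 1 / e\<close> becomes \<open>ln t = t - 1\<close>,
  and the logarithm meets its tangent at 1 nowhere else.\<close>

lemma tree_fun_inv_e: "tree_fun (1 / exp 1) = 1"
proof -
  let ?t = "tree_fun (1 / exp 1)"
  have eq: "?t * exp (- ?t) = 1 / exp 1" by (rule tree_fun_inverse) simp
  have "0 \<le> ?t" by (rule tree_fun_nonneg) simp
  moreover have "?t \<noteq> 0"
  proof
    assume "?t = 0"
    with eq show False by simp
  qed
  ultimately have pos: "0 < ?t" by simp
  have "ln (?t * exp (- ?t)) = ln ?t - ?t" using pos by (simp add: ln_mult)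
  then have "ln ?t = ?t - 1" unfolding eq by (simp add: ln_div)
  then show ?thesis using pos ln_eq_minus_one by blast
qed

text \<open>At 0 the exponential is 1 while the quotient 0/0 is read as 0, hence the half-open
  interval.\<close>

lemma exp_minus_tree_fun:
  assumes "z \<in> {0<..1 / exp 1}"
  shows "exp (- tree_fun z) = z / tree_fun z" "0 < tree_fun z"
proof -
  have eq: "tree_fun z * exp (- tree_fun z) = z" using assms by (intro tree_fun_inverse) auto
  then have "tree_fun z \<noteq> 0" using assms by auto
  then show "exp (- tree_fun z) = z / tree_fun z" using eq by (simp add: field_simps)
  show "0 < tree_fun z" using tree_fun_nonneg[of z] \<open>tree_fun z \<noteq> 0\<close> assms by simp
qed

section \<open>Asymptotics of the limit law\<close>

text \<open>The weights \<open>k * s ^ (k - 1) / c ^ k\<close> are probability densities that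
  concentrate at \<open>c\<close>.\<close>

lemma integral_power_weight_lim:
  fixes g :: "real \<Rightarrow> real"
  assumes c: "0 < c" and g: "continuous_on {0..c} g"
  shows "(\<lambda>k. real k / c ^ k * integral {0..c} (\<lambda>s. s ^ (k - 1) * g s)) \<longlonglongrightarrow> g c"
proof -
  have I: "((\<lambda>s. s ^ (k - 1)) has_integral c ^ k / real k) {0..c}" if "0 < k" for k
  proof -
    have "((\<lambda>s. s ^ (k - 1)) has_integral c ^ k / real k - 0 ^ k / real k) {0..c}"
    proof (rule fundamental_theorem_of_calculus)
      show "((\<lambda>s. s ^ k / real k) has_vector_derivative s ^ (k - 1)) (at s within {0..c})" for s
        unfolding has_real_derivative_iff_has_vector_derivative[symmetric]
        using that by (auto intro!: derivative_eq_intros)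
    qed (use c in simp)
    moreover have "0 ^ k / real k = (0::real)" using that by simp
    ultimately show ?thesis by simp
  qed
  obtain M where "\<forall>x\<in>g ` {0..c}. norm x \<le> M"
    using compact_imp_bounded[OF compact_continuous_image[OF g compact_Icc]] unfolding bounded_iff by blast
  then have M: "\<bar>g s\<bar> \<le> M" if "s \<in> {0..c}" for s
    using that by auto
  have M0: "0 \<le> M" using M[of c] c by auto
  show ?thesis
    unfolding tendsto_iff dist_real_def
  proof (intro allI impI)
    fix \<epsilon> :: real assume \<epsilon>: "\<epsilon> > 0"
    have "c \<in> {0..c}" "\<epsilon> / 2 > 0" using c \<epsilon> by auto
    with g obtain d where d: "d > 0" "\<And>s. s \<in> {0..c} \<Longrightarrow> dist s c < d \<Longrightarrow> dist (g s) (g c) < \<epsilon> / 2"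
      unfolding continuous_on_iff by blast
    \<comment> \<open>Makes \<open>\<epsilon> / 2 + B * (c - s)\<close> a majorant of
      \<open>\<bar>g s - g c\<bar>\<close>: at distance \<open>d\<close> from \<open>c\<close> the
      linear part already reaches \<open>2 * M\<close>. Against the weight it integrates to
      \<open>B * c / (k + 1)\<close>.\<close>
    define B where "B = 2 * M / d"
    have B: "0 \<le> B" unfolding B_def using M0 d by simp
    have g_near: "\<bar>g s - g c\<bar> \<le> \<epsilon> / 2 + B * (c - s)" if s: "s \<in> {0..c}" for s
    proof (cases "dist s c < d")
      case True
      then have "\<bar>g s - g c\<bar> < \<epsilon> / 2" using d(2)[OF s] by (simp add: dist_real_def)
      moreover have "0 \<le> B * (c - s)" using B s by simp
      ultimately show ?thesis by linarith
    next
      case False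
      then have "d \<le> c - s" using s by (simp add: dist_real_def)
      then have "B * d \<le> B * (c - s)" using B by (rule mult_left_mono)
      moreover have "B * d = 2 * M" using d by (simp add: B_def)
      moreover have "\<bar>g s - g c\<bar> \<le> 2 * M" using M[OF s] M[of c] c by auto
      ultimately show ?thesis using \<epsilon> by linarith
    qed
    have "(\<lambda>k. B * c / (real k + 1)) \<longlonglongrightarrow> 0" by real_asymp
    then have "\<forall>\<^sub>F k in sequentially. B * c / (real k + 1) < \<epsilon> / 2"
      by (rule order_tendstoD(2)) (use \<epsilon> in simp)
    then show "\<forall>\<^sub>F k in sequentially. \<bar>real k / c ^ k * integral {0..c} (\<lambda>s. s ^ (k - 1) * g s) - g c\<bar> < \<epsilon>"
      using eventually_gt_at_top[of 0]
    proof eventually_elim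
      case (elim k)
      define w where "w s = real k / c ^ k * s ^ (k - 1)" for s
      have w: "(w has_integral 1) {0..c}"
        using has_integral_mult_right[OF I[OF elim(2)], of "real k / c ^ k"] elim c by (simp add: w_def[abs_def])
      have "((\<lambda>s. real k / c ^ k * s ^ (Suc k - 1)) has_integral real k / c ^ k * (c ^ Suc k / real (Suc k))) {0..c}"
        by (intro has_integral_mult_right I) simp
      moreover have "real k / c ^ k * s ^ (Suc k - 1) = w s * s" for s
        using elim by (cases k) (simp_all add: w_def)
      moreover have "real k / c ^ k * (c ^ Suc k / real (Suc k)) = c * (real k / (real k + 1))"
        using c by (simp add: add.commute)
      ultimately have ws: "((\<lambda>s. w s * s) has_integral c * (real k / (real k + 1))) {0..c}" by simp
      have "((\<lambda>s. (\<epsilon> / 2 + B * c) * w s - B * (w s * s)) has_integral (\<epsilon> / 2 + B * c) * 1 - B * (c * (real k / (real k + 1)))) {0..c}"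
        by (rule has_integral_diff[OF has_integral_mult_right[OF w] has_integral_mult_right[OF ws]])
      moreover have "(\<epsilon> / 2 + B * c) * w s - B * (w s * s) = w s * (\<epsilon> / 2 + B * (c - s))" for s
        by (simp add: algebra_simps)
      ultimately have up: "((\<lambda>s. w s * (\<epsilon> / 2 + B * (c - s))) has_integral (\<epsilon> / 2 + B * c) * 1 - B * (c * (real k / (real k + 1)))) {0..c}"
        by simp
      have cw: "continuous_on {0..c} w" unfolding w_def by (intro continuous_intros)
      have fi: "(\<lambda>s. w s * (g s - g c)) integrable_on {0..c}"
        by (intro integrable_continuous_real continuous_intros g cw)
      have gi: "(\<lambda>s. w s * g s) integrable_on {0..c}"
        by (intro integrable_continuous_real continuous_intros g cw)
      have "norm (integral {0..c} (\<lambda>s. w s * (g s - g c))) \<le> integral {0..c} (\<lambda>s. w s * (\<epsilon> / 2 + B * (c - s)))"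
      proof (rule integral_norm_bound_integral[OF fi])
        show "(\<lambda>s. w s * (\<epsilon> / 2 + B * (c - s))) integrable_on {0..c}" using up by blast
        show "norm (w s * (g s - g c)) \<le> w s * (\<epsilon> / 2 + B * (c - s))" if s: "s \<in> {0..c}" for s
        proof -
          have "0 \<le> w s" using s c by (simp add: w_def)
          then have "\<bar>w s\<bar> * \<bar>g s - g c\<bar> \<le> w s * (\<epsilon> / 2 + B * (c - s))"
            using mult_left_mono[OF g_near[OF s], of "w s"] by simp
          then show ?thesis by (simp add: abs_mult)
        qed
      qed
      also have "\<dots> = (\<epsilon> / 2 + B * c) * 1 - B * (c * (real k / (real k + 1)))"
        using up by (rule integral_unique)
      also have "\<dots> = \<epsilon> / 2 + B * c / (real k + 1)"
        by (simp add: field_simps)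
      also have "\<dots> < \<epsilon>" using elim(1) by linarith
      finally have "\<bar>integral {0..c} (\<lambda>s. w s * (g s - g c))\<bar> < \<epsilon>" by simp
      moreover have "integral {0..c} (\<lambda>s. w s * (g s - g c)) = integral {0..c} (\<lambda>s. w s * g s) - g c"
        using integral_unique[OF has_integral_diff[OF integrable_integral[OF gi] has_integral_mult_left[OF w, of "g c"]]]
        by (simp add: right_diff_distrib)
      moreover have "integral {0..c} (\<lambda>s. w s * g s) = real k / c ^ k * integral {0..c} (\<lambda>s. s ^ (k - 1) * g s)"
        unfolding w_def mult.assoc by (rule integral_mult_right)
      ultimately show ?case by simp
    qed
  qed
qed

context cycle_model
begin

text \<open>The integral contributes \<open>exp (- k) / k\<close> times the value of
  \<open>exp (- LamInf)\<close> at the end point, and Stirling's formula gives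
  \<open>exp k / sqrt (2 * pi * k)\<close> for \<open>k ^ k / fact k\<close>; the exponentials
  cancel.\<close>

lemma limit_prob_asymp:
  "limit_prob \<sim>[at_top] (\<lambda>k. \<kappa> * exp (- LamInf (1 / exp 1)) / sqrt (2 * pi) * real k powr (- 3 / 2))"
proof (rule asymp_equivI')
  let ?e = "1 / exp 1 :: real"
  let ?g = "\<lambda>s. exp (- LamInf s)"
  let ?A = "\<lambda>k. real k / ?e ^ k * integral {0..?e} (\<lambda>s. s ^ (k - 1) * ?g s)"
  have A: "?A \<longlonglongrightarrow> ?g ?e"
    by (rule integral_power_weight_lim) (auto intro!: continuous_intros continuous_on_LamInf)
  have "(\<lambda>k. sqrt (2 * pi) / stirling_ratio k * (?A k / ?g ?e)) \<longlonglongrightarrow> sqrt (2 * pi) / sqrt (2 * pi) * (?g ?e / ?g ?e)"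
    by (intro tendsto_intros stirling_ratio_lim A) auto
  then have lim: "(\<lambda>k. sqrt (2 * pi) / stirling_ratio k * (?A k / ?g ?e)) \<longlonglongrightarrow> 1" by simp
  show "((\<lambda>k. limit_prob k / (\<kappa> * ?g ?e / sqrt (2 * pi) * real k powr (- 3 / 2))) \<longlongrightarrow> 1) at_top"
  proof (rule Lim_transform_eventually[OF lim])
    show "\<forall>\<^sub>F k in sequentially. sqrt (2 * pi) / stirling_ratio k * (?A k / ?g ?e)
        = limit_prob k / (\<kappa> * ?g ?e / sqrt (2 * pi) * real k powr (- 3 / 2))"
      using eventually_gt_at_top[of 0]
    proof eventually_elim
      case (elim k)
      define I where "I = integral {0..?e} (\<lambda>s. s ^ (k - 1) * ?g s)"
      have p: "limit_prob k = \<kappa> * (real k ^ k / fact k) * I"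
        unfolding limit_prob_def lam'_def tree_term_deriv_def I_def
        by (subst integral_mult_right[symmetric]) (simp add: mult_ac)
      have "real k powr (3 / 2) = real k powr 1 * real k powr (1 / 2)" by (simp only: powr_add[symmetric]) simp
      then have s: "real k powr (3 / 2) = real k * sqrt (real k)" using elim by (simp add: powr_half_sqrt)
      have "?e = exp (- 1)" by (simp only: exp_minus inverse_eq_divide)
      then have e: "?e ^ k = exp (- real k)"
        using exp_of_nat_mult[of k "- 1 :: real"] by simp
      have r: "real k ^ k / fact k = 1 / (stirling_ratio k * (exp (- real k) * sqrt (real k)))"
        using elim by (simp add: stirling_ratio_def)
      have alg: "S / q * (K / x * I / G) = a * (1 / (q * (x * y))) * I / (a * G / S * (1 / (K * y)))"
        if "S \<noteq> 0" "q \<noteq> 0" "x \<noteq> 0" "G \<noteq> 0" "a \<noteq> 0" "y \<noteq> 0" "K \<noteq> 0" for S q K x G a y :: real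
        using that by (simp add: divide_simps)
      have m: "real k powr (- 3 / 2) = 1 / (real k * sqrt (real k))"
        using powr_minus_divide[of "real k" "3 / 2"] by (simp add: s)
      show ?case
        unfolding p r I_def[symmetric] e m
        by (rule alg) (use elim stirling_ratio_pos[OF elim] \<kappa>_pos in auto)
    qed
  qed
qed

end

section \<open>Counting cycles by vertex lists\<close>

lemma Suc_mod_eq: "i < k \<Longrightarrow> Suc i mod k = (if Suc i = k then 0 else Suc i)"
  by simp

lemma Suc_mod_less: "i < k \<Longrightarrow> Suc i mod k < k"
  by (auto simp: Suc_mod_eq)

lemma Suc_mod_pred:
  assumes "p < (k :: nat)"
  obtains q where "q < k" "Suc q mod k = p"
proof (cases p)
  case 0
  then show ?thesis using assms that[of "k - 1"] by simp
next
  case (Suc q)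
  then show ?thesis using assms that[of q] by simp
qed

lemma Suc_mod_Suc_mod_neq:
  assumes "i < k" "3 \<le> k"
  shows "Suc (Suc i mod k) mod k \<noteq> i"
proof (cases "Suc i = k")
  case True
  then show ?thesis using assms by simp
next
  case False
  then have "Suc i mod k = Suc i" using assms by simp
  then show ?thesis using assms False by (cases "Suc (Suc i) = k") auto
qed

text \<open>Propagates a property around a cycle: \<open>j\<close> is reached from \<open>i\<close>
  after \<open>j + k - i\<close> cyclic successors, where adding \<open>k\<close> keeps the natural
  subtraction exact.\<close>

lemma Suc_mod_induct:
  assumes i: "i < k" "P i" and step: "\<And>i. i < k \<Longrightarrow> P i \<Longrightarrow> P (Suc i mod k)" and j: "j < k"
  shows "P j"
proof -
  have *: "P ((i + d) mod k)" for d
  proof (induction d)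
    case (Suc d)
    have "P (Suc ((i + d) mod k) mod k)" using Suc i(1) by (intro step) auto
    then show ?case by (simp add: mod_Suc_eq)
  qed (use i in simp)
  have "(i + (j + k - i)) mod k = j" using i(1) j by simp
  then show ?thesis using *[of "j + k - i"] by simp
qed

text \<open>\<open>\<phi>\<close> joins consecutive vertices into an arc or an edge, so that both
  kinds of cycles share the counting.\<close>

definition cyc_edges :: "('a \<Rightarrow> 'a \<Rightarrow> 'e) \<Rightarrow> 'a list \<Rightarrow> 'e set" where
  "cyc_edges \<phi> vs = (\<lambda>i. \<phi> (vs ! i) (vs ! (Suc i mod length vs))) ` {..<length vs}"

lemma arcs_of_eq: "arcs_of = cyc_edges Pair"
  by (auto simp: fun_eq_iff arcs_of_def cyc_edges_def)

lemma edges_of_eq: "edges_of = cyc_edges (\<lambda>u v. {u, v})"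
  by (auto simp: fun_eq_iff edges_of_def cyc_edges_def)

lemma finite_cyc_edges: "finite (cyc_edges \<phi> vs)"
  by (simp add: cyc_edges_def)

lemma cyc_edges_rotate1: "cyc_edges \<phi> (rotate1 vs) = cyc_edges \<phi> vs"
proof -
  let ?k = "length vs"
  let ?e = "\<lambda>i. \<phi> (vs ! i) (vs ! (Suc i mod ?k))"
  have "cyc_edges \<phi> (rotate1 vs) = (\<lambda>i. ?e (Suc i mod ?k)) ` {..<?k}"
    unfolding cyc_edges_def by (intro image_cong) (auto simp: nth_rotate1 Suc_mod_less)
  also have "\<dots> = ?e ` ((\<lambda>i. Suc i mod ?k) ` {..<?k})" by (simp add: image_image)
  also have "(\<lambda>i. Suc i mod ?k) ` {..<?k} = {..<?k}"
  proof (intro equalityI subsetI)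
    fix p assume "p \<in> {..<?k}"
    then obtain q where "q < ?k" "Suc q mod ?k = p" using Suc_mod_pred by blast
    then show "p \<in> (\<lambda>i. Suc i mod ?k) ` {..<?k}" by blast
  qed (auto intro: Suc_mod_less)
  finally show ?thesis by (simp add: cyc_edges_def)
qed

lemma cyc_edges_rotate: "cyc_edges \<phi> (rotate i vs) = cyc_edges \<phi> vs"
  by (induction i) (simp_all add: cyc_edges_rotate1)

section \<open>Directed cycles as vertex lists\<close>

lemma arcs_of_out_unique:
  assumes "distinct vs" "(u, v) \<in> arcs_of vs" "(u, v') \<in> arcs_of vs"
  shows "v = v'"
  using assms by (auto simp: arcs_of_def nth_eq_iff_index_eq)

text \<open>Out-arcs are unique, so from a common vertex on the successors in \<open>us\<close> and
  \<open>vs\<close> agree. Hence \<open>us\<close> visits all of \<open>vs\<close>, and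
  cardinalities force equality.\<close>

lemma arcs_of_subset_imp_eq:
  assumes vs: "distinct vs" and us: "distinct us" "us \<noteq> []" and sub: "arcs_of us \<subseteq> arcs_of vs"
  shows "arcs_of us = arcs_of vs"
proof -
  let ?k = "length vs" and ?l = "length us"
  have us0: "(us ! 0, us ! (Suc 0 mod ?l)) \<in> arcs_of us"
    unfolding arcs_of_def using us(2) by blast
  then obtain i where i: "i < ?k" "vs ! i = us ! 0" using sub by (auto simp: arcs_of_def)
  have "vs ! j \<in> set us" if "j < ?k" for j
  proof (rule Suc_mod_induct[where P = "\<lambda>j. vs ! j \<in> set us" and k = ?k and i = i])
    show "vs ! i \<in> set us" using i us(2) by simp
    fix j assume j: "j < ?k" "vs ! j \<in> set us"
    then obtain p where p: "p < ?l" "us ! p = vs ! j" by (auto simp: in_set_conv_nth)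
    have "(vs ! j, us ! (Suc p mod ?l)) \<in> arcs_of us" unfolding arcs_of_def using p by (intro CollectI exI[of _ p]) simp
    moreover have "(vs ! j, vs ! (Suc j mod ?k)) \<in> arcs_of vs" unfolding arcs_of_def using j by blast
    ultimately have "us ! (Suc p mod ?l) = vs ! (Suc j mod ?k)"
      using arcs_of_out_unique[OF vs] sub by blast
    then show "vs ! (Suc j mod ?k) \<in> set us"
      using p Suc_mod_less by (metis nth_mem)
  qed (use i that in auto)
  then have "set vs \<subseteq> set us" by (auto simp: in_set_conv_nth)
  then have "card (set vs) \<le> card (set us)" by (intro card_mono) auto
  then have "card (arcs_of vs) \<le> card (arcs_of us)"
    using vs us by (simp add: card_arcs_of distinct_card)
  then show ?thesis using sub by (intro card_seteq) (simp_all add: arcs_of_eq finite_cyc_edges)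
qed

lemma arcs_of_hd_inject:
  assumes us: "distinct us" and ws: "distinct ws" and len: "length us = length ws"
    and eq: "arcs_of us = arcs_of ws" and hd: "us ! 0 = ws ! 0"
  shows "us = ws"
proof (rule nth_equalityI[OF len])
  fix i assume "i < length us"
  then show "us ! i = ws ! i"
  proof (induction i)
    case (Suc i)
    have "(us ! i, us ! Suc i) \<in> arcs_of us"
      unfolding arcs_of_def using Suc.prems by (auto intro!: exI[of _ i])
    moreover have "(ws ! i, ws ! Suc i) \<in> arcs_of ws"
      unfolding arcs_of_def using Suc.prems len by (auto intro!: exI[of _ i])
    ultimately show ?case
      using Suc eq arcs_of_out_unique[OF ws] by auto
  qed (rule hd)
qed

lemma rotate_hd_snd:
  assumes "(u, v) \<in> arcs_of vs" "2 \<le> length vs"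
  obtains i where "rotate i vs ! 0 = u" "rotate i vs ! 1 = v"
proof -
  obtain i where i: "i < length vs" "u = vs ! i" "v = vs ! (Suc i mod length vs)"
    using assms(1) by (auto simp: arcs_of_def)
  show ?thesis
  proof (rule that)
    show "rotate i vs ! 0 = u" using i nth_rotate[of 0 vs i] by fastforce
    show "rotate i vs ! 1 = v" using i assms(2) nth_rotate[of 1 vs i] by simp
  qed
qed

text \<open>The first arc determines the list, and rotation makes any arc of the cycle the
  first.\<close>

lemma card_directed_fibre:
  assumes vs: "distinct vs" "2 \<le> length vs"
  shows "card {us. distinct us \<and> length us = length vs \<and> arcs_of us = arcs_of vs} = length vs"
proof -
  let ?F = "{us. distinct us \<and> length us = length vs \<and> arcs_of us = arcs_of vs}"
  have "bij_betw (\<lambda>us. (us ! 0, us ! 1)) ?F (arcs_of vs)"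
  proof (rule bij_betwI')
    fix us ws assume "us \<in> ?F" "ws \<in> ?F"
    then show "((us ! 0, us ! 1) = (ws ! 0, ws ! 1)) = (us = ws)"
      by (auto intro: arcs_of_hd_inject)
  next
    fix us assume us: "us \<in> ?F"
    then have "(us ! 0, us ! 1) \<in> arcs_of us"
      using vs(2) unfolding arcs_of_def by (auto intro!: exI[of _ 0])
    then show "(us ! 0, us ! 1) \<in> arcs_of vs" using us by simp
  next
    fix p assume "p \<in> arcs_of vs"
    then have "(fst p, snd p) \<in> arcs_of vs" "2 \<le> length vs" using vs(2) by auto
    from rotate_hd_snd[OF this] obtain i where i: "rotate i vs ! 0 = fst p" "rotate i vs ! 1 = snd p"
      by blast
    have "rotate i vs \<in> ?F"
      using vs by (simp add: arcs_of_eq cyc_edges_rotate)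
    moreover have "p = (rotate i vs ! 0, rotate i vs ! 1)" unfolding i by simp
    ultimately show "\<exists>us\<in>?F. p = (us ! 0, us ! 1)" by (rule rev_bexI)
  qed
  then have "card ?F = card (arcs_of vs)" by (rule bij_betw_same_card)
  then show ?thesis using vs(1) by (simp add: card_arcs_of)
qed

section \<open>Undirected cycles as vertex lists\<close>

lemma edges_of_arcs: "edges_of vs = (\<lambda>(u, v). {u, v}) ` arcs_of vs"
  unfolding edges_of_eq arcs_of_eq cyc_edges_def by (simp add: image_image)

lemma converse_arcs_of_rev:
  assumes "(u, v) \<in> arcs_of vs"
  shows "(v, u) \<in> arcs_of (rev vs)"
proof -
  let ?k = "length vs"
  obtain i where i: "i < ?k" "u = vs ! i" "v = vs ! (Suc i mod ?k)"
    using assms by (auto simp: arcs_of_def)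
  show ?thesis
  proof (cases "Suc i = ?k")
    case True
    moreover have "rev vs ! i = vs ! (?k - Suc i)" "rev vs ! 0 = vs ! (?k - Suc 0)"
      using i(1) by (intro rev_nth; linarith)+
    ultimately have "v = rev vs ! i" "u = rev vs ! (Suc i mod ?k)"
      using i by (simp_all flip: \<open>Suc i = ?k\<close>)
    then show ?thesis unfolding arcs_of_def using i by auto
  next
    case False
    let ?p = "?k - 1 - Suc i"
    have "Suc ?p mod ?k = ?k - 1 - i" using i False by simp
    then have "v = rev vs ! ?p" "u = rev vs ! (Suc ?p mod ?k)"
      using i False by (auto simp: rev_nth)
    then show ?thesis unfolding arcs_of_def using i False by (auto intro!: exI[of _ ?p])
  qed
qed

lemma edges_at_vertex:
  assumes vs: "distinct vs" and q: "q < length vs" "Suc q mod length vs = i"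
    and e: "e \<in> edges_of vs" "vs ! i \<in> e"
  shows "e = {vs ! i, vs ! (Suc i mod length vs)} \<or> e = {vs ! q, vs ! i}"
proof -
  let ?k = "length vs"
  obtain j where j: "j < ?k" "e = {vs ! j, vs ! (Suc j mod ?k)}"
    using e(1) by (auto simp: edges_of_def)
  have i: "i < ?k" using q Suc_mod_less by metis
  consider "vs ! i = vs ! j" | "vs ! i = vs ! (Suc j mod ?k)" using e(2) j(2) by auto
  then show ?thesis
  proof cases
    case 1
    then have "i = j" using vs i j by (simp add: nth_eq_iff_index_eq)
    then show ?thesis using j by simp
  next
    case 2
    then have "i = Suc j mod ?k" using vs i j Suc_mod_less by (simp add: nth_eq_iff_index_eq)
    then have "Suc j mod ?k = Suc q mod ?k" using q by simp
    then have "j = q" using j(1) q(1) by (auto simp: Suc_mod_eq split: if_splits)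
    then show ?thesis using j q by simp
  qed
qed

text \<open>A common vertex carries two distinct edges of \<open>us\<close> (here length 3 matters)
  and at most two of \<open>vs\<close>, so these coincide and its successor in \<open>vs\<close> is
  a vertex of \<open>us\<close>. Then propagate around \<open>vs\<close> and count.\<close>

lemma edges_of_subset_imp_eq:
  assumes vs: "distinct vs" "3 \<le> length vs" and us: "distinct us" "3 \<le> length us" and sub: "edges_of us \<subseteq> edges_of vs"
  shows "edges_of us = edges_of vs"
proof -
  let ?k = "length vs" and ?l = "length us"
  have "{us ! 0, us ! (Suc 0 mod ?l)} \<in> edges_of us"
    unfolding edges_of_def using us(2) by (intro CollectI exI[of _ 0]) auto
  then have "{us ! 0, us ! (Suc 0 mod ?l)} \<in> edges_of vs" using sub by blast
  then obtain j where j: "j < ?k" "{us ! 0, us ! (Suc 0 mod ?l)} = {vs ! j, vs ! (Suc j mod ?k)}"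
    by (auto simp: edges_of_def)
  then have "vs ! j = us ! 0 \<or> vs ! (Suc j mod ?k) = us ! 0" by (auto simp: doubleton_eq_iff)
  then obtain i where i: "i < ?k" "vs ! i = us ! 0" using j(1) Suc_mod_less[OF j(1)] by blast
  have "vs ! j \<in> set us" if "j < ?k" for j
  proof (rule Suc_mod_induct[where P = "\<lambda>j. vs ! j \<in> set us" and k = ?k and i = i])
    show "vs ! i \<in> set us" unfolding i(2) using us(2) by (intro nth_mem) linarith
    fix j assume j: "j < ?k" "vs ! j \<in> set us"
    then obtain p where p: "p < ?l" "us ! p = vs ! j" by (auto simp: in_set_conv_nth)
    obtain q where q: "q < ?k" "Suc q mod ?k = j" using Suc_mod_pred[OF j(1)] by blast
    obtain r where r: "r < ?l" "Suc r mod ?l = p" using Suc_mod_pred[OF p(1)] by blast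
    let ?e = "{us ! p, us ! (Suc p mod ?l)}" and ?f = "{us ! r, us ! p}"
    have "?e \<in> edges_of us" "?f \<in> edges_of us"
      unfolding edges_of_def using p r by blast+
    then have e: "?e \<in> edges_of vs" "?f \<in> edges_of vs" using sub by auto
    have gen: "g = A \<or> g = B" if "A \<noteq> B" "A = g \<or> A = h" "B = g \<or> B = h" for A B g h :: "nat set"
      using that by blast
    have "Suc p mod ?l \<noteq> r"
      using Suc_mod_Suc_mod_neq[OF r(1) us(2)] r(2) by simp
    then have "us ! (Suc p mod ?l) \<noteq> us ! r"
      using us(1) p r Suc_mod_less[OF p(1)] by (simp add: nth_eq_iff_index_eq)
    then have "?e \<noteq> ?f" by (auto simp: doubleton_eq_iff)
    moreover have "?e = {vs ! j, vs ! (Suc j mod ?k)} \<or> ?e = {vs ! q, vs ! j}"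
      "?f = {vs ! j, vs ! (Suc j mod ?k)} \<or> ?f = {vs ! q, vs ! j}"
      using edges_at_vertex[OF vs(1) q e(1)] edges_at_vertex[OF vs(1) q e(2)] p(2) by auto
    ultimately have "{vs ! j, vs ! (Suc j mod ?k)} = ?e \<or> {vs ! j, vs ! (Suc j mod ?k)} = ?f" by (rule gen)
    then have "vs ! (Suc j mod ?k) \<in> ?e \<union> ?f" by auto
    moreover have "us ! p \<in> set us" "us ! (Suc p mod ?l) \<in> set us" "us ! r \<in> set us"
      by (intro nth_mem p(1) r(1) Suc_mod_less[OF p(1)])+
    ultimately show "vs ! (Suc j mod ?k) \<in> set us" by auto
  qed (use i that in auto)
  then have "set vs \<subseteq> set us" by (auto simp: in_set_conv_nth)
  then have "card (set vs) \<le> card (set us)" by (intro card_mono) auto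
  then have "card (edges_of vs) \<le> card (edges_of us)"
    using vs us by (simp add: card_edges_of distinct_card)
  then show ?thesis using sub by (intro card_seteq) (simp_all add: edges_of_eq finite_cyc_edges)
qed

text \<open>One inclusion is enough, as nested cycles coincide.\<close>

lemma edges_of_rev:
  assumes "distinct vs" "3 \<le> length vs"
  shows "edges_of (rev vs) = edges_of vs"
proof -
  have "edges_of vs \<subseteq> edges_of (rev vs)"
  proof
    fix e assume "e \<in> edges_of vs"
    then obtain u v where "(u, v) \<in> arcs_of vs" "e = {u, v}" by (auto simp: edges_of_arcs)
    then have "(v, u) \<in> arcs_of (rev vs)" "e = {v, u}" by (auto intro: converse_arcs_of_rev)
    then show "e \<in> edges_of (rev vs)" by (force simp: edges_of_arcs)
  qed
  then show ?thesis using assms by (intro edges_of_subset_imp_eq[symmetric]) auto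
qed

text \<open>The first two vertices fix base point and orientation: one of the two edges at a vertex
  leads back, which forces the next vertex.\<close>

lemma edges_of_hd_snd_inject:
  assumes us: "distinct us" and ws: "distinct ws" and len: "length us = length ws" "3 \<le> length us"
    and eq: "edges_of us = edges_of ws" and hd: "us ! 0 = ws ! 0" "us ! 1 = ws ! 1"
  shows "us = ws"
proof (rule nth_equalityI[OF len(1)])
  have *: "us ! i = ws ! i \<and> us ! Suc i = ws ! Suc i" if "Suc i < length us" for i
    using that
  proof (induction i)
    case (Suc i)
    let ?e = "{us ! Suc i, us ! Suc (Suc i)}"
    have IH: "us ! i = ws ! i" "us ! Suc i = ws ! Suc i" using Suc by auto
    have "?e \<in> edges_of us"
      unfolding edges_of_def using Suc.prems by (auto intro!: exI[of _ "Suc i"])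
    then have "?e \<in> edges_of ws" using eq by simp
    then have "?e = {ws ! Suc i, ws ! (Suc (Suc i) mod length ws)} \<or> ?e = {ws ! i, ws ! Suc i}"
      using Suc.prems len IH by (intro edges_at_vertex[OF ws]) auto
    moreover have "us ! Suc (Suc i) \<noteq> us ! i" "us ! Suc (Suc i) \<noteq> us ! Suc i"
      using us Suc.prems by (simp_all add: nth_eq_iff_index_eq)
    moreover have "Suc (Suc i) mod length ws = Suc (Suc i)" using Suc.prems len by simp
    ultimately have "us ! Suc (Suc i) = ws ! Suc (Suc i)"
      using IH by (auto simp: doubleton_eq_iff)
    then show ?case using IH by simp
  qed (use hd in simp)
  fix i assume "i < length us"
  then show "us ! i = ws ! i" using *[of "i - 1"] hd by (cases i) auto
qed

text \<open>The first two vertices run through the arcs of both orientations, which have no arc in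
  common from length 3 on; whence the factor 2.\<close>

lemma card_undirected_fibre:
  assumes vs: "distinct vs" "3 \<le> length vs"
  shows "card {us. distinct us \<and> length us = length vs \<and> edges_of us = edges_of vs} = 2 * length vs"
proof -
  let ?F = "{us. distinct us \<and> length us = length vs \<and> edges_of us = edges_of vs}"
  let ?D = "arcs_of vs \<union> (arcs_of vs)\<inverse>"
  have D: "{u, v} \<in> edges_of vs \<longleftrightarrow> (u, v) \<in> ?D" for u v
    by (auto simp: edges_of_arcs doubleton_eq_iff)
  have "bij_betw (\<lambda>us. (us ! 0, us ! 1)) ?F ?D"
  proof (rule bij_betwI')
    fix us ws assume "us \<in> ?F" "ws \<in> ?F"
    then show "((us ! 0, us ! 1) = (ws ! 0, ws ! 1)) = (us = ws)"
      using vs by (auto intro: edges_of_hd_snd_inject)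
  next
    fix us assume us: "us \<in> ?F"
    then have "{us ! 0, us ! 1} \<in> edges_of us"
      using vs(2) unfolding edges_of_def by (auto intro!: exI[of _ 0])
    then show "(us ! 0, us ! 1) \<in> ?D" using us D by simp
  next
    fix p assume "p \<in> ?D"
    then consider "p \<in> arcs_of vs" | "p \<in> arcs_of (rev vs)"
      by (cases p) (auto dest: converse_arcs_of_rev)
    then obtain ws where ws: "ws \<in> {vs, rev vs}" "p \<in> arcs_of ws" by cases auto
    then have "(fst p, snd p) \<in> arcs_of ws" "2 \<le> length ws" using vs(2) by auto
    from rotate_hd_snd[OF this] obtain i where i: "rotate i ws ! 0 = fst p" "rotate i ws ! 1 = snd p"
      by blast
    have "rotate i ws \<in> ?F"
      using vs ws edges_of_rev[OF vs] by (auto simp: edges_of_eq cyc_edges_rotate)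
    moreover have "p = (rotate i ws ! 0, rotate i ws ! 1)" unfolding i by simp
    ultimately show "\<exists>us\<in>?F. p = (us ! 0, us ! 1)" by (rule rev_bexI)
  qed
  then have "card ?F = card ?D" by (rule bij_betw_same_card)
  also have "\<dots> = card (arcs_of vs) + card ((arcs_of vs)\<inverse>)"
  proof (rule card_Un_disjoint)
    show "arcs_of vs \<inter> (arcs_of vs)\<inverse> = {}"
    proof (rule ccontr)
      assume "arcs_of vs \<inter> (arcs_of vs)\<inverse> \<noteq> {}"
      then obtain u v where "(u, v) \<in> arcs_of vs" "(v, u) \<in> arcs_of vs" by auto
      then obtain i j where ij: "i < length vs" "u = vs ! i" "v = vs ! (Suc i mod length vs)"
          "j < length vs" "v = vs ! j" "u = vs ! (Suc j mod length vs)"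
        by (auto simp: arcs_of_def)
      then have "vs ! j = vs ! (Suc i mod length vs)" "vs ! i = vs ! (Suc j mod length vs)" by simp_all
      then have "j = Suc i mod length vs" "i = Suc j mod length vs"
        using nth_eq_iff_index_eq[OF vs(1) ij(4) Suc_mod_less[OF ij(1)]]
          nth_eq_iff_index_eq[OF vs(1) ij(1) Suc_mod_less[OF ij(4)]] by simp_all
      then show False using Suc_mod_Suc_mod_neq[OF ij(1) vs(2)] by simp
    qed
  qed (simp_all add: arcs_of_eq finite_cyc_edges)
  finally show ?thesis using vs(1) by (simp add: card_arcs_of card_inverse)
qed

section \<open>Overlapping cycles\<close>

text \<open>Choose the support among at most \<open>n ^ v\<close> sets, then each of the
  \<open>l\<close> entries among \<open>v\<close> vertices.\<close>

lemma card_lists_with_support_le: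
  "card {xs. length xs = l \<and> set xs \<subseteq> {..<n} \<and> card (set xs) = v} \<le> n ^ v * v ^ l"
proof -
  let ?Q = "{Q. Q \<subseteq> {..<n} \<and> card Q = v}"
  have finQ: "finite ?Q" by (rule finite_subset[of _ "Pow {..<n}"]) auto
  have fin: "finite Q" if "Q \<in> ?Q" for Q using that finite_subset[of Q "{..<n}"] by auto
  have "{xs. length xs = l \<and> set xs \<subseteq> {..<n} \<and> card (set xs) = v} \<subseteq> (\<Union>Q\<in>?Q. {xs. set xs \<subseteq> Q \<and> length xs = l})"
    by auto
  then have "card {xs. length xs = l \<and> set xs \<subseteq> {..<n} \<and> card (set xs) = v}
      \<le> card (\<Union>Q\<in>?Q. {xs. set xs \<subseteq> Q \<and> length xs = l})"
    by (intro card_mono finite_UN_I finQ finite_lists_length_eq fin)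
  also have "\<dots> \<le> (\<Sum>Q\<in>?Q. card {xs. set xs \<subseteq> Q \<and> length xs = l})"
    by (rule card_UN_le[OF finQ])
  also have "\<dots> = (\<Sum>Q\<in>?Q. v ^ l)"
  proof (intro sum.cong refl)
    fix Q assume Q: "Q \<in> ?Q"
    then show "card {xs. set xs \<subseteq> Q \<and> length xs = l} = v ^ l"
      using card_lists_length_eq[OF fin[OF Q], of l] by simp
  qed
  also have "\<dots> = (n choose v) * v ^ l"
    using n_subsets[of "{..<n}" v] by simp
  also have "n choose v \<le> n ^ v"
    by (cases "v \<le> n") (auto intro: binomial_le_pow simp: binomial_eq_0)
  finally show ?thesis by simp
qed

text \<open>Lists with \<open>v\<close> distinct entries number at most a constant times
  \<open>n ^ v\<close>; the extra factor \<open>1 / n\<close> from \<open>Suc\<close> wins.\<close>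

lemma lists_support_weight_lim:
  "(\<lambda>n. \<Sum>xs\<in>{xs. length xs = l \<and> set xs \<subseteq> {..<n}}. (1 / real n) ^ Suc (card (set xs))) \<longlonglongrightarrow> 0"
proof (rule tendsto_sandwich)
  let ?X = "\<lambda>n::nat. {xs. length xs = l \<and> set xs \<subseteq> {..<n}}"
  let ?f = "\<lambda>n. \<Sum>xs\<in>?X n. (1 / real n) ^ Suc (card (set xs))"
  have fin: "finite (?X n)" for n
  proof -
    have "{xs. length xs = l \<and> set xs \<subseteq> {..<n}} = {xs. set xs \<subseteq> {..<n} \<and> length xs = l}" by auto
    then show ?thesis by (simp only: finite_lists_length_eq finite_lessThan)
  qed
  have le: "card (set xs) \<le> l" if "xs \<in> ?X n" for xs n
    using that card_length[of xs] by auto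
  show "\<forall>\<^sub>F n in sequentially. 0 \<le> ?f n" by (simp add: sum_nonneg)
  show "\<forall>\<^sub>F n in sequentially. ?f n \<le> (\<Sum>v\<le>l. real (v ^ l)) * (1 / real n)"
    using eventually_gt_at_top[of 0]
  proof eventually_elim
    case (elim n)
    have "?f n = (\<Sum>v\<le>l. \<Sum>xs\<in>{xs \<in> ?X n. card (set xs) = v}. (1 / real n) ^ Suc (card (set xs)))"
      using le by (intro sum.group[symmetric] fin) auto
    also have "\<dots> = (\<Sum>v\<le>l. real (card {xs. length xs = l \<and> set xs \<subseteq> {..<n} \<and> card (set xs) = v}) * (1 / real n) ^ Suc v)"
      by (intro sum.cong refl) (simp add: conj_assoc)
    also have "\<dots> \<le> (\<Sum>v\<le>l. real (n ^ v * v ^ l) * (1 / real n) ^ Suc v)"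
      by (intro sum_mono mult_right_mono of_nat_mono card_lists_with_support_le) auto
    also have "\<dots> = (\<Sum>v\<le>l. real (v ^ l) * (1 / real n))"
      using elim by (intro sum.cong refl) (simp add: power_divide)
    finally show ?case by (simp only: sum_distrib_right)
  qed
  show "(\<lambda>n. (\<Sum>v\<le>l. real (v ^ l)) * (1 / real n)) \<longlonglongrightarrow> 0"
    by (rule tendsto_mult_right_zero) (rule lim_const_over_n)
qed simp

lemma card_distinct_lists_le:
  "card {vs. distinct vs \<and> length vs = j \<and> set vs \<subseteq> {..<n}} \<le> n ^ j"
proof -
  have "card {vs. distinct vs \<and> length vs = j \<and> set vs \<subseteq> {..<n}} \<le> card {vs. set vs \<subseteq> {..<n} \<and> length vs = j}"
    by (intro card_mono finite_lists_length_eq) auto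
  then show ?thesis by (simp add: card_lists_length_eq)
qed

text \<open>The falling factorial lies between \<open>(n - j) ^ j\<close> and
  \<open>n ^ j\<close>.\<close>

lemma card_distinct_lists_lim:
  "(\<lambda>n. real (card {vs. distinct vs \<and> length vs = j \<and> set vs \<subseteq> {..<n}}) / real n ^ j) \<longlonglongrightarrow> 1"
proof (rule tendsto_sandwich)
  let ?c = "\<lambda>n::nat. real (card {vs. distinct vs \<and> length vs = j \<and> set vs \<subseteq> {..<n}})"
  show "\<forall>\<^sub>F n in sequentially. (1 - real j / real n) ^ j \<le> ?c n / real n ^ j"
    using eventually_gt_at_top[of j]
  proof eventually_elim
    case (elim n)
    have "card {vs. length vs = j \<and> distinct vs \<and> set vs \<subseteq> {..<n}} = \<Prod>{n - j + 1..n}"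
      using elim by (subst card_lists_distinct_length_eq) auto
    then have c: "?c n = (\<Prod>i\<in>{n - j + 1..n}. real i)"
      by (simp add: conj_ac of_nat_prod)
    have "(real n - real j) ^ j = (\<Prod>i\<in>{n - j + 1..n}. real n - real j)" using elim by simp
    also have "\<dots> \<le> (\<Prod>i\<in>{n - j + 1..n}. real i)"
      using elim by (intro prod_mono) auto
    finally have "(real n - real j) ^ j / real n ^ j \<le> ?c n / real n ^ j"
      unfolding c by (rule divide_right_mono) simp
    moreover have "(1 - real j / real n) ^ j = (real n - real j) ^ j / real n ^ j"
      using elim by (simp add: power_divide[symmetric] diff_divide_distrib)
    ultimately show ?case by simp
  qed
  show "\<forall>\<^sub>F n in sequentially. ?c n / real n ^ j \<le> 1"
    using eventually_gt_at_top[of 0]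
  proof eventually_elim
    case (elim n)
    have "?c n \<le> real (n ^ j)" by (intro of_nat_mono card_distinct_lists_le)
    then show ?case using elim by (simp add: divide_le_eq)
  qed
  have "(\<lambda>n. (1 - real j / real n) ^ j) \<longlonglongrightarrow> (1 - 0) ^ j"
    by (intro tendsto_intros lim_const_over_n)
  then show "(\<lambda>n. (1 - real j / real n) ^ j) \<longlonglongrightarrow> 1" by simp
qed simp

text \<open>\<open>m\<close> is the number of orientations: a cycle of length \<open>k\<close> comes from \<open>m k\<close> vertex lists.\<close>

locale cycle_shape =
  fixes \<phi> :: "nat \<Rightarrow> nat \<Rightarrow> 'e" and ends :: "'e \<Rightarrow> nat set" and L m :: nat
  assumes ends: "ends (\<phi> u v) = {u, v}"
    and L: "1 \<le> L" and m: "1 \<le> m"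
    and card_cyc: "distinct vs \<Longrightarrow> L \<le> length vs \<Longrightarrow> card (cyc_edges \<phi> vs) = length vs"
    and subset_imp_eq: "distinct vs \<Longrightarrow> L \<le> length vs \<Longrightarrow> distinct us \<Longrightarrow> L \<le> length us \<Longrightarrow>
      cyc_edges \<phi> us \<subseteq> cyc_edges \<phi> vs \<Longrightarrow> cyc_edges \<phi> us = cyc_edges \<phi> vs"
    and card_fibre: "distinct vs \<Longrightarrow> L \<le> length vs \<Longrightarrow>
      card {us. distinct us \<and> length us = length vs \<and> cyc_edges \<phi> us = cyc_edges \<phi> vs} = m * length vs"
begin

definition cycles :: "nat \<Rightarrow> 'e set set" where
  "cycles n = {cyc_edges \<phi> vs | vs. distinct vs \<and> set vs \<subseteq> {..<n} \<and> L \<le> length vs}"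

lemma Union_ends: "(\<Union>e\<in>cyc_edges \<phi> vs. ends e) = set vs"
proof -
  have "(\<Union>e\<in>cyc_edges \<phi> vs. ends e) = (\<Union>i<length vs. {vs ! i, vs ! (Suc i mod length vs)})"
    by (simp add: cyc_edges_def ends)
  also have "\<dots> = set vs"
  proof (intro equalityI subsetI)
    fix x assume "x \<in> (\<Union>i<length vs. {vs ! i, vs ! (Suc i mod length vs)})"
    then show "x \<in> set vs" using Suc_mod_less by fastforce
  qed (auto simp: in_set_conv_nth)
  finally show ?thesis .
qed

lemma set_eq_of_cyc_edges_eq: "cyc_edges \<phi> us = cyc_edges \<phi> vs \<Longrightarrow> set us = set vs"
  using Union_ends[of us] Union_ends[of vs] by simp

text \<open>Every vertex of \<open>us\<close> outside \<open>vs\<close> has an outgoing edge outside the cycle of \<open>vs\<close>, and one more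
  such edge leaves a common vertex, for otherwise the cycle of \<open>us\<close> would never leave that of \<open>vs\<close>.\<close>

lemma card_Un_cyc_edges:
  assumes vs: "distinct vs" "L \<le> length vs" and us: "distinct us" "L \<le> length us"
    and neq: "cyc_edges \<phi> us \<noteq> cyc_edges \<phi> vs" and meet: "cyc_edges \<phi> us \<inter> cyc_edges \<phi> vs \<noteq> {}"
  shows "Suc (card (set us \<union> set vs)) \<le> card (cyc_edges \<phi> us \<union> cyc_edges \<phi> vs)"
proof -
  let ?k = "length us" and ?C = "cyc_edges \<phi> vs"
  define e where "e i = \<phi> (us ! i) (us ! (Suc i mod ?k))" for i
  have us_eq: "cyc_edges \<phi> us = e ` {..<?k}" by (simp add: cyc_edges_def e_def)
  have inj: "inj_on e {..<?k}"
    using card_cyc[OF us] by (intro eq_card_imp_inj_on) (simp_all add: us_eq)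
  have ends_e: "ends (e i) = {us ! i, us ! (Suc i mod ?k)}" for i by (simp add: e_def ends)
  have in_C: "us ! i \<in> set vs \<and> us ! (Suc i mod ?k) \<in> set vs" if "e i \<in> ?C" for i
    using that Union_ends[of vs] ends_e[of i] by blast
  define I where "I = {i. i < ?k \<and> us ! i \<notin> set vs}"
  have "\<exists>i0<?k. us ! i0 \<in> set vs \<and> e i0 \<notin> ?C"
  proof (rule ccontr)
    assume "\<not> ?thesis"
    then have stay: "e i \<in> ?C" if "i < ?k" "us ! i \<in> set vs" for i using that by blast
    obtain i1 where i1: "i1 < ?k" "e i1 \<in> ?C" using meet us_eq by auto
    have "us ! i \<in> set vs" if "i < ?k" for i
      by (rule Suc_mod_induct[where P = "\<lambda>i. us ! i \<in> set vs" and i = i1 and k = ?k])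
        (use i1 in_C stay that in auto)
    then have "cyc_edges \<phi> us \<subseteq> ?C" unfolding us_eq using stay by auto
    then show False using subset_imp_eq[OF vs us] neq by blast
  qed
  then obtain i0 where i0: "i0 < ?k" "us ! i0 \<in> set vs" "e i0 \<notin> ?C" by blast
  have "set us - set vs = (!) us ` I" by (auto simp: I_def in_set_conv_nth)
  moreover have "inj_on ((!) us) I" using us(1) by (auto simp: inj_on_def I_def nth_eq_iff_index_eq)
  ultimately have cardI: "card (set us - set vs) = card I" by (simp add: card_image)
  have finI: "finite I" by (simp add: I_def)
  have "Suc (card I) = card (insert i0 I)" using i0 finI by (simp add: I_def)
  also have "\<dots> = card (e ` insert i0 I)"
    using i0 by (intro card_image[symmetric] inj_on_subset[OF inj]) (auto simp: I_def)
  also have "\<dots> \<le> card (cyc_edges \<phi> us - ?C)"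
  proof (rule card_mono)
    show "e ` insert i0 I \<subseteq> cyc_edges \<phi> us - ?C"
      unfolding us_eq using i0 in_C by (auto simp: I_def)
  qed (simp add: finite_cyc_edges)
  finally have "Suc (card (set us - set vs)) \<le> card (cyc_edges \<phi> us - ?C)" by (simp add: cardI)
  moreover have "card (cyc_edges \<phi> us \<union> ?C) = card (cyc_edges \<phi> us - ?C) + card ?C"
    using card_Un_disjoint[of "cyc_edges \<phi> us - ?C" ?C] by (simp add: finite_cyc_edges Int_commute)
  moreover have "card (set us \<union> set vs) = card (set us - set vs) + card (set vs)"
    using card_Un_disjoint[of "set us - set vs" "set vs"] by (simp add: Int_commute)
  moreover have "card ?C = card (set vs)" using vs by (simp add: card_cyc distinct_card)
  ultimately show ?thesis by linarith
qed

lemma finite_cycles: "finite (cycles n)"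
proof (rule finite_surj)
  show "finite {vs. distinct vs \<and> set vs \<subseteq> {..<n}}"
    using finite_subset_distinct[of "{..<n}"] by (simp add: conj_commute)
  show "cycles n \<subseteq> cyc_edges \<phi> ` {vs. distinct vs \<and> set vs \<subseteq> {..<n}}"
    by (auto simp: cycles_def)
qed

lemma cycles_of_length:
  assumes "L \<le> j"
  shows "{C \<in> cycles n. card C = j} = cyc_edges \<phi> ` {vs. distinct vs \<and> length vs = j \<and> set vs \<subseteq> {..<n}}"
  using assms by (auto simp: cycles_def card_cyc)

text \<open>Double counting with fibres of size \<open>m * j\<close>. The edges determine the vertex
  set, so a whole fibre stays inside \<open>{..<n}\<close>.\<close>

lemma count_cycles:
  assumes j: "L \<le> j"
  shows "card {vs. distinct vs \<and> length vs = j \<and> set vs \<subseteq> {..<n}} = m * j * card {C \<in> cycles n. card C = j}"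
proof -
  let ?V = "{vs. distinct vs \<and> length vs = j \<and> set vs \<subseteq> {..<n}}"
  have finV: "finite ?V"
    by (rule finite_subset[OF _ finite_lists_length_eq[of "{..<n}" j]]) auto
  have "card ?V = (\<Sum>vs\<in>?V. 1)" by simp
  also have "\<dots> = (\<Sum>C\<in>{C \<in> cycles n. card C = j}. \<Sum>us\<in>{us \<in> ?V. cyc_edges \<phi> us = C}. 1)"
  proof (rule sum.group[symmetric, OF finV])
    show "finite {C \<in> cycles n. card C = j}" using finite_cycles[of n] by simp
    show "cyc_edges \<phi> ` ?V \<subseteq> {C \<in> cycles n. card C = j}" unfolding cycles_of_length[OF j] ..
  qed
  also have "\<dots> = (\<Sum>C\<in>{C \<in> cycles n. card C = j}. m * j)"
  proof (intro sum.cong refl)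
    fix C assume "C \<in> {C \<in> cycles n. card C = j}"
    then obtain vs where vs: "distinct vs" "length vs = j" "set vs \<subseteq> {..<n}" "C = cyc_edges \<phi> vs"
      unfolding cycles_of_length[OF j] by auto
    have "{us \<in> ?V. cyc_edges \<phi> us = C} = {us. distinct us \<and> length us = length vs \<and> cyc_edges \<phi> us = cyc_edges \<phi> vs}"
    proof (intro equalityI subsetI)
      fix us assume "us \<in> {us. distinct us \<and> length us = length vs \<and> cyc_edges \<phi> us = cyc_edges \<phi> vs}"
      then show "us \<in> {us \<in> ?V. cyc_edges \<phi> us = C}"
        using vs set_eq_of_cyc_edges_eq[of us vs] by simp
    qed (use vs in simp)
    then have "card {us \<in> ?V. cyc_edges \<phi> us = C} = m * j"
      using card_fibre[OF vs(1)] vs(2) j by simp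
    then show "(\<Sum>us\<in>{us \<in> ?V. cyc_edges \<phi> us = C}. 1) = m * j" by (simp only: card_eq_sum)
  qed
  finally show ?thesis by simp
qed

text \<open>A pair is encoded by concatenating one chosen vertex list for each cycle; the known
  length \<open>j\<close> of the first makes this injective. The surplus edge of
  \<open>card_Un_cyc_edges\<close> becomes the \<open>Suc\<close> in the exponent.\<close>

lemma overlap_sum_le:
  assumes "L \<le> j" "L \<le> k"
  shows "(\<Sum>(C, C')\<in>{(C, C'). C \<in> cycles n \<and> C' \<in> cycles n \<and> card C = j \<and> card C' = k \<and> C \<noteq> C' \<and> C \<inter> C' \<noteq> {}}.
        (1 / real n) ^ card (C \<union> C')) \<le> (\<Sum>xs\<in>{xs. length xs = j + k \<and> set xs \<subseteq> {..<n}}. (1 / real n) ^ Suc (card (set xs)))"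
proof -
  let ?P = "{(C, C'). C \<in> cycles n \<and> C' \<in> cycles n \<and> card C = j \<and> card C' = k \<and> C \<noteq> C' \<and> C \<inter> C' \<noteq> {}}"
  let ?X = "{xs. length xs = j + k \<and> set xs \<subseteq> {..<n}}"
  define r where "r C = (SOME vs. distinct vs \<and> set vs \<subseteq> {..<n} \<and> L \<le> length vs \<and> cyc_edges \<phi> vs = C)" for C
  have r: "distinct (r C) \<and> set (r C) \<subseteq> {..<n} \<and> L \<le> length (r C) \<and> cyc_edges \<phi> (r C) = C" if "C \<in> cycles n" for C
    unfolding r_def by (rule someI_ex) (use that in \<open>auto simp: cycles_def\<close>)
  have len: "length (r C) = card C" if "C \<in> cycles n" for C
    using r[OF that] card_cyc[of "r C"] by auto
  define h where "h = (\<lambda>(C, C'). r C @ r C')"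
  have fin: "finite ?X"
  proof -
    have "{xs. length xs = j + k \<and> set xs \<subseteq> {..<n}} = {xs. set xs \<subseteq> {..<n} \<and> length xs = j + k}" by auto
    then show ?thesis by (simp only: finite_lists_length_eq finite_lessThan)
  qed
  \<comment> \<open>Lowering the exponent needs \<open>1 / n \<le> 1\<close>; the mere existence of
    a cycle makes \<open>n\<close> positive.\<close>
  have n: "real n \<ge> 1" if "p \<in> ?P" for p
  proof -
    obtain C C' where "C \<in> cycles n" "p = (C, C')" using \<open>p \<in> ?P\<close> by auto
    then have "r C \<noteq> []" "set (r C) \<subseteq> {..<n}" using r[of C] L by auto
    then have "hd (r C) < n" by (auto dest: hd_in_set)
    then show ?thesis by simp
  qed
  have "(\<Sum>(C, C')\<in>?P. (1 / real n) ^ card (C \<union> C')) \<le> (\<Sum>p\<in>?P. (1 / real n) ^ Suc (card (set (h p))))"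
  proof (rule sum_mono)
    fix p assume p: "p \<in> ?P"
    then obtain C C' where C: "p = (C, C')" "C \<in> cycles n" "C' \<in> cycles n" "C \<noteq> C'" "C \<inter> C' \<noteq> {}" by auto
    have "Suc (card (set (r C) \<union> set (r C'))) \<le> card (C \<union> C')"
      using card_Un_cyc_edges[of "r C'" "r C"] r[OF C(2)] r[OF C(3)] C(4,5) by auto
    then have "(1 / real n) ^ card (C \<union> C') \<le> (1 / real n) ^ Suc (card (set (r C) \<union> set (r C')))"
      using n[OF p] by (intro power_decreasing) auto
    then show "(case p of (C, C') \<Rightarrow> (1 / real n) ^ card (C \<union> C')) \<le> (1 / real n) ^ Suc (card (set (h p)))"
      using C(1) by (simp add: h_def)
  qed
  also have "\<dots> = (\<Sum>xs\<in>h ` ?P. (1 / real n) ^ Suc (card (set xs)))"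
  proof (rule sum.reindex[symmetric, unfolded o_def])
    show "inj_on h ?P"
    proof (rule inj_onI)
      fix p q assume p: "p \<in> ?P" and q: "q \<in> ?P" and eq: "h p = h q"
      obtain C C' where C: "p = (C, C')" "C \<in> cycles n" "C' \<in> cycles n" "card C = j" using p by auto
      obtain D D' where D: "q = (D, D')" "D \<in> cycles n" "D' \<in> cycles n" "card D = j" using q by auto
      have "r C = r D \<and> r C' = r D'"
        using eq len[OF C(2)] len[OF D(2)] C D by (simp add: h_def)
      then show "p = q" using r[OF C(2)] r[OF C(3)] r[OF D(2)] r[OF D(3)] C(1) D(1) by metis
    qed
  qed
  also have "\<dots> \<le> (\<Sum>xs\<in>?X. (1 / real n) ^ Suc (card (set xs)))"
  proof (rule sum_mono2[OF fin])
    show "h ` ?P \<subseteq> ?X"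
    proof
      fix xs assume "xs \<in> h ` ?P"
      then obtain C C' where C: "xs = r C @ r C'" "C \<in> cycles n" "C' \<in> cycles n" "card C = j" "card C' = k"
        by (auto simp: h_def)
      then show "xs \<in> ?X" using r[OF C(2)] r[OF C(3)] len[OF C(2)] len[OF C(3)] by simp
    qed
  qed auto
  finally show ?thesis .
qed

lemma cycle_model:
  assumes E: "\<And>n. finite (E n)" "\<And>n. cycles n \<subseteq> Pow (E n)"
  shows "cycle_model E cycles (1 / real m) L"
proof
  fix n j k
  show "finite (E n)" "cycles n \<subseteq> Pow (E n)" by (rule E)+
  show "0 < 1 / real m" "1 \<le> L" using m L by auto
  show "L \<le> card C" if "C \<in> cycles n" for C
    using that by (auto simp: cycles_def card_cyc)
  have count: "real (card {C \<in> cycles n. card C = j}) =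
      1 / real m / real j * real (card {vs. distinct vs \<and> length vs = j \<and> set vs \<subseteq> {..<n}})" if "L \<le> j" for n j
    using that L m by (simp add: count_cycles)
  show "real (card {C \<in> cycles n. card C = j}) \<le> 1 / real m / real j * real n ^ j" if "L \<le> j"
    unfolding count[OF that] using card_distinct_lists_le[of j n]
    by (intro mult_left_mono) (simp_all flip: of_nat_power)
  show "(\<lambda>n. real (card {C \<in> cycles n. card C = j}) / real n ^ j) \<longlonglongrightarrow> 1 / real m / real j" if "L \<le> j"
    unfolding count[OF that] times_divide_eq_right[symmetric]
    using tendsto_mult[OF tendsto_const card_distinct_lists_lim[of j], of "1 / real m / real j"] by simp
  show "(\<lambda>n. \<Sum>(C, C')\<in>{(C, C'). C \<in> cycles n \<and> C' \<in> cycles n \<and> card C = j \<and> card C' = k \<and> C \<noteq> C' \<and> C \<inter> C' \<noteq> {}}.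
        (1 / real n) ^ card (C \<union> C')) \<longlonglongrightarrow> 0" if "L \<le> j" "L \<le> k"
  proof (rule tendsto_sandwich[OF _ _ tendsto_const lists_support_weight_lim[of "j + k"]])
    show "\<forall>\<^sub>F n in sequentially. 0 \<le> (\<Sum>(C, C')\<in>{(C, C'). C \<in> cycles n \<and> C' \<in> cycles n \<and> card C = j \<and> card C' = k \<and> C \<noteq> C' \<and> C \<inter> C' \<noteq> {}}.
        (1 / real n) ^ card (C \<union> C'))"
      by (intro always_eventually allI sum_nonneg) auto
  qed (intro always_eventually allI overlap_sum_le that)
qed

end

section \<open>The directed and the undirected instance\<close>

lemma finite_directed_arcs: "finite (directed_arcs n)"
  by (rule finite_subset[of _ "{..<n} \<times> {..<n}"]) (auto simp: directed_arcs_def)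

lemma finite_undirected_edges: "finite (undirected_edges n)"
  by (rule finite_subset[of _ "Pow {..<n}"]) (auto simp: undirected_edges_def)

interpretation directed_shape: cycle_shape Pair "\<lambda>(u, v). {u, v}" 2 1
proof (unfold_locales, goal_cases)
  case (4 vs)
  then show ?case using card_arcs_of[of vs] by (simp add: arcs_of_eq)
next
  case (5 vs us)
  then show ?case using arcs_of_subset_imp_eq[of vs us] by (simp add: arcs_of_eq flip: length_greater_0_conv)
next
  case (6 vs)
  then show ?case using card_directed_fibre[of vs] by (simp add: arcs_of_eq)
qed simp_all

interpretation undirected_shape: cycle_shape "\<lambda>u v. {u, v}" "\<lambda>e. e" 3 2
proof (unfold_locales, goal_cases)
  case (4 vs)
  then show ?case using card_edges_of[of vs] by (simp add: edges_of_eq)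
next
  case (5 vs us)
  then show ?case using edges_of_subset_imp_eq[of vs us] by (simp add: edges_of_eq)
next
  case (6 vs)
  then show ?case using card_undirected_fibre[of vs] by (simp add: edges_of_eq)
qed simp_all

lemma directed_cycles_eq: "directed_cycles = directed_shape.cycles"
  by (simp add: fun_eq_iff directed_cycles_def directed_shape.cycles_def arcs_of_eq)

lemma undirected_cycles_eq: "undirected_cycles = undirected_shape.cycles"
  by (simp add: fun_eq_iff undirected_cycles_def undirected_shape.cycles_def edges_of_eq)

lemma consecutive_vertices:
  assumes vs: "distinct vs" "2 \<le> length vs" "set vs \<subseteq> {..<n}" and i: "i < length vs"
  shows "vs ! i < n" "vs ! (Suc i mod length vs) < n" "vs ! i \<noteq> vs ! (Suc i mod length vs)"
proof -
  have j: "Suc i mod length vs < length vs" by (rule Suc_mod_less[OF i])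
  show "vs ! i < n" "vs ! (Suc i mod length vs) < n" using vs(3) nth_mem[OF i] nth_mem[OF j] by auto
  have "Suc i mod length vs \<noteq> i" using i vs(2) by (cases "Suc i = length vs") auto
  then show "vs ! i \<noteq> vs ! (Suc i mod length vs)" using nth_eq_iff_index_eq[OF vs(1) i j] by simp
qed

lemma directed_cycles_subset: "directed_cycles n \<subseteq> Pow (directed_arcs n)"
proof
  fix C assume "C \<in> directed_cycles n"
  then obtain vs where vs: "distinct vs" "set vs \<subseteq> {..<n}" "2 \<le> length vs" "C = arcs_of vs"
    by (auto simp: directed_cycles_def)
  have "e \<in> directed_arcs n" if e: "e \<in> C" for e
  proof -
    obtain i where i: "i < length vs" "e = (vs ! i, vs ! (Suc i mod length vs))"
      using e unfolding vs(4) arcs_of_def by blast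
    then show ?thesis
      using consecutive_vertices[OF vs(1,3,2) i(1)] unfolding directed_arcs_def by auto
  qed
  then show "C \<in> Pow (directed_arcs n)" by blast
qed

lemma undirected_cycles_subset: "undirected_cycles n \<subseteq> Pow (undirected_edges n)"
proof
  fix C assume "C \<in> undirected_cycles n"
  then obtain vs where vs: "distinct vs" "set vs \<subseteq> {..<n}" "3 \<le> length vs" "C = edges_of vs"
    by (auto simp: undirected_cycles_def)
  have "e \<in> undirected_edges n" if e: "e \<in> C" for e
  proof -
    obtain i where i: "i < length vs" "e = {vs ! i, vs ! (Suc i mod length vs)}"
      using e unfolding vs(4) edges_of_def by blast
    then show ?thesis
      using consecutive_vertices[OF vs(1) _ vs(2) i(1)] vs(3) unfolding undirected_edges_def
      by (intro CollectI exI[of _ "vs ! i"] exI[of _ "vs ! (Suc i mod length vs)"]) simp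
  qed
  then show "C \<in> Pow (undirected_edges n)" by blast
qed

lemma directed_cycle_model: "cycle_model directed_arcs directed_cycles 1 2"
proof -
  have "directed_shape.cycles n \<subseteq> Pow (directed_arcs n)" for n
    using directed_cycles_subset[of n] by (simp only: directed_cycles_eq)
  from directed_shape.cycle_model[of directed_arcs, OF finite_directed_arcs this]
  show ?thesis unfolding directed_cycles_eq by simp
qed

lemma undirected_cycle_model: "cycle_model undirected_edges undirected_cycles (1 / 2) 3"
proof -
  have "undirected_shape.cycles n \<subseteq> Pow (undirected_edges n)" for n
    using undirected_cycles_subset[of n] by (simp only: undirected_cycles_eq)
  from undirected_shape.cycle_model[of undirected_edges, OF finite_undirected_edges this]
  show ?thesis unfolding undirected_cycles_eq by simp
qed

section \<open>The complete graphs\<close>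

lemma tree_fun_suminf_shift:
  assumes "t \<in> {0..1 / exp 1}"
  shows "(\<lambda>j. tree_term (j + m) t) sums (tree_fun t - (\<Sum>j<m. tree_term j t))"
  using sums_split_initial_segment[OF tree_fun_sums] assms by simp

interpretation directed: cycle_model directed_arcs directed_cycles 1 2
  by (rule directed_cycle_model)

interpretation undirected: cycle_model undirected_edges undirected_cycles "1 / 2" 3
  by (rule undirected_cycle_model)

lemma directed_LamInf:
  assumes "t \<in> {0..1 / exp 1}"
  shows "directed.LamInf t = tree_fun t - t"
proof -
  have "(\<Sum>j<2. tree_term j t) = t" by (simp add: numeral_2_eq_2 tree_term_def)
  then show ?thesis
    using tree_fun_suminf_shift[OF assms, of 2] by (simp add: directed.LamInf_def directed.lam_def sums_iff)
qed

text \<open>The indices 1 and 2 of the tree series, which give \<open>t\<close> and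
  \<open>t^2\<close>, are not lengths of undirected cycles; the division by 2 is
  \<open>\<kappa>\<close>.\<close>

lemma undirected_LamInf:
  assumes "t \<in> {0..1 / exp 1}"
  shows "undirected.LamInf t = (tree_fun t - t - t\<^sup>2) / 2"
proof -
  have "(\<Sum>j<3. tree_term j t) = t + t\<^sup>2" by (simp add: numeral_3_eq_3 tree_term_def power2_eq_square)
  then have "(\<lambda>j. tree_term (j + 3) t) sums (tree_fun t - (t + t\<^sup>2))"
    using tree_fun_suminf_shift[OF assms, of 3] by simp
  from sums_divide[OF this, of 2] show ?thesis
    by (simp add: undirected.LamInf_def undirected.lam_def sums_iff)
qed

text \<open>Replaces the quotient of the final formula by a continuous integrand, for which the
  Lebesgue and the gauge integral agree.\<close>

lemma set_lebesgue_integral_eq_integral: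
  fixes f g :: "real \<Rightarrow> real"
  assumes "continuous_on {a..b} g" "\<And>x. x \<in> {a..b} \<Longrightarrow> f x = g x"
  shows "(LBINT x:{a..b}. f x) = integral {a..b} g"
proof -
  have "(LBINT x:{a..b}. f x) = (LBINT x:{a..b}. g x)"
    by (intro set_lebesgue_integral_cong) (use assms(2) in auto)
  also have "\<dots> = integral {a..b} g"
    by (intro set_borel_integral_eq_integral borel_integrable_atLeastAtMost' assms(1))
  finally show ?thesis .
qed

lemma directed_limit_prob:
  assumes k: "2 \<le> k"
  shows "directed.limit_prob k = real k ^ k / fact k * (LBINT c:{0..1 / exp 1}. c ^ k * exp c / tree_fun c)"
proof -
  let ?g = "\<lambda>c. c ^ (k - 1) * exp (- directed.LamInf c)"
  have "(LBINT c:{0..1 / exp 1}. c ^ k * exp c / tree_fun c) = integral {0..1 / exp 1} ?g"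
  proof (rule set_lebesgue_integral_eq_integral)
    show "continuous_on {0..1 / exp 1} ?g"
      by (intro continuous_intros directed.continuous_on_LamInf)
    fix c :: real assume c: "c \<in> {0..1 / exp 1}"
    show "c ^ k * exp c / tree_fun c = ?g c"
    proof (cases "c = 0")
      \<comment> \<open>At 0 both sides vanish, as \<open>k \<ge> 2\<close> leaves a positive power
        of \<open>c\<close> in \<open>?g\<close>.\<close>
      case True
      then show ?thesis using k by (simp add: power_0_left)
    next
      case False
      then have c': "c \<in> {0<..1 / exp 1}" using c by auto
      have "exp (- directed.LamInf c) = exp c * exp (- tree_fun c)"
        unfolding directed_LamInf[OF c] by (simp flip: exp_add)
      then have "?g c = (c ^ (k - 1) * c) * exp c / tree_fun c"
        unfolding exp_minus_tree_fun(1)[OF c'] by simp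
      also have "c ^ (k - 1) * c = c ^ k" using k by (simp add: power_eq_if[of c k] mult.commute)
      finally show ?thesis by simp
    qed
  qed
  moreover have "directed.limit_prob k = real k ^ k / fact k * integral {0..1 / exp 1} ?g"
    unfolding directed.limit_prob_def directed.lam'_def tree_term_deriv_def
    by (subst integral_mult_right[symmetric]) (simp add: mult_ac)
  ultimately show ?thesis by simp
qed

lemma undirected_limit_prob:
  assumes k: "3 \<le> k"
  shows "undirected.limit_prob k = real k ^ k / (2 * fact k) *
    (LBINT c:{0..1 / exp 1}. c powr (real k - 1 / 2) * exp (c / 2 + c\<^sup>2 / 2) / sqrt (tree_fun c))"
proof -
  let ?g = "\<lambda>c. c ^ (k - 1) * exp (- undirected.LamInf c)"
  have "(LBINT c:{0..1 / exp 1}. c powr (real k - 1 / 2) * exp (c / 2 + c\<^sup>2 / 2) / sqrt (tree_fun c))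
      = integral {0..1 / exp 1} ?g"
  proof (rule set_lebesgue_integral_eq_integral)
    show "continuous_on {0..1 / exp 1} ?g"
      by (intro continuous_intros undirected.continuous_on_LamInf)
    fix c :: real assume c: "c \<in> {0..1 / exp 1}"
    show "c powr (real k - 1 / 2) * exp (c / 2 + c\<^sup>2 / 2) / sqrt (tree_fun c) = ?g c"
    proof (cases "c = 0")
      case True
      then show ?thesis using k by (simp add: power_0_left)
    next
      case False
      then have c': "c \<in> {0<..1 / exp 1}" and pos: "0 < c" using c by auto
      \<comment> \<open>The factor 1/2 of \<open>LamInf\<close> turns \<open>c / T\<close> into its
        square root, the source of the half-integral power of \<open>c\<close>.\<close>
      have "exp (- tree_fun c / 2) = sqrt (exp (- tree_fun c))"
        by (intro real_sqrt_unique[symmetric]) (simp_all flip: exp_of_nat_mult)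
      also have "\<dots> = sqrt c / sqrt (tree_fun c)"
        unfolding exp_minus_tree_fun(1)[OF c'] by (rule real_sqrt_divide)
      finally have half: "exp (- tree_fun c / 2) = sqrt c / sqrt (tree_fun c)" .
      have "- undirected.LamInf c = (c / 2 + c\<^sup>2 / 2) + - tree_fun c / 2"
        unfolding undirected_LamInf[OF c] by (simp add: field_simps)
      then have "exp (- undirected.LamInf c) = exp (c / 2 + c\<^sup>2 / 2) * exp (- tree_fun c / 2)"
        by (simp only: exp_add)
      then have "?g c = (c ^ (k - 1) * sqrt c) * exp (c / 2 + c\<^sup>2 / 2) / sqrt (tree_fun c)"
        unfolding half by simp
      also have "c ^ (k - 1) * sqrt c = c powr (real (k - 1) + 1 / 2)"
        using pos by (simp only: powr_add powr_realpow powr_half_sqrt less_imp_le)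
      also have "real (k - 1) + 1 / 2 = real k - 1 / 2" using k by simp
      finally show ?thesis by simp
    qed
  qed
  moreover have "undirected.limit_prob k = real k ^ k / (2 * fact k) * integral {0..1 / exp 1} ?g"
    unfolding undirected.limit_prob_def undirected.lam'_def tree_term_deriv_def
    by (subst integral_mult_right[symmetric]) (simp add: mult_ac)
  ultimately show ?thesis by simp
qed

lemma directed_prob_lim: "2 \<le> k \<Longrightarrow> (\<lambda>n. directed_prob n k) \<longlonglongrightarrow> directed.limit_prob k"
  unfolding directed_prob_def by (rule directed.min_mean_length_prob_lim)

lemma undirected_prob_lim: "3 \<le> k \<Longrightarrow> (\<lambda>n. undirected_prob n k) \<longlonglongrightarrow> undirected.limit_prob k"
  unfolding undirected_prob_def by (rule undirected.min_mean_length_prob_lim)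

lemma directed_p_eq: "2 \<le> k \<Longrightarrow> directed_p k = directed.limit_prob k"
  unfolding directed_p_def by (rule limI[OF directed_prob_lim])

lemma undirected_p_eq: "3 \<le> k \<Longrightarrow> undirected_p k = undirected.limit_prob k"
  unfolding undirected_p_def by (rule limI[OF undirected_prob_lim])

lemma directed_LamInf_inv_e: "- directed.LamInf (1 / exp 1) = - 1 + 1 / exp 1"
  by (subst directed_LamInf) (simp_all add: tree_fun_inv_e)

lemma undirected_LamInf_inv_e:
  "- undirected.LamInf (1 / exp 1) = - 1 / 2 + 1 / (2 * exp 1) + 1 / (2 * (exp 1)\<^sup>2)"
  by (subst undirected_LamInf) (simp_all add: tree_fun_inv_e power_divide diff_divide_distrib)

theorem mainTheorem6:
  "(\<forall>k\<ge>2. convergent (\<lambda>n. directed_prob n k) \<and>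
      directed_p k = real k ^ k / fact k *
        (LBINT c:{0..1 / exp 1}. c ^ k * exp c / tree_fun c)) \<and>
   directed_p \<sim>[at_top]
     (\<lambda>k. exp (- 1 + 1 / exp 1) / sqrt (2 * pi) * real k powr (- 3 / 2)) \<and>
   (directed_p has_sum (1 - exp (- 1 + 1 / exp 1))) {2..} \<and>
   1 - exp (- 1 + 1 / exp 1) < (1 :: real) \<and>
   (\<forall>k\<ge>3. convergent (\<lambda>n. undirected_prob n k) \<and>
      undirected_p k = real k ^ k / (2 * fact k) *
        (LBINT c:{0..1 / exp 1}.
           c powr (real k - 1 / 2) * exp (c / 2 + c\<^sup>2 / 2) / sqrt (tree_fun c))) \<and>
   undirected_p \<sim>[at_top]
     (\<lambda>k. exp (- 1 / 2 + 1 / (2 * exp 1) + 1 / (2 * (exp 1)\<^sup>2)) / (2 * sqrt (2 * pi)) *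
          real k powr (- 3 / 2)) \<and>
   (undirected_p has_sum (1 - exp (- 1 / 2 + 1 / (2 * exp 1) + 1 / (2 * (exp 1)\<^sup>2)))) {3..} \<and>
   1 - exp (- 1 / 2 + 1 / (2 * exp 1) + 1 / (2 * (exp 1)\<^sup>2)) < (1 :: real)"
proof (intro conjI allI impI)
  show "convergent (\<lambda>n. directed_prob n k)" if "2 \<le> k" for k
    using directed_prob_lim[OF that] by (rule convergentI)
  show "convergent (\<lambda>n. undirected_prob n k)" if "3 \<le> k" for k
    using undirected_prob_lim[OF that] by (rule convergentI)
  show "directed_p k = real k ^ k / fact k * (LBINT c:{0..1 / exp 1}. c ^ k * exp c / tree_fun c)"
    if "2 \<le> k" for k
    using directed_p_eq[OF that] directed_limit_prob[OF that] by simp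
  show "undirected_p k = real k ^ k / (2 * fact k) *
      (LBINT c:{0..1 / exp 1}. c powr (real k - 1 / 2) * exp (c / 2 + c\<^sup>2 / 2) / sqrt (tree_fun c))"
    if "3 \<le> k" for k
    using undirected_p_eq[OF that] undirected_limit_prob[OF that] by simp
  have "directed.limit_prob \<sim>[at_top]
     (\<lambda>k. exp (- 1 + 1 / exp 1) / sqrt (2 * pi) * real k powr (- 3 / 2))"
    using directed.limit_prob_asymp unfolding directed_LamInf_inv_e by simp
  \<comment> \<open>The two sequences are identified from length 2 on, which suffices for an
    equivalence at infinity.\<close>
  moreover have "\<forall>\<^sub>F k in at_top. directed_p k = directed.limit_prob k"
    using eventually_ge_at_top[of 2] by eventually_elim (rule directed_p_eq)
  ultimately show "directed_p \<sim>[at_top]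
     (\<lambda>k. exp (- 1 + 1 / exp 1) / sqrt (2 * pi) * real k powr (- 3 / 2))"
    by (blast intro: asymp_equiv_trans asymp_equiv_refl_ev)
  have "undirected.limit_prob \<sim>[at_top]
     (\<lambda>k. exp (- 1 / 2 + 1 / (2 * exp 1) + 1 / (2 * (exp 1)\<^sup>2)) / (2 * sqrt (2 * pi)) *
          real k powr (- 3 / 2))"
    using undirected.limit_prob_asymp unfolding undirected_LamInf_inv_e by simp
  moreover have "\<forall>\<^sub>F k in at_top. undirected_p k = undirected.limit_prob k"
    using eventually_ge_at_top[of 3] by eventually_elim (rule undirected_p_eq)
  ultimately show "undirected_p \<sim>[at_top]
     (\<lambda>k. exp (- 1 / 2 + 1 / (2 * exp 1) + 1 / (2 * (exp 1)\<^sup>2)) / (2 * sqrt (2 * pi)) *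
          real k powr (- 3 / 2))"
    by (blast intro: asymp_equiv_trans asymp_equiv_refl_ev)
  show "(directed_p has_sum (1 - exp (- 1 + 1 / exp 1))) {2..}"
    using directed.limit_prob_has_sum unfolding directed_LamInf_inv_e
    by (rule has_sum_cong[THEN iffD1, rotated]) (simp add: directed_p_eq)
  show "(undirected_p has_sum (1 - exp (- 1 / 2 + 1 / (2 * exp 1) + 1 / (2 * (exp 1)\<^sup>2)))) {3..}"
    using undirected.limit_prob_has_sum unfolding undirected_LamInf_inv_e
    by (rule has_sum_cong[THEN iffD1, rotated]) (simp add: undirected_p_eq)
qed simp_all

end
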